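(* Let $q_1\in C^r[0,b]$ for some $r\in\mathbb N_0=\{0,1,2,\dots\}$. For every $N>r$ let the coefficients $\{a_n\}_{n=0}^N\subset\mathbb C$ and $\{d_n\}_{n=0}^N\subset\mathbb C$ be the least squares solutions (minimizers) of $$\min_{a_0,\dots,a_N}\Bigl\|\frac{f'}{2f}-\sum_{n=0}^N\frac{a_n}{n+1}\,f\Bigl(\frac{\boldsymbol s_{n+1}}{f}\Bigr)'\Bigr\|_{L_2(0,b)}\quad\text{and}\quad\min_{d_0,\dots,d_N}\Bigl\|\frac{f'}{2f}-\sum_{n=0}^N\frac{d_n}{n+1}\,f\Bigl(\frac{\boldsymbol c_{n+1}}{f}\Bigr)'\Bigr\|_{L_2(0,b)},$$ and define approximate kernels $$K_{f,N}=a_0u_0+\sum_{n=1}^Na_nu_{2n-1}+\sum_{n=1}^Nd_nu_{2n},\qquad K_{1/f,N}=-d_0v_0-\sum_{n=1}^Na_nv_{2n}-\sum_{n=1}^Nd_nv_{2n-1}.$$ Then there is a constant $C$, independent of $x$ and $N$, such that for every $x\in[0,b]$ and every $N>r$ $$\|K_f(x,\cdot)-K_{f,N}(x,\cdot)\|_{L_2(-x,x)}<\frac{C}{N^{r+1}},\qquad\|K_{1/f}(x,\cdot)-K_{1/f,N}(x,\cdot)\|_{L_2(-x,x)}<\frac{C}{N^{r+1}}.$$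
   Context: $b>0$; $q_1$ is complex-valued on $[0,b]$; $f$ is a complex-valued solution of $-f''+q_1f=0$ on $[0,b]$, non-vanishing on $[0,b]$, with $f(0)=1$; $h=f'(0)$; $q_2=2(f'/f)^2-q_1$ (the Darboux transformed potential, for which $1/f$ satisfies $-(1/f)''+q_2\,(1/f)=0$). $K_f$ is the integral kernel, on $0\le x\le b$, $|t|\le x$, of the transmutation operator $T_fu(x)=u(x)+\int_{-x}^xK_f(x,t)u(t)dt$ for $-\frac{d^2}{dx^2}+q_1$ and $-\frac{d^2}{dx^2}$: it is the (for merely continuous $q_1$, mild) solution of $\bigl(\partial_x^2-q_1(x)\bigr)K_f=\partial_t^2K_f$, $K_f(x,x)=\frac h2+\frac12\int_0^xq_1(s)ds$, $K_f(x,-x)=\frac h2$; equivalently $H(\xi,\eta)=K_f(\xi+\eta,\xi-\eta)$ is continuous and $H(\xi,\eta)=\frac h2+\frac12\int_0^\xi q_1(s)ds+\int_0^\xi\int_0^\eta q_1(u+v)H(u,v)\,dv\,du$ for $\xi,\eta\ge0$, $\xi+\eta\le b$. $K_{1/f}$ is defined in the same way with $q_1,h$ replaced by $q_2,-h$. Formal powers: $X^{(0)}=\widetilde X^{(0)}\equiv1$, $X^{(n)}(x)=n\int_0^xX^{(n-1)}(s)(f^2(s))^{(-1)^n}ds$, $\widetilde X^{(n)}(x)=n\int_0^x\widetilde X^{(n-1)}(s)(f^2(s))^{(-1)^{n-1}}ds$; $\varphi_k=fX^{(k)}$ for $k$ odd, $\varphi_k=f\widetilde X^{(k)}$ for $k$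 even; $\psi_k=\widetilde X^{(k)}/f$ for $k$ odd, $\psi_k=X^{(k)}/f$ for $k$ even. Generalized wave polynomials: $u_0=\varphi_0(x)$, $v_0=\psi_0(x)$ and for $n\ge1$ $u_{2n-1}(x,t)=\sum_{\text{even }k=0}^n\binom nk\varphi_{n-k}(x)t^k$, $u_{2n}(x,t)=\sum_{\text{odd }k=1}^n\binom nk\varphi_{n-k}(x)t^k$, $v_{2n-1}(x,t)=\sum_{\text{even }k=0}^n\binom nk\psi_{n-k}(x)t^k$, $v_{2n}(x,t)=\sum_{\text{odd }k=1}^n\binom nk\psi_{n-k}(x)t^k$. For $n\ge1$: $\boldsymbol c_n(x)=u_{2n-1}(x,x)$, $\boldsymbol s_n(x)=u_{2n}(x,x)$. *)

theory Defs
  imports "HOL-Analysis.Analysis"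
begin

text \<open>Functions on \<open>[0,b]\<close> are total functions on the reals; their values outside the interval play no
  role, and derivatives on \<open>[0,b]\<close> are one-sided at the end points.\<close>

primrec Cr_on :: "nat \<Rightarrow> real set \<Rightarrow> (real \<Rightarrow> complex) \<Rightarrow> bool" where
  "Cr_on 0 S g \<longleftrightarrow> continuous_on S g"
| "Cr_on (Suc r) S g \<longleftrightarrow>
     (\<exists>g'. (\<forall>x\<in>S. (g has_vector_derivative g' x) (at x within S)) \<and> Cr_on r S g')"

text \<open>Applied only to functions continuous on \<open>[a,b]\<close>, so the integral below always exists.\<close>

definition L2_norm :: "real \<Rightarrow> real \<Rightarrow> (real \<Rightarrow> complex) \<Rightarrow> real" where
  "L2_norm a b g = sqrt (LINT x:{a<..<b}|lborel. (cmod (g x))\<^sup>2)"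

definition darboux_potential ::
  "(real \<Rightarrow> complex) \<Rightarrow> (real \<Rightarrow> complex) \<Rightarrow> (real \<Rightarrow> complex) \<Rightarrow> real \<Rightarrow> complex" where
  "darboux_potential q f f' x = 2 * (f' x / f x)\<^sup>2 - q x"

text \<open>The mild (integral equation) form of the Goursat problem
  \<open>(\<partial>\<^sub>x\<^sup>2 - q(x)) K = \<partial>\<^sub>t\<^sup>2 K\<close>, \<open>K(x,x) = h/2 + 1/2 \<integral>\<^sub>0\<^sup>x q\<close>, \<open>K(x,-x) = h/2\<close> in the characteristic variables
  \<open>x = \<xi> + \<eta>\<close>, \<open>t = \<xi> - \<eta>\<close>. It determines \<open>K(x,t)\<close> for \<open>0 \<le> x \<le> b\<close>, \<open>\<bar>t\<bar> \<le> x\<close> and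
  says nothing about other arguments.\<close>

definition transmutation_kernel ::
  "real \<Rightarrow> (real \<Rightarrow> complex) \<Rightarrow> complex \<Rightarrow> (real \<Rightarrow> real \<Rightarrow> complex) \<Rightarrow> bool" where
  "transmutation_kernel b q h K \<longleftrightarrow>
     (let H = (\<lambda>\<xi> \<eta>. K (\<xi> + \<eta>) (\<xi> - \<eta>)) in
        continuous_on {(\<xi>, \<eta>). 0 \<le> \<xi> \<and> 0 \<le> \<eta> \<and> \<xi> + \<eta> \<le> b} (\<lambda>(\<xi>, \<eta>). H \<xi> \<eta>) \<and>
        (\<forall>\<xi> \<eta>. 0 \<le> \<xi> \<and> 0 \<le> \<eta> \<and> \<xi> + \<eta> \<le> b \<longrightarrow>
           H \<xi> \<eta> = h / 2 + integral {0..\<xi>} q / 2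
                 + integral {0..\<xi>} (\<lambda>u. integral {0..\<eta>} (\<lambda>v. q (u + v) * H u v))))"

primrec formal_X :: "(real \<Rightarrow> complex) \<Rightarrow> nat \<Rightarrow> real \<Rightarrow> complex" where
  "formal_X f 0 = (\<lambda>x. 1)"
| "formal_X f (Suc n) = (\<lambda>x. of_nat (Suc n) *
     integral {0..x} (\<lambda>s. formal_X f n s * ((f s)\<^sup>2) powi ((-1) ^ Suc n)))"

primrec formal_Xt :: "(real \<Rightarrow> complex) \<Rightarrow> nat \<Rightarrow> real \<Rightarrow> complex" where
  "formal_Xt f 0 = (\<lambda>x. 1)"
| "formal_Xt f (Suc n) = (\<lambda>x. of_nat (Suc n) *
     integral {0..x} (\<lambda>s. formal_Xt f n s * ((f s)\<^sup>2) powi ((-1) ^ n)))"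

definition phi :: "(real \<Rightarrow> complex) \<Rightarrow> nat \<Rightarrow> real \<Rightarrow> complex" where
  "phi f k x = (if odd k then f x * formal_X f k x else f x * formal_Xt f k x)"

definition psi :: "(real \<Rightarrow> complex) \<Rightarrow> nat \<Rightarrow> real \<Rightarrow> complex" where
  "psi f k x = (if odd k then formal_Xt f k x / f x else formal_X f k x / f x)"

text \<open>\<open>wave_poly p\<close> is the family \<open>w\<^sub>0 = p\<^sub>0(x)\<close>,
  \<open>w\<^bsub>2n-1\<^esub> = \<Sum>\<^bsub>even k \<le> n\<^esub> (n choose k) p\<^bsub>n-k\<^esub>(x) t\<^sup>k\<close>, \<open>w\<^bsub>2n\<^esub> = \<Sum>\<^bsub>odd k \<le> n\<^esub> (n choose k) p\<^bsub>n-k\<^esub>(x) t\<^sup>k\<close>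
  for \<open>n \<ge> 1\<close>; an odd index \<open>m = 2n - 1\<close> has \<open>n = (m + 1) div 2\<close>.\<close>

definition wave_poly :: "(nat \<Rightarrow> real \<Rightarrow> complex) \<Rightarrow> nat \<Rightarrow> real \<Rightarrow> real \<Rightarrow> complex" where
  "wave_poly p m x t =
     (if m = 0 then p 0 x
      else if odd m then
        let n = (m + 1) div 2
        in \<Sum>k\<in>{k\<in>{0..n}. even k}. of_nat (n choose k) * p (n - k) x * of_real t ^ k
      else
        let n = m div 2
        in \<Sum>k\<in>{k\<in>{1..n}. odd k}. of_nat (n choose k) * p (n - k) x * of_real t ^ k)"

lemma wave_poly_0: "wave_poly p 0 x t = p 0 x"
  by (simp add: wave_poly_def)

lemma wave_poly_odd_index:
  assumes "n \<ge> 1"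
  shows "wave_poly p (2 * n - 1) x t =
    (\<Sum>k\<in>{k\<in>{0..n}. even k}. of_nat (n choose k) * p (n - k) x * of_real t ^ k)"
  using assms by (auto simp: wave_poly_def Let_def)

lemma wave_poly_even_index:
  assumes "n \<ge> 1"
  shows "wave_poly p (2 * n) x t =
    (\<Sum>k\<in>{k\<in>{1..n}. odd k}. of_nat (n choose k) * p (n - k) x * of_real t ^ k)"
  using assms by (auto simp: wave_poly_def Let_def)

definition u_poly :: "(real \<Rightarrow> complex) \<Rightarrow> nat \<Rightarrow> real \<Rightarrow> real \<Rightarrow> complex" where
  "u_poly f = wave_poly (phi f)"

definition v_poly :: "(real \<Rightarrow> complex) \<Rightarrow> nat \<Rightarrow> real \<Rightarrow> real \<Rightarrow> complex" where
  "v_poly f = wave_poly (psi f)"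

text \<open>Only used for \<open>n \<ge> 1\<close>.\<close>

definition c_trace :: "(real \<Rightarrow> complex) \<Rightarrow> nat \<Rightarrow> real \<Rightarrow> complex" where
  "c_trace f n x = u_poly f (2 * n - 1) x x"

definition s_trace :: "(real \<Rightarrow> complex) \<Rightarrow> nat \<Rightarrow> real \<Rightarrow> complex" where
  "s_trace f n x = u_poly f (2 * n) x x"

text \<open>The least squares functional of a coefficient sequence \<open>a\<close>, of which only \<open>a 0, \<dots>, a N\<close> matter;
  \<open>w\<close> stands for \<open>s_trace f\<close> or \<open>c_trace f\<close>.\<close>

definition ls_residual ::
  "real \<Rightarrow> (real \<Rightarrow> complex) \<Rightarrow> (real \<Rightarrow> complex) \<Rightarrow> (nat \<Rightarrow> real \<Rightarrow> complex) \<Rightarrow> nat \<Rightarrow>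
    (nat \<Rightarrow> complex) \<Rightarrow> real" where
  "ls_residual b f f' w N a =
     L2_norm 0 b (\<lambda>x. f' x / (2 * f x) -
       (\<Sum>n=0..N. a n / of_nat (n + 1) *
          (f x * vector_derivative (\<lambda>y. w (n + 1) y / f y) (at x within {0..b}))))"

definition least_squares_solution ::
  "real \<Rightarrow> (real \<Rightarrow> complex) \<Rightarrow> (real \<Rightarrow> complex) \<Rightarrow> (nat \<Rightarrow> real \<Rightarrow> complex) \<Rightarrow> nat \<Rightarrow>
    (nat \<Rightarrow> complex) \<Rightarrow> bool" where
  "least_squares_solution b f f' w N a \<longleftrightarrow> is_arg_min (ls_residual b f f' w N) (\<lambda>_. True) a"

definition approx_K_f ::
  "(real \<Rightarrow> complex) \<Rightarrow> nat \<Rightarrow> (nat \<Rightarrow> complex) \<Rightarrow> (nat \<Rightarrow> complex) \<Rightarrow> real \<Rightarrow> real \<Rightarrow> complex" where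
  "approx_K_f f N a d x t =
     a 0 * u_poly f 0 x t + (\<Sum>n=1..N. a n * u_poly f (2 * n - 1) x t)
       + (\<Sum>n=1..N. d n * u_poly f (2 * n) x t)"

definition approx_K_inv_f ::
  "(real \<Rightarrow> complex) \<Rightarrow> nat \<Rightarrow> (nat \<Rightarrow> complex) \<Rightarrow> (nat \<Rightarrow> complex) \<Rightarrow> real \<Rightarrow> real \<Rightarrow> complex" where
  "approx_K_inv_f f N a d x t =
     - d 0 * v_poly f 0 x t - (\<Sum>n=1..N. a n * v_poly f (2 * n) x t)
       - (\<Sum>n=1..N. d n * v_poly f (2 * n - 1) x t)"

end

theory Submission
  imports Defs "HOL-Computational_Algebra.Polynomial"
begin

text \<open>Put \<open>p = f'/f\<close>. The sum \<open>s\<close> and the difference \<open>m\<close> of \<open>K\<^sub>f\<close> and \<open>K\<^bsub>1/f\<^esub>\<close> satisfy the first order system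
  \<open>(\<partial>\<^sub>x + \<partial>\<^sub>t) s = p m\<close>, \<open>(\<partial>\<^sub>x - \<partial>\<^sub>t) m = p s\<close> with \<open>m = p\<close> on \<open>t = x\<close> and \<open>s = 0\<close> on \<open>t = -x\<close>, and so do the sum and the
  difference of the two approximate kernels, up to the boundary values. On the two characteristics the
  differences of the boundary values are \<open>\<epsilon>\<^sub>1 + \<epsilon>\<^sub>2\<close> and \<open>\<epsilon>\<^sub>1 - \<epsilon>\<^sub>2\<close>, where \<open>\<epsilon>\<^sub>1, \<epsilon>\<^sub>2\<close> are the residuals of the two least squares problems, so that
  the kernel errors are bounded by the minima. To bound a minimum, let \<open>L Q\<close> be the trace on \<open>t = x\<close> of
  the solution of the system generated by the polynomial \<open>Q\<close> as initial value on \<open>x = 0\<close>. Its derivative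
  is \<open>2 L' Q'\<close> up to lower order terms, where \<open>L'\<close> belongs to \<open>-p\<close>, and \<open>L\<close> has dense range with
  bounded preimages since the trace problem is solvable for continuous data. Hence a function of class
  \<open>C\<^sup>k\<close> is a limit of traces \<open>L Q\<close> with \<open>Q\<^bsup>(k)\<^esup>\<close> bounded, and truncating the Chebyshev expansion of \<open>Q\<close> at
  degree \<open>N\<close> costs only \<open>O(N\<^bsup>-k\<^esup>)\<close> in the \<open>L\<^sub>2\<close> norm.\<close>

text \<open>The exponent \<open>r + 1\<close> comes from the Riccati equation
  \<open>p' = q1 - p^2\<close>: the common target \<open>p / 2\<close> of both problems is one class
  smoother than \<open>q1\<close>. The hypothesis \<open>N > r\<close> is the condition
  \<open>k \<le> n\<close> of the degree reduction with \<open>k = r + 1\<close>. The obstacle is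
  that solving the trace problem yields an initial value known only to be continuous, whose
  polynomial approximants have uncontrolled degree. So nothing is asked of \<open>Q\<close> except a
  bound on one derivative, uniform in the accuracy; the rate comes from truncation alone, whose cost
  depends on \<open>Q\<close> only through that derivative. The Chebyshev weight is used because
  differentiation in the angle turns cosines into sines and both families are orthogonal. The
  interval is \<open>[-2b, 2b]\<close> because the characteristic through \<open>(x, x)\<close>
  meets \<open>x = 0\<close> at \<open>t = 2x\<close>, and the reflection \<open>c -> 2y - c\<close>
  in the integral equation reaches down to \<open>-2b\<close>. All Volterra bounds use one device:
  with an exponential weight of rate \<open>l = 2 * Mp + 1\<close> the integral term costs at most
  half the supremum and can be absorbed.\<close>

section \<open>Elementary tools for integrals, derivatives and norms\<close>

text \<open>This takes the place of Gronwall's inequality: a bound that reproduces itself at half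
  its size can be absorbed once the supremum is known to be finite, which is what \<open>bdd\<close>
  supplies.\<close>

lemma sup_halving:
  fixes W :: "'a \<Rightarrow> real"
  assumes bdd: "\<And>z. z \<in> S \<Longrightarrow> W z \<le> B0" and c: "0 \<le> c"
    and step: "\<And>B z. 0 \<le> B \<Longrightarrow> (\<And>z. z \<in> S \<Longrightarrow> W z \<le> B) \<Longrightarrow> z \<in> S \<Longrightarrow> W z \<le> c + B / 2"
    and z: "z \<in> S"
  shows "W z \<le> 2 * c"
proof -
  \<comment> \<open>The maximum with \<open>2 * c\<close> makes \<open>B\<close> nonnegative, as
    \<open>step\<close> demands, whatever the sign of the supremum.\<close>
  define B where "B = max (2 * c) (SUP z\<in>S. W z)"
  have bd: "bdd_above (W ` S)" using bdd by (auto simp: bdd_above_def)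
  have "W z \<le> B" if "z \<in> S" for z
    unfolding B_def using cSUP_upper[OF that bd] by linarith
  moreover have "0 \<le> B" using c by (auto simp: B_def)
  ultimately have *: "W z \<le> c + B / 2" if "z \<in> S" for z using step that by blast
  have "(SUP z\<in>S. W z) \<le> c + B / 2"
    using z * by (intro cSUP_least) auto
  then have "B \<le> 2 * c" by (auto simp: B_def max_def split: if_splits)
  then show ?thesis using *[OF z] by linarith
qed

lemma exp_has_integral:
  fixes l :: real
  assumes "l > 0" "0 \<le> x"
  shows "((\<lambda>y. exp (l * y)) has_integral (exp (l * x) - 1) / l) {0..x}"
proof -
  have "((\<lambda>y. exp (l * y)) has_integral (exp (l * x) / l - exp (l * 0) / l)) {0..x}"
    using assms
    by (intro fundamental_theorem_of_calculus)
       (auto intro!: derivative_eq_intros simp: has_real_derivative_iff_has_vector_derivative[symmetric])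
  then show ?thesis by (simp add: diff_divide_distrib)
qed

lemma has_vector_derivative_translate:
  assumes "(f has_vector_derivative d) (at (k + v) within {0..b})" "0 \<le> k" "k + y \<le> b"
  shows "((\<lambda>v. f (k + v)) has_vector_derivative d) (at v within {0..y})"
proof -
  have 1: "((\<lambda>v. k + v) has_vector_derivative 1) (at v within {0..y})"
    by (auto intro!: derivative_eq_intros)
  have "(f has_vector_derivative d) (at (k + v) within (\<lambda>v. k + v) ` {0..y})"
    using assms by (intro has_vector_derivative_within_subset[OF assms(1)]) auto
  from vector_diff_chain_within[OF 1 this] show ?thesis by (simp add: o_def)
qed

lemma has_vector_derivative_inverse:
  fixes f :: "real \<Rightarrow> complex"
  assumes "(f has_vector_derivative f') (at x within S)" "f x \<noteq> 0"
  shows "((\<lambda>x. inverse (f x)) has_vector_derivative - (f' / (f x)\<^sup>2)) (at x within S)"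
proof -
  have "(inverse has_field_derivative - (inverse (f x) ^ Suc (Suc 0))) (at (f x) within f ` S)"
    using assms(2) by (rule DERIV_inverse)
  from field_vector_diff_chain_within[OF assms(1) this]
  show ?thesis by (simp add: o_def divide_inverse power2_eq_square mult_ac)
qed

text \<open>The end points are null, so the Lebesgue integral over the open interval turns into the
  gauge integral over the closed one, in which all estimates are carried out.\<close>

lemma L2_norm_continuous:
  assumes "a \<le> b" "continuous_on {a..b} g"
  shows "L2_norm a b g = sqrt (integral {a..b} (\<lambda>x. (cmod (g x))\<^sup>2))"
proof -
  have "continuous_on {a..b} (\<lambda>x. (cmod (g x))\<^sup>2)" using assms by (intro continuous_intros)
  then have "set_integrable lborel {a..b} (\<lambda>x. (cmod (g x))\<^sup>2)"
    by (rule borel_integrable_atLeastAtMost')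
  then have "set_integrable lborel {a<..<b} (\<lambda>x. (cmod (g x))\<^sup>2)"
    by (rule set_integrable_subset) auto
  then show ?thesis
    unfolding L2_norm_def by (simp add: set_borel_integral_eq_integral(2) integral_open_interval_real)
qed

lemma L2_norm_cong:
  assumes "\<And>x. a < x \<Longrightarrow> x < b \<Longrightarrow> g x = h x"
  shows "L2_norm a b g = L2_norm a b h"
  unfolding L2_norm_def
  by (rule arg_cong[where f = sqrt], rule set_lebesgue_integral_cong) (use assms in auto)

lemma Cauchy_Schwarz_integral:
  fixes g :: "real \<Rightarrow> real"
  assumes "a \<le> b" "continuous_on {a..b} g"
  shows "(integral {a..b} g)\<^sup>2 \<le> (b - a) * integral {a..b} (\<lambda>x. (g x)\<^sup>2)"
proof (cases "a = b")
  case False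
  define I where "I = integral {a..b} g"
  \<comment> \<open>The mean of \<open>g\<close>; the inequality is the nonnegativity of the
    integral of \<open>(g - c)^2\<close>.\<close>
  define c where "c = I / (b - a)"
  have ig: "g integrable_on {a..b}" using assms by (intro integrable_continuous_real)
  have ig2: "(\<lambda>x. (g x)\<^sup>2) integrable_on {a..b}"
    using assms by (intro integrable_continuous_real continuous_intros)
  have "((\<lambda>x. (g x)\<^sup>2 - 2 * c * g x + c\<^sup>2) has_integral
      (integral {a..b} (\<lambda>x. (g x)\<^sup>2) - 2 * c * I + (b - a) * c\<^sup>2)) {a..b}"
    using assms has_integral_const_real[of "c\<^sup>2" a b]
    by (intro has_integral_add has_integral_diff has_integral_mult_right)
       (auto simp: ig ig2 integrable_integral I_def)
  moreover have "(g x)\<^sup>2 - 2 * c * g x + c\<^sup>2 \<ge> 0" for x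
    using zero_le_power2[of "g x - c"] by (simp add: power2_diff algebra_simps)
  ultimately have "0 \<le> integral {a..b} (\<lambda>x. (g x)\<^sup>2) - 2 * c * I + (b - a) * c\<^sup>2"
    by (meson has_integral_nonneg)
  then have "0 \<le> (b - a) * (integral {a..b} (\<lambda>x. (g x)\<^sup>2) - 2 * c * I + (b - a) * c\<^sup>2)"
    using assms by simp
  also have "\<dots> = (b - a) * integral {a..b} (\<lambda>x. (g x)\<^sup>2) - I\<^sup>2"
  proof -
    have "c * (b - a) = I" using False by (simp add: c_def)
    moreover have "(b - a) * (X - 2 * c * I + (b - a) * c\<^sup>2) = (b - a) * X - 2 * (c * (b - a)) * I + (c * (b - a))\<^sup>2" for X
      by (simp add: power2_eq_square algebra_simps)
    ultimately show ?thesis by (simp add: power2_eq_square)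
  qed
  finally show ?thesis by (simp add: I_def)
qed auto

section \<open>Polynomial approximation in the Chebyshev norm\<close>

text \<open>Parseval's identity, \<open>w i\<close> being the squared norm of \<open>e i\<close>.
  The family is real, so the real and imaginary parts of the coefficients separate and each squared
  sum keeps only its diagonal.\<close>

lemma integral_norm_sum_orthogonal:
  fixes e :: "'i \<Rightarrow> real \<Rightarrow> real" and \<alpha> :: "'i \<Rightarrow> complex"
  assumes F: "finite F"
    and orth: "\<And>i j. i \<in> F \<Longrightarrow> j \<in> F \<Longrightarrow> ((\<lambda>x. e i x * e j x) has_integral (if i = j then w i else 0)) S"
  shows "((\<lambda>x. (cmod (\<Sum>i\<in>F. \<alpha> i * e i x))\<^sup>2) has_integral (\<Sum>i\<in>F. w i * (cmod (\<alpha> i))\<^sup>2)) S"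
proof -
  have *: "((\<lambda>x. (\<Sum>i\<in>F. r i * e i x)\<^sup>2) has_integral (\<Sum>i\<in>F. w i * (r i)\<^sup>2)) S" for r
  proof -
    have "((\<lambda>x. \<Sum>i\<in>F. \<Sum>j\<in>F. (r i * r j) * (e i x * e j x)) has_integral
        (\<Sum>i\<in>F. \<Sum>j\<in>F. (r i * r j) * (if i = j then w i else 0))) S"
      using orth by (intro has_integral_sum F has_integral_mult_right) auto
    moreover have "(\<Sum>i\<in>F. \<Sum>j\<in>F. (r i * r j) * (if i = j then w i else 0)) = (\<Sum>i\<in>F. w i * (r i)\<^sup>2)"
      using F by (intro sum.cong refl) (simp add: if_distrib sum.delta power2_eq_square cong: if_cong)
    moreover have "(\<Sum>i\<in>F. r i * e i x)\<^sup>2 = (\<Sum>i\<in>F. \<Sum>j\<in>F. (r i * r j) * (e i x * e j x))" for x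
      by (simp add: power2_eq_square sum_product mult_ac)
    ultimately show ?thesis by simp
  qed
  have "(cmod (\<Sum>i\<in>F. \<alpha> i * e i x))\<^sup>2 = (\<Sum>i\<in>F. Re (\<alpha> i) * e i x)\<^sup>2 + (\<Sum>i\<in>F. Im (\<alpha> i) * e i x)\<^sup>2" for x
    by (simp add: cmod_power2)
  moreover have "(\<Sum>i\<in>F. w i * (cmod (\<alpha> i))\<^sup>2) = (\<Sum>i\<in>F. w i * (Re (\<alpha> i))\<^sup>2) + (\<Sum>i\<in>F. w i * (Im (\<alpha> i))\<^sup>2)"
    by (simp add: cmod_power2 algebra_simps sum.distrib)
  ultimately show ?thesis
    using has_integral_add[OF *[of "\<lambda>i. Re (\<alpha> i)"] *[of "\<lambda>i. Im (\<alpha> i)"]] by simp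
qed

text \<open>The frequency is an integer because the product formulas below produce differences of
  indices.\<close>

lemma cos_int_has_integral:
  "((\<lambda>x. cos (of_int m * x)) has_integral (if m = 0 then pi else 0)) {0..pi}"
proof (cases "m = 0")
  case True
  then show ?thesis using has_integral_const_real[of "1::real" 0 pi] by simp
next
  case False
  have "((\<lambda>x. cos (of_int m * x)) has_integral
      (sin (of_int m * pi) / of_int m - sin (of_int m * 0) / of_int m)) {0..pi}"
    using False
    by (intro fundamental_theorem_of_calculus)
       (auto intro!: derivative_eq_intros simp: has_real_derivative_iff_has_vector_derivative[symmetric])
  then show ?thesis using False sin_npi_int[of m] by (simp add: mult.commute)
qed

lemma cos_cos_has_integral:
  fixes i j :: nat
  shows "((\<lambda>x. cos (real i * x) * cos (real j * x)) has_integral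
    (if i = j then (if i = 0 then pi else pi / 2) else 0)) {0..pi}"
proof -
  have "((\<lambda>x. (1/2) * cos (of_int (int i - int j) * x) + (1/2) * cos (of_int (int i + int j) * x)) has_integral
     (1/2) * (if int i - int j = 0 then pi else 0) + (1/2) * (if int i + int j = 0 then pi else 0)) {0..pi}"
    by (intro has_integral_add has_integral_mult_right cos_int_has_integral)
  moreover have "(1/2) * cos (of_int (int i - int j) * x) + (1/2) * cos (of_int (int i + int j) * x)
      = cos (real i * x) * cos (real j * x)" for x
    by (simp add: ring_distribs cos_add cos_diff)
  moreover have "(1/2) * (if int i - int j = 0 then pi else 0) + (1/2) * (if int i + int j = 0 then pi else 0)
      = (if i = j then (if i = 0 then pi else pi / 2) else 0)"
    by auto
  ultimately show ?thesis by (simp only:)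
qed

lemma sin_sin_has_integral:
  fixes i j :: nat
  shows "((\<lambda>x. sin (real i * x) * sin (real j * x)) has_integral
    (if i = j then (if i = 0 then 0 else pi / 2) else 0)) {0..pi}"
proof -
  have "((\<lambda>x. (1/2) * cos (of_int (int i - int j) * x) - (1/2) * cos (of_int (int i + int j) * x)) has_integral
     (1/2) * (if int i - int j = 0 then pi else 0) - (1/2) * (if int i + int j = 0 then pi else 0)) {0..pi}"
    by (intro has_integral_diff has_integral_mult_right cos_int_has_integral)
  moreover have "(1/2) * cos (of_int (int i - int j) * x) - (1/2) * cos (of_int (int i + int j) * x)
      = sin (real i * x) * sin (real j * x)" for x
    by (simp add: ring_distribs cos_add cos_diff)
  moreover have "(1/2) * (if int i - int j = 0 then pi else 0) - (1/2) * (if int i + int j = 0 then pi else 0)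
      = (if i = j then (if i = 0 then 0 else pi / 2) else 0)"
    by auto
  ultimately show ?thesis by (simp only:)
qed

text \<open>With \<open>z = R * cos \<theta>\<close> this is the squared \<open>L2\<close> norm on
  \<open>[-R, R]\<close> for the Chebyshev weight \<open>1 / sqrt (R^2 - z^2)\<close>.\<close>

definition cheb_sq :: "real \<Rightarrow> complex poly \<Rightarrow> real" where
  "cheb_sq R Q = integral {0..pi} (\<lambda>\<theta>. (cmod (poly Q (of_real (R * cos \<theta>))))\<^sup>2)"

lemma Chebyshev_poly_exists:
  assumes "R > 0"
  shows "\<exists>T :: complex poly. degree T \<le> n \<and> (\<forall>\<theta>. poly T (of_real (R * cos \<theta>)) = of_real (cos (real n * \<theta>)))"
proof (induction n rule: less_induct)
  case (less n)
  consider "n = 0" | "n = 1" | m where "n = Suc (Suc m)" by (metis One_nat_def not0_implies_Suc)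
  then show ?case
  proof cases
    case 1
    then show ?thesis by (intro exI[of _ 1]) auto
  next
    case 2
    then show ?thesis using assms by (intro exI[of _ "[:0, of_real (1 / R):]"]) auto
  next
    case (3 m)
    obtain T0 :: "complex poly" where T0: "degree T0 \<le> m"
      "\<And>\<theta>. poly T0 (of_real (R * cos \<theta>)) = of_real (cos (real m * \<theta>))"
      using less[of m] 3 by auto
    obtain T1 :: "complex poly" where T1: "degree T1 \<le> Suc m"
      "\<And>\<theta>. poly T1 (of_real (R * cos \<theta>)) = of_real (cos (real (Suc m) * \<theta>))"
      using less[of "Suc m"] 3 by auto
    \<comment> \<open>The three term recursion of the Chebyshev polynomials, rescaled to
      \<open>[-R, R]\<close>.\<close>
    let ?T = "[:0, of_real (2 / R):] * T1 - T0"
    have "degree ([:0, of_real (2 / R):] * T1) \<le> Suc (Suc m)"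
      using degree_mult_le[of "[:0, of_real (2 / R):]" T1] T1(1) assms by simp
    then have "degree ?T \<le> n" using 3 T0(1) by (intro degree_diff_le) auto
    moreover have "poly ?T (of_real (R * cos \<theta>)) = of_real (cos (real n * \<theta>))" for \<theta>
    proof -
      have e: "real n * \<theta> = real (Suc m) * \<theta> + \<theta>" "real m * \<theta> = real (Suc m) * \<theta> - \<theta>"
        using 3 by (auto simp: algebra_simps)
      have c: "cos (real n * \<theta>) = 2 * cos \<theta> * cos (real (Suc m) * \<theta>) - cos (real m * \<theta>)"
        unfolding e cos_add cos_diff by simp
      have "poly [:0, complex_of_real (2 / R):] (of_real (R * cos \<theta>)) = of_real (2 * cos \<theta>)"
        using assms by simp
      then show ?thesis
        by (simp only: poly_diff poly_mult T0(2) T1(2) c) simp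
    qed
    ultimately show ?thesis by blast
  qed
qed

text \<open>The Chebyshev expansions seen in the angle variable. Closure under sums and under
  multiplication by \<open>cos \<theta>\<close> yields the expansion of every polynomial without
  computing its coefficients.\<close>

definition cosine_sum :: "(real \<Rightarrow> complex) \<Rightarrow> bool" where
  "cosine_sum F \<longleftrightarrow> (\<exists>M \<alpha>. \<forall>\<theta>. F \<theta> = (\<Sum>k\<le>(M::nat). \<alpha> k * of_real (cos (real k * \<theta>))))"

lemma cosine_sum_add:
  assumes "cosine_sum F" "cosine_sum G"
  shows "cosine_sum (\<lambda>\<theta>. F \<theta> + G \<theta>)"
proof -
  obtain M \<alpha> N \<beta> where F: "\<And>\<theta>. F \<theta> = (\<Sum>k\<le>(M::nat). \<alpha> k * of_real (cos (real k * \<theta>)))"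
    and G: "\<And>\<theta>. G \<theta> = (\<Sum>k\<le>(N::nat). \<beta> k * of_real (cos (real k * \<theta>)))"
    using assms unfolding cosine_sum_def by metis
  have 1: "F \<theta> = (\<Sum>k\<le>max M N. (if k \<le> M then \<alpha> k else 0) * of_real (cos (real k * \<theta>)))" for \<theta>
    unfolding F by (rule sum.mono_neutral_cong_left) auto
  have 2: "G \<theta> = (\<Sum>k\<le>max M N. (if k \<le> N then \<beta> k else 0) * of_real (cos (real k * \<theta>)))" for \<theta>
    unfolding G by (rule sum.mono_neutral_cong_left) auto
  show ?thesis
    unfolding cosine_sum_def 1 2 sum.distrib[symmetric] distrib_right[symmetric]
    by (intro exI[of _ "max M N"] exI[of _ "\<lambda>k. (if k \<le> M then \<alpha> k else 0) + (if k \<le> N then \<beta> k else 0)"]) simp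
qed

lemma cosine_sum_cos: "cosine_sum (\<lambda>\<theta>. a * of_real (cos (real k * \<theta>)))"
proof -
  have "a * of_real (cos (real k * \<theta>)) = (\<Sum>j\<le>k. (if j = k then a else 0) * of_real (cos (real j * \<theta>)))" for \<theta>
    by (simp add: if_distrib[of "\<lambda>u. u * _"] sum.delta cong: if_cong)
  then show ?thesis unfolding cosine_sum_def by metis
qed

lemma cosine_sum_sum:
  assumes "finite A" "\<And>i. i \<in> A \<Longrightarrow> cosine_sum (F i)"
  shows "cosine_sum (\<lambda>\<theta>. \<Sum>i\<in>A. F i \<theta>)"
  using assms
proof (induction A rule: finite_induct)
  case empty
  then show ?case using cosine_sum_cos[of 0 0] by simp
qed (auto intro: cosine_sum_add)

text \<open>Multiplication by the variable is multiplication by \<open>R * cos \<theta>\<close>,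
  which sends a cosine to \<open>R\<close> times the mean of its two neighbours in frequency; hence
  Horner's scheme stays inside the cosine sums.\<close>

lemma cosine_sum_poly: "cosine_sum (\<lambda>\<theta>. poly Q (of_real (R * cos \<theta>)))"
proof (induction Q)
  case 0
  then show ?case using cosine_sum_cos[of 0 0] by simp
next
  case (pCons a Q)
  obtain M \<alpha> where Q: "\<And>\<theta>. poly Q (of_real (R * cos \<theta>)) = (\<Sum>k\<le>(M::nat). \<alpha> k * of_real (cos (real k * \<theta>)))"
    using pCons.IH unfolding cosine_sum_def by blast
  have *: "cosine_sum (\<lambda>\<theta>. c * of_real (cos \<theta> * cos (real k * \<theta>)))" for c k
  proof (cases k)
    case 0
    then show ?thesis using cosine_sum_cos[of c 1] by simp
  next
    case (Suc j)
    have "cos \<theta> * cos (real k * \<theta>) = cos (real j * \<theta>) / 2 + cos (real (Suc k) * \<theta>) / 2" for \<theta>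
    proof -
      have e: "real j * \<theta> = real k * \<theta> - \<theta>" "real (Suc k) * \<theta> = real k * \<theta> + \<theta>"
        using Suc by (auto simp: algebra_simps)
      show ?thesis unfolding e(1) cos_diff unfolding e(2) cos_add by (simp add: field_simps)
    qed
    then have "(\<lambda>\<theta>. c * of_real (cos \<theta> * cos (real k * \<theta>))) = (\<lambda>\<theta>. (c/2) * of_real (cos (real j * \<theta>)) + (c/2) * of_real (cos (real (Suc k) * \<theta>)))"
      by (auto simp: algebra_simps)
    then show ?thesis by (simp only: cosine_sum_add cosine_sum_cos)
  qed
  have "poly (pCons a Q) (of_real (R * cos \<theta>)) =
      a * of_real (cos (real 0 * \<theta>)) + (\<Sum>k\<le>M. (of_real R * \<alpha> k) * of_real (cos \<theta> * cos (real k * \<theta>)))" for \<theta>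
    by (simp only: poly_pCons Q) (simp add: sum_distrib_left mult_ac)
  then show ?case
    by (simp only:) (intro cosine_sum_add cosine_sum_cos cosine_sum_sum * finite_atMost)
qed

text \<open>\<open>q\<close> is the Chebyshev expansion of \<open>Q\<close> cut at degree
  \<open>n\<close>. Differentiation in the angle multiplies the coefficient of index
  \<open>k\<close> by \<open>k\<close> and produces orthogonal sines, so by Parseval the remaining
  indices \<open>k > n\<close> gain a factor \<open>1 / (n + 1)\<close>.\<close>

lemma cheb_sq_approx_step:
  assumes R: "R > 0"
  shows "\<exists>q. degree q \<le> n \<and> cheb_sq R (Q - q) \<le> (R / real (Suc n))\<^sup>2 * cheb_sq R (pderiv Q)"
proof -
  obtain M \<alpha> where Q: "\<And>\<theta>. poly Q (of_real (R * cos \<theta>)) = (\<Sum>k\<le>(M::nat). \<alpha> k * of_real (cos (real k * \<theta>)))"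
    using cosine_sum_poly unfolding cosine_sum_def by metis
  obtain T :: "nat \<Rightarrow> complex poly" where T: "\<And>n. degree (T n) \<le> n"
    "\<And>n \<theta>. poly (T n) (of_real (R * cos \<theta>)) = of_real (cos (real n * \<theta>))"
    using Chebyshev_poly_exists[OF R] by metis
  define q where "q = (\<Sum>k\<in>{..M} \<inter> {..n}. smult (\<alpha> k) (T k))"
  have deg: "degree q \<le> n"
    unfolding q_def by (intro degree_sum_le) (auto intro: order_trans[OF degree_smult_le] order_trans[OF T(1)])
  have "poly (Q - q) (of_real (R * cos \<theta>)) = (\<Sum>k\<in>{..M} - {..n}. \<alpha> k * of_real (cos (real k * \<theta>)))" for \<theta>
    using sum.Int_Diff[of "{..M}" "\<lambda>k. \<alpha> k * of_real (cos (real k * \<theta>))" "{..n}"]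
    by (simp only: poly_diff Q q_def poly_sum poly_smult T) (simp add: poly_sum)
  then have diff: "cheb_sq R (Q - q) = (\<Sum>k\<in>{..M} - {..n}. pi / 2 * (cmod (\<alpha> k))\<^sup>2)"
        unfolding cheb_sq_def
    by (simp only:)
       (intro integral_unique integral_norm_sum_orthogonal has_integral_eq_rhs[OF cos_cos_has_integral], auto)
  \<comment> \<open>The chain rule gives one form of the angular derivative, termwise
    differentiation of the cosine sum the other.\<close>
  have der: "of_real (R * sin \<theta>) * poly (pderiv Q) (of_real (R * cos \<theta>)) =
      (\<Sum>k\<le>M. (of_nat k * \<alpha> k) * of_real (sin (real k * \<theta>)))" for \<theta>
  proof -
    have 1: "((\<lambda>\<theta>. poly Q (of_real (R * cos \<theta>))) has_vector_derivative
       (of_real (- (R * sin \<theta>)) * poly (pderiv Q) (of_real (R * cos \<theta>)))) (at \<theta>)"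
    proof -
      have "((\<lambda>\<theta>. complex_of_real (R * cos \<theta>)) has_vector_derivative of_real (- (R * sin \<theta>))) (at \<theta>)"
        by (intro has_vector_derivative_of_real derivative_eq_intros) (auto intro!: derivative_eq_intros)
      from field_vector_diff_chain_at[OF this poly_DERIV[of Q]] show ?thesis by (simp add: o_def)
    qed
    have 2: "((\<lambda>\<theta>. \<Sum>k\<le>M. \<alpha> k * of_real (cos (real k * \<theta>))) has_vector_derivative
       (\<Sum>k\<le>M. \<alpha> k * of_real (- (sin (real k * \<theta>) * real k)))) (at \<theta>)"
      by (intro has_vector_derivative_sum has_vector_derivative_mult_right has_vector_derivative_of_real)
         (auto intro!: derivative_eq_intros)
    have "of_real (- (R * sin \<theta>)) * poly (pderiv Q) (of_real (R * cos \<theta>)) =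
       (\<Sum>k\<le>M. \<alpha> k * of_real (- (sin (real k * \<theta>) * real k)))"
      using vector_derivative_unique_at[OF 1] 2 unfolding Q by blast
    then show ?thesis by (simp add: sum_negf mult_ac)
  qed
  have sins: "((\<lambda>\<theta>. (cmod (of_real (R * sin \<theta>) * poly (pderiv Q) (of_real (R * cos \<theta>))))\<^sup>2) has_integral
      (\<Sum>k\<le>M. (if k = 0 then 0 else pi / 2) * (cmod (of_nat k * \<alpha> k))\<^sup>2)) {0..pi}"
    unfolding der
    by (intro integral_norm_sum_orthogonal has_integral_eq_rhs[OF sin_sin_has_integral]) auto
  have int: "(\<lambda>\<theta>. R\<^sup>2 * (cmod (poly (pderiv Q) (of_real (R * cos \<theta>))))\<^sup>2) integrable_on {0..pi}"
    by (intro integrable_continuous_real continuous_intros)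
  have "(real (Suc n))\<^sup>2 * cheb_sq R (Q - q) = (\<Sum>k\<in>{..M} - {..n}. (pi / 2) * ((real (Suc n))\<^sup>2 * (cmod (\<alpha> k))\<^sup>2))"
    unfolding diff sum_distrib_left by (simp add: mult_ac)
  also have "\<dots> \<le> (\<Sum>k\<in>{..M} - {..n}. (if k = 0 then 0 else pi / 2) * (cmod (of_nat k * \<alpha> k))\<^sup>2)"
    by (intro sum_mono) (auto simp: norm_mult power_mult_distrib intro!: mult_left_mono mult_right_mono power_mono)
  also have "\<dots> \<le> (\<Sum>k\<le>M. (if k = 0 then 0 else pi / 2) * (cmod (of_nat k * \<alpha> k))\<^sup>2)"
    by (rule sum_mono2) auto
  also have "\<dots> = integral {0..pi} (\<lambda>\<theta>. (cmod (of_real (R * sin \<theta>) * poly (pderiv Q) (of_real (R * cos \<theta>))))\<^sup>2)"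
    using sins by (simp add: integral_unique)
  also have "\<dots> \<le> integral {0..pi} (\<lambda>\<theta>. R\<^sup>2 * (cmod (poly (pderiv Q) (of_real (R * cos \<theta>))))\<^sup>2)"
  proof (rule integral_le)
    fix \<theta> :: real
    have "(sin \<theta>)\<^sup>2 \<le> 1" using abs_square_le_1 abs_sin_le_one by blast
    then have "(R\<^sup>2 * (cmod (poly (pderiv Q) (of_real (R * cos \<theta>))))\<^sup>2) * (sin \<theta>)\<^sup>2 \<le> (R\<^sup>2 * (cmod (poly (pderiv Q) (of_real (R * cos \<theta>))))\<^sup>2) * 1"
      by (intro mult_left_mono) auto
    then show "(cmod (of_real (R * sin \<theta>) * poly (pderiv Q) (of_real (R * cos \<theta>))))\<^sup>2 \<le> R\<^sup>2 * (cmod (poly (pderiv Q) (of_real (R * cos \<theta>))))\<^sup>2"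
      by (simp add: norm_mult power_mult_distrib mult_ac)
  qed (use sins int in auto)
  also have "\<dots> = R\<^sup>2 * cheb_sq R (pderiv Q)"
    by (simp add: cheb_sq_def)
  finally have "cheb_sq R (Q - q) \<le> (R / real (Suc n))\<^sup>2 * cheb_sq R (pderiv Q)"
    by (simp add: field_simps)
  with deg show ?thesis by blast
qed

text \<open>The antiderivative is normalised at 0 so that a prescribed initial value can later be
  added as a constant.\<close>

lemma pderiv_surj:
  fixes Q :: "'a :: field_char_0 poly"
  shows "\<exists>P. pderiv P = Q \<and> degree P \<le> Suc (degree Q) \<and> poly P 0 = 0"
proof -
  define P where "P = (\<Sum>i\<le>degree Q. monom (coeff Q i / of_nat (Suc i)) (Suc i))"
  have "pderiv P = (\<Sum>i\<le>degree Q. monom (coeff Q i) i)"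
    unfolding P_def higher_pderiv_sum[of 1, simplified]
    by (intro sum.cong refl) (simp add: pderiv_monom del: of_nat_Suc)
  moreover have "degree P \<le> Suc (degree Q)"
    unfolding P_def by (intro degree_sum_le) (auto intro: order_trans[OF degree_monom_le])
  moreover have "poly P 0 = 0" by (simp add: P_def poly_sum poly_monom)
  ultimately show ?thesis by (auto simp: poly_as_sum_of_monoms)
qed

text \<open>Truncation does not commute with differentiation, so the one step bound cannot simply be
  iterated. Instead an antiderivative \<open>P\<close> of an approximant of \<open>pderiv Q\<close>
  is subtracted first, and the one step bound is applied to \<open>Q - P\<close>, whose derivative
  is already small. The denominator \<open>Suc n - k\<close> is a common lower bound for those that
  occur.\<close>

lemma cheb_sq_approx:
  assumes R: "R > 0" and "k \<le> n"
  shows "\<exists>q. degree q \<le> n \<and> cheb_sq R (Q - q) \<le> ((R / real (Suc n - k)) ^ k)\<^sup>2 * cheb_sq R ((pderiv ^^ k) Q)"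
  using assms(2)
proof (induction k arbitrary: n Q)
  case 0
  show ?case by (intro exI[of _ 0]) simp
next
  case (Suc k)
  then obtain m where n: "n = Suc m" "k \<le> m" by (cases n) auto
  obtain q1 where q1: "degree q1 \<le> m"
    "cheb_sq R (pderiv Q - q1) \<le> ((R / real (Suc m - k)) ^ k)\<^sup>2 * cheb_sq R ((pderiv ^^ k) (pderiv Q))"
    using Suc.IH[OF n(2)] by metis
  obtain P where P: "pderiv P = q1" "degree P \<le> Suc (degree q1)" using pderiv_surj by metis
  obtain q2 where q2: "degree q2 \<le> n"
    "cheb_sq R ((Q - P) - q2) \<le> (R / real (Suc n))\<^sup>2 * cheb_sq R (pderiv (Q - P))"
    using cheb_sq_approx_step[OF R] by metis
  have "degree (P + q2) \<le> n" using P q1 q2 n by (intro degree_add_le) auto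
  moreover have "cheb_sq R (Q - (P + q2)) \<le> ((R / real (Suc n - Suc k)) ^ Suc k)\<^sup>2 * cheb_sq R ((pderiv ^^ Suc k) Q)"
  proof -
    have nn: "0 \<le> cheb_sq R ((pderiv ^^ k) (pderiv Q))" unfolding cheb_sq_def
      by (intro integral_nonneg integrable_continuous_real continuous_intros) auto
    have "cheb_sq R (Q - (P + q2)) \<le> (R / real (Suc n))\<^sup>2 * cheb_sq R (pderiv Q - q1)"
      using q2 P by (simp add: pderiv_diff diff_diff_eq)
    also have "\<dots> \<le> (R / real (Suc n))\<^sup>2 * (((R / real (Suc m - k)) ^ k)\<^sup>2 * cheb_sq R ((pderiv ^^ k) (pderiv Q)))"
      by (intro mult_left_mono q1) auto
    also have "\<dots> \<le> (R / real (Suc m - k))\<^sup>2 * (((R / real (Suc m - k)) ^ k)\<^sup>2 * cheb_sq R ((pderiv ^^ k) (pderiv Q)))"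
      using R n nn by (intro mult_right_mono power_mono divide_left_mono mult_nonneg_nonneg) auto
    also have "\<dots> = ((R / real (Suc n - Suc k)) ^ Suc k)\<^sup>2 * cheb_sq R ((pderiv ^^ Suc k) Q)"
      by (simp add: n funpow_Suc_right power_mult_distrib[symmetric] mult.assoc[symmetric] del: funpow.simps)
    finally show ?thesis .
  qed
  ultimately show ?case by blast
qed

text \<open>Substituting \<open>z = R * cos \<theta>\<close> leaves the Jacobian
  \<open>R * sin \<theta>\<close>, which is at most \<open>R\<close>.\<close>

lemma integral_poly_le_cheb_sq:
  assumes R: "R > 0"
  shows "integral {-R..R} (\<lambda>z. (cmod (poly Q (of_real z)))\<^sup>2) \<le> R * cheb_sq R Q"
proof -
  define g where "g = (\<lambda>z. (cmod (poly Q (of_real z)))\<^sup>2)"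
  have cg: "continuous_on A g" for A unfolding g_def by (intro continuous_intros)
  \<comment> \<open>The lower limit \<open>-R - 1\<close> makes \<open>G\<close> differentiable from
    both sides on all of \<open>[-R, R]\<close>, end points included, so that the chain rule applies
    at \<open>\<theta> = 0\<close> and \<open>\<theta> = pi\<close> too.\<close>
  define G where "G = (\<lambda>z. integral {-R-1..z} g)"
  have G: "(G has_real_derivative g z) (at z)" if "z \<in> {-R..R}" for z
  proof -
    have "(G has_real_derivative g z) (at z within {-R-1..R+1})"
      unfolding G_def has_real_derivative_iff_has_vector_derivative
      by (rule integral_has_vector_derivative) (use that cg in auto)
    then show ?thesis
      using at_within_Icc_at[of "-R-1" z "R+1"] that by simp
  qed
  have cos: "R * cos \<theta> \<in> {-R..R}" for \<theta>
    using R cos_ge_minus_one[of \<theta>] cos_le_one[of \<theta>] mult_left_mono[of "-1" "cos \<theta>" R] mult_left_mono[of "cos \<theta>" 1 R] by auto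
  have "((\<lambda>\<theta>. g (R * cos \<theta>) * (R * sin \<theta>)) has_integral ((- G (R * cos pi)) - (- G (R * cos 0)))) {0..pi}"
  proof (rule fundamental_theorem_of_calculus)
    fix \<theta> :: real assume "\<theta> \<in> {0..pi}"
    have "((\<lambda>\<theta>. G (R * cos \<theta>)) has_real_derivative g (R * cos \<theta>) * - (R * sin \<theta>)) (at \<theta> within {0..pi})"
    proof (rule DERIV_chain'[where f = "\<lambda>\<theta>. R * cos \<theta>" and g = G, THEN DERIV_cong])
      show "((\<lambda>\<theta>. R * cos \<theta>) has_real_derivative - (R * sin \<theta>)) (at \<theta> within {0..pi})"
        by (auto intro!: derivative_eq_intros)
    next
      show "(G has_real_derivative g (R * cos \<theta>)) (at (R * cos \<theta>))" using G cos by blast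
    qed simp
    from DERIV_minus[OF this] show "((\<lambda>\<theta>. - G (R * cos \<theta>)) has_vector_derivative g (R * cos \<theta>) * (R * sin \<theta>)) (at \<theta> within {0..pi})"
      by (simp add: has_real_derivative_iff_has_vector_derivative)
  qed simp
  moreover have "(- G (R * cos pi)) - (- G (R * cos 0)) = integral {-R..R} g"
    using Henstock_Kurzweil_Integration.integral_combine[of "-R-1" "-R" R g] R integrable_continuous_real[OF cg]
    by (simp add: G_def algebra_simps)
  ultimately have *: "((\<lambda>\<theta>. g (R * cos \<theta>) * (R * sin \<theta>)) has_integral integral {-R..R} g) {0..pi}"
    by simp
  have "integral {-R..R} g = integral {0..pi} (\<lambda>\<theta>. g (R * cos \<theta>) * (R * sin \<theta>))"
    using * by (simp add: integral_unique)
  also have "\<dots> \<le> integral {0..pi} (\<lambda>\<theta>. R * g (R * cos \<theta>))"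
  proof (rule integral_le)
    show "(\<lambda>\<theta>. R * g (R * cos \<theta>)) integrable_on {0..pi}"
      unfolding g_def by (intro integrable_continuous_real continuous_intros)
    fix \<theta> :: real
    have "(g (R * cos \<theta>) * R) * sin \<theta> \<le> (g (R * cos \<theta>) * R) * 1"
      using R by (intro mult_left_mono) (auto simp: g_def)
    then show "g (R * cos \<theta>) * (R * sin \<theta>) \<le> R * g (R * cos \<theta>)" by (simp add: mult_ac)
  qed (use * in auto)
  also have "\<dots> = R * cheb_sq R Q" by (simp add: cheb_sq_def g_def)
  finally show ?thesis by (simp add: g_def)
qed

section \<open>The integral equation of the trace problem\<close>

text \<open>The right-hand side is the oriented integral from \<open>a\<close> to \<open>x\<close>.
  Parametrising the segment over \<open>[0, 1]\<close> covers \<open>x < a\<close> without a case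
  distinction.\<close>

lemma segment_integral:
  fixes G :: "real \<Rightarrow> complex"
  assumes G: "continuous_on {0..B} G" and a: "a \<in> {0..B}" and x: "x \<in> {0..B}"
  shows "of_real (x - a) * integral {0..1} (\<lambda>\<tau>. G (a + \<tau> * (x - a))) = integral {0..x} G - integral {0..a} G"
proof -
  have mem: "a + \<tau> * (x - a) \<in> {0..B}" if "\<tau> \<in> {0..1}" for \<tau>
    using convexD_alt[OF convex_real_interval(5) a x, of \<tau>] that by (simp add: algebra_simps)
  have d: "((\<lambda>\<tau>. integral {0..a + \<tau> * (x - a)} G) has_vector_derivative (x - a) *\<^sub>R G (a + \<tau> * (x - a))) (at \<tau> within {0..1})"
    if "\<tau> \<in> {0..1}" for \<tau>
  proof -
    have 1: "((\<lambda>\<tau>. a + \<tau> * (x - a)) has_vector_derivative (x - a)) (at \<tau> within {0..1})"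
      by (auto intro!: derivative_eq_intros simp: has_real_derivative_iff_has_vector_derivative[symmetric])
    have "((\<lambda>u. integral {0..u} G) has_vector_derivative G (a + \<tau> * (x - a))) (at (a + \<tau> * (x - a)) within {0..B})"
      by (rule integral_has_vector_derivative[OF G mem[OF that]])
    then have 2: "((\<lambda>u. integral {0..u} G) has_vector_derivative G (a + \<tau> * (x - a))) (at (a + \<tau> * (x - a)) within (\<lambda>\<tau>. a + \<tau> * (x - a)) ` {0..1})"
      using mem by (elim has_vector_derivative_within_subset) blast
    from vector_diff_chain_within[OF 1 2] show ?thesis by (simp add: o_def)
  qed
  have "((\<lambda>\<tau>. (x - a) *\<^sub>R G (a + \<tau> * (x - a))) has_integral
      (integral {0..a + 1 * (x - a)} G - integral {0..a + 0 * (x - a)} G)) {0..1}"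
    by (rule fundamental_theorem_of_calculus) (use d in auto)
  then have "integral {0..1} (\<lambda>\<tau>. (x - a) *\<^sub>R G (a + \<tau> * (x - a))) = integral {0..x} G - integral {0..a} G"
    by (rule integral_unique[OF has_integral_eq_rhs]) simp
  then show ?thesis by (simp only: scaleR_conv_of_real integral_mult_right)
qed

lemma continuous_on_compact_bound:
  fixes f :: "'a :: topological_space \<Rightarrow> 'b :: real_normed_vector"
  assumes "compact S" "continuous_on S f"
  obtains B where "B \<ge> 0" "\<And>x. x \<in> S \<Longrightarrow> norm (f x) \<le> B"
proof -
  obtain B where "\<And>x. x \<in> S \<Longrightarrow> norm (f x) \<le> B"
    using compact_imp_bounded[OF compact_continuous_image[OF assms(2,1)]] by (auto simp: bounded_iff)
  then show ?thesis using that[of "max 0 B"] by (auto simp: le_max_iff_disj)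
qed

text \<open>The substitution \<open>y = (1 - \<tau>) * r\<close> gives the integral of
  \<open>exp (- l * y)\<close> over \<open>[0, r]\<close>. A large \<open>l\<close> thus makes the
  weighted integral operator a contraction.\<close>

lemma exp_segment_bound:
  fixes r l :: real
  assumes "l > 0" "r \<ge> 0"
  shows "r * integral {0..1} (\<lambda>\<tau>. exp (- (l * (1 - \<tau>) * r))) \<le> 1 / l"
proof (cases "r = 0")
  case False
  have "((\<lambda>\<tau>. r * exp (- (l * (1 - \<tau>) * r))) has_integral
      (exp (- (l * (1 - 1) * r)) / l - exp (- (l * (1 - 0) * r)) / l)) {0..1}"
    using assms False
    by (intro fundamental_theorem_of_calculus)
       (auto intro!: derivative_eq_intros simp: has_real_derivative_iff_has_vector_derivative[symmetric])
  then have "integral {0..1} (\<lambda>\<tau>. r * exp (- (l * (1 - \<tau>) * r))) = 1 / l - exp (- (l * r)) / l"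
    by (subst integral_unique) auto
  then show ?thesis using assms by simp
qed (use assms in auto)

text \<open>Here \<open>M(x,c)\<close> is the solution at \<open>t = c - x\<close>. On the half-line \<open>c \<le> 0\<close> the trace \<open>M(0,\<cdot>)\<close> is not determined by \<open>g\<close> and is taken to be \<open>g 0\<close>. With
  \<open>a = max c 0 / 2\<close> both requirements become the single equation
  \<open>M(x,c) = g(a) + \<integral>\<^sub>a\<^sup>x p(y) M(y,2y-c) dy\<close>. The path of integration moves \<open>max x \<bar>x - c\<bar>\<close>
  monotonically, at unit speed, so that the exponential of a multiple of this quantity is a weight
  which makes the right-hand side a contraction.\<close>

lemma trace_problem_solvable:
  fixes p g :: "real \<Rightarrow> complex"
  assumes b: "b > 0" and p: "continuous_on {0..b} p" and g: "continuous_on {0..b} g"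
  shows "\<exists>M. continuous_on UNIV (\<lambda>(x, c). M x c) \<and> (\<forall>x\<in>{0..b}. M x (2 * x) = g x) \<and>
    (\<forall>x\<in>{0..b}. \<forall>c\<le>2 * b. M x c = M 0 c + integral {0..x} (\<lambda>y. p y * M y (2 * y - c)))"
proof -
  \<comment> \<open>Clamping the argument to \<open>[0, b]\<close> gives bounded continuous
    functions on the line, so that the fixed point problem lives in the bounded continuous functions
    on the plane.\<close>
  define p' where "p' = (\<lambda>x. p (max 0 (min b x)))"
  define g' where "g' = (\<lambda>x. g (max 0 (min b x)))"
  have cont: "continuous_on UNIV p'" "continuous_on UNIV g'"
    unfolding p'_def g'_def using b
    by (auto intro!: continuous_on_compose2[OF p] continuous_on_compose2[OF g] continuous_intros)
  obtain Mp where Mp: "\<And>x. x \<in> {0..b} \<Longrightarrow> cmod (p x) \<le> Mp"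
    using continuous_on_compact_bound[OF compact_Icc p] by blast
  obtain Mg where Mg: "\<And>x. x \<in> {0..b} \<Longrightarrow> cmod (g x) \<le> Mg"
    using continuous_on_compact_bound[OF compact_Icc g] by blast
  have p'b: "cmod (p' x) \<le> Mp" and g'b: "cmod (g' x) \<le> Mg" for x
    unfolding p'_def g'_def using b by (auto intro!: Mp Mg)
  have Mp0: "Mp \<ge> 0" using p'b[of 0] norm_ge_zero order_trans by blast
  \<comment> \<open>This makes \<open>Mp / l\<close> at most 1/2, the contraction constant; the
    summand 1 keeps \<open>l\<close> positive when \<open>Mp = 0\<close>.\<close>
  define l where "l = 2 * Mp + 1"
  have l: "l > 0" using Mp0 by (simp add: l_def)
  define a where "a = (\<lambda>c::real. max c 0 / 2)"
  define X where "X = (\<lambda>x::real. max 0 x)"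
  define w where "w = (\<lambda>x c::real. max (X x) \<bar>X x - c\<bar>)"
  define y where "y = (\<lambda>x c \<tau>. a c + \<tau> * (X x - a c))"
  \<comment> \<open>The unknown is \<open>F (x, c) = exp (- l * w x c) * M x c\<close>. The
    exponential in the integrand is the quotient of the values of \<open>exp (l * w)\<close> at the
    point with parameter \<open>\<tau>\<close> and at the end of the path.\<close>
  define I where "I = (\<lambda>F x c. integral {0..1} (\<lambda>\<tau>. p' (y x c \<tau>) * of_real (exp (- (l * (1 - \<tau>) * \<bar>X x - a c\<bar>)))
      * apply_bcontfun F (y x c \<tau>, 2 * y x c \<tau> - c)))"
  define Op where "Op = (\<lambda>F (x, c). of_real (exp (- (l * w x c))) * g' (a c) + of_real (X x - a c) * I F x c)"
  have ci: "continuous_on A (\<lambda>\<tau>. p' (y x c \<tau>) * of_real (exp (- (l * (1 - \<tau>) * \<bar>X x - a c\<bar>)))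
      * apply_bcontfun F (y x c \<tau>, 2 * y x c \<tau> - c))" for A x c F
    unfolding y_def by (intro continuous_intros continuous_on_compose2[OF cont(1)]
       continuous_on_compose2[OF continuous_on_apply_bcontfun[of UNIV F]]) auto
  have Ibound: "cmod (of_real (X x - a c) * integral {0..1} (\<lambda>\<tau>. p' (y x c \<tau>) * of_real (exp (- (l * (1 - \<tau>) * \<bar>X x - a c\<bar>))) * H \<tau>)) \<le> D / 2"
    if H: "continuous_on {0..1} H" "\<And>\<tau>. cmod (H \<tau>) \<le> D" for x c and H :: "real \<Rightarrow> complex" and D
  proof -
    have D: "D \<ge> 0" using H(2)[of 0] norm_ge_zero order_trans by blast
    have "cmod (integral {0..1} (\<lambda>\<tau>. p' (y x c \<tau>) * of_real (exp (- (l * (1 - \<tau>) * \<bar>X x - a c\<bar>))) * H \<tau>))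
        \<le> integral {0..1} (\<lambda>\<tau>. Mp * D * exp (- (l * (1 - \<tau>) * \<bar>X x - a c\<bar>)))"
    proof (rule integral_norm_bound_integral)
      show "(\<lambda>\<tau>. p' (y x c \<tau>) * of_real (exp (- (l * (1 - \<tau>) * \<bar>X x - a c\<bar>))) * H \<tau>) integrable_on {0..1}"
        unfolding y_def by (intro integrable_continuous_real continuous_intros continuous_on_compose2[OF cont(1)] H) auto
      show "(\<lambda>\<tau>. Mp * D * exp (- (l * (1 - \<tau>) * \<bar>X x - a c\<bar>))) integrable_on {0..1}"
        by (intro integrable_continuous_real continuous_intros)
      show "cmod (p' (y x c \<tau>) * of_real (exp (- (l * (1 - \<tau>) * \<bar>X x - a c\<bar>))) * H \<tau>)
         \<le> Mp * D * exp (- (l * (1 - \<tau>) * \<bar>X x - a c\<bar>))" for \<tau>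
        using mult_mono[OF p'b H(2), of \<tau> "y x c \<tau>"] Mp0 by (simp add: norm_mult mult_ac)
    qed
    then have "cmod (of_real (X x - a c) * integral {0..1} (\<lambda>\<tau>. p' (y x c \<tau>) * of_real (exp (- (l * (1 - \<tau>) * \<bar>X x - a c\<bar>))) * H \<tau>))
        \<le> \<bar>X x - a c\<bar> * integral {0..1} (\<lambda>\<tau>. Mp * D * exp (- (l * (1 - \<tau>) * \<bar>X x - a c\<bar>)))"
      unfolding norm_mult norm_of_real by (rule mult_left_mono) simp
    also have "\<dots> = Mp * D * (\<bar>X x - a c\<bar> * integral {0..1} (\<lambda>\<tau>. exp (- (l * (1 - \<tau>) * \<bar>X x - a c\<bar>))))"
      by simp
    also have "\<dots> \<le> Mp * D * (1 / l)"
      by (intro mult_left_mono exp_segment_bound l) (use Mp0 D in auto)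
    also have "\<dots> = D * (Mp / l)" by simp
    also have "\<dots> \<le> D * (1 / 2)"
      using Mp0 D by (intro mult_left_mono) (auto simp: l_def field_simps)
    finally show ?thesis by simp
  qed
  have cI: "continuous_on UNIV (\<lambda>z. I F (fst z) (snd z))" for F
  proof -
    have "continuous_on (UNIV \<times> cbox 0 1) (\<lambda>(z, \<tau>). p' (y (fst z) (snd z) \<tau>) * of_real (exp (- (l * (1 - \<tau>) * \<bar>X (fst z) - a (snd z)\<bar>)))
      * apply_bcontfun F (y (fst z) (snd z) \<tau>, 2 * y (fst z) (snd z) \<tau> - snd z))"
      unfolding y_def X_def a_def split_def
      by (intro continuous_intros continuous_on_compose2[OF cont(1)]
       continuous_on_compose2[OF continuous_on_apply_bcontfun[of UNIV F]]) auto
    from integral_continuous_on_param[OF this] show ?thesis by (simp add: I_def)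
  qed
  have Op: "Op F \<in> bcontfun" for F
  proof -
    obtain D where D: "\<And>z. cmod (apply_bcontfun F z) \<le> D"
      using bounded_apply_bcontfun[of F] by (auto simp: bounded_iff)
    have "continuous_on UNIV (Op F)"
      unfolding Op_def split_def w_def X_def a_def
      by (intro continuous_intros continuous_on_compose2[OF cont(2)] cI[unfolded X_def a_def]) auto
    moreover have "cmod (Op F z) \<le> Mg + D / 2" for z
    proof -
      obtain x c where z: "z = (x, c)" by force
      have "cmod (of_real (exp (- (l * w x c))) * g' (a c)) \<le> 1 * Mg"
        unfolding norm_mult using l g'b by (intro mult_mono) (auto simp: w_def X_def)
      moreover have "cmod (of_real (X x - a c) * I F x c) \<le> D / 2"
        unfolding I_def by (rule Ibound)
          (auto simp: y_def D intro!: continuous_intros continuous_on_compose2[OF continuous_on_apply_bcontfun[of UNIV F]])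
      ultimately show ?thesis unfolding z Op_def by (simp add: norm_triangle_le)
    qed
    ultimately show ?thesis unfolding bcontfun_def bounded_iff by blast
  qed
  have lip: "dist (Bcontfun (Op F)) (Bcontfun (Op G)) \<le> 1 / 2 * dist F G" for F G
  proof (rule dist_bound)
    fix z :: "real \<times> real"
    obtain x c where z: "z = (x, c)" by force
    have "Op F z - Op G z = of_real (X x - a c) * (I F x c - I G x c)"
      unfolding z Op_def by (simp add: algebra_simps)
    also have "I F x c - I G x c = integral {0..1} (\<lambda>\<tau>. p' (y x c \<tau>) * of_real (exp (- (l * (1 - \<tau>) * \<bar>X x - a c\<bar>)))
      * (apply_bcontfun F (y x c \<tau>, 2 * y x c \<tau> - c) - apply_bcontfun G (y x c \<tau>, 2 * y x c \<tau> - c)))"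
      unfolding I_def Henstock_Kurzweil_Integration.integral_diff[OF integrable_continuous_real[OF ci] integrable_continuous_real[OF ci], symmetric]
      by (simp only: right_diff_distrib[of "_ * _"])
    finally have "cmod (Op F z - Op G z) \<le> dist F G / 2"
      by (simp only:) (rule Ibound,
          auto simp: y_def dist_norm[symmetric] dist_bounded intro!: continuous_intros
            continuous_on_compose2[OF continuous_on_apply_bcontfun[of UNIV F]]
            continuous_on_compose2[OF continuous_on_apply_bcontfun[of UNIV G]])
    then show "dist (apply_bcontfun (Bcontfun (Op F)) z) (apply_bcontfun (Bcontfun (Op G)) z) \<le> 1 / 2 * dist F G"
      by (simp add: Bcontfun_inverse Op dist_norm)
  qed
  have "\<exists>!F. Bcontfun (Op F) = F"
    by (rule banach_fix_type[of "1/2"]) (use lip in auto)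
  then obtain F where "Bcontfun (Op F) = F" by blast
  then have fixp: "apply_bcontfun F (x, c) = of_real (exp (- (l * w x c))) * g' (a c) + of_real (X x - a c) * I F x c" for x c
    using Bcontfun_inverse[OF Op, of F] by (simp add: Op_def)
  define M where "M = (\<lambda>x c. of_real (exp (l * w x c)) * apply_bcontfun F (x, c))"
  have contM: "continuous_on UNIV (\<lambda>(x, c). M x c)"
    unfolding M_def w_def X_def split_def by (intro continuous_intros) auto
  have M: "M x c = g (a c) + (integral {0..x} (\<lambda>y. p y * M y (2 * y - c)) - integral {0..a c} (\<lambda>y. p y * M y (2 * y - c)))"
    if x: "x \<in> {0..b}" and c: "c \<le> 2 * b" for x c
  proof -
    have ac: "a c \<in> {0..b}" using c b by (auto simp: a_def)
    have ymem: "y x c \<tau> \<in> {0..b}" if "\<tau> \<in> {0..1}" for \<tau>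
      using convexD_alt[OF convex_real_interval(5) ac x, of \<tau>] that x by (simp add: y_def X_def algebra_simps)
    \<comment> \<open>For \<open>y \<ge> 0\<close> the weight \<open>w\<close> is unchanged by the
      reflection \<open>c -> 2 * y - c\<close> at \<open>y\<close>, and along the path it exceeds
      its value at the starting point \<open>a c\<close> by exactly the distance travelled.\<close>
    have wx: "w x c = (max (c/2) (-c)) + \<bar>X x - a c\<bar>"
      using x by (auto simp: w_def X_def a_def max_def abs_if split: if_splits)
    have wy: "w (y x c \<tau>) (2 * y x c \<tau> - c) = (max (c/2) (-c)) + \<tau> * \<bar>X x - a c\<bar>" if "\<tau> \<in> {0..1}" for \<tau>
    proof -
      have "w (y x c \<tau>) (2 * y x c \<tau> - c) = (max (c/2) (-c)) + \<bar>y x c \<tau> - a c\<bar>"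
        using ymem[OF that] by (auto simp: w_def X_def a_def max_def abs_if split: if_splits)
      also have "\<bar>y x c \<tau> - a c\<bar> = \<tau> * \<bar>X x - a c\<bar>" using that by (simp add: y_def abs_mult)
      finally show ?thesis .
    qed
    have "of_real (exp (l * w x c)) * I F x c = integral {0..1} (\<lambda>\<tau>. p (y x c \<tau>) * M (y x c \<tau>) (2 * y x c \<tau> - c))"
      unfolding I_def integral_mult_right[symmetric]
    proof (rule integral_cong)
      fix \<tau> :: real assume t: "\<tau> \<in> {0..1}"
      have "complex_of_real (exp (l * w (y x c \<tau>) (2 * y x c \<tau> - c))) = of_real (exp (l * w x c)) * of_real (exp (- (l * (1 - \<tau>) * \<bar>X x - a c\<bar>)))"
        unfolding wx wy[OF t] of_real_mult[symmetric] exp_add[symmetric] by (simp add: algebra_simps)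
      moreover have "p' (y x c \<tau>) = p (y x c \<tau>)" using ymem[OF t] by (simp add: p'_def)
      ultimately show "of_real (exp (l * w x c)) * (p' (y x c \<tau>) * of_real (exp (- (l * (1 - \<tau>) * \<bar>X x - a c\<bar>)))
      * apply_bcontfun F (y x c \<tau>, 2 * y x c \<tau> - c)) = p (y x c \<tau>) * M (y x c \<tau>) (2 * y x c \<tau> - c)"
        by (simp add: M_def mult_ac)
    qed
    moreover have cG: "continuous_on {0..b} (\<lambda>y. p y * M y (2 * y - c))"
    proof -
      have "continuous_on {0..b} (\<lambda>y. (\<lambda>(x, c). M x c) (y, 2 * y - c))"
        by (rule continuous_on_compose2[OF contM]) (auto intro!: continuous_intros)
      then show ?thesis by (intro continuous_intros p) simp
    qed
    moreover have "of_real (exp (l * w x c)) * (of_real (exp (- (l * w x c))) * g' (a c)) = g (a c)"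
    proof -
      have "of_real (exp (l * w x c)) * (of_real (exp (- (l * w x c))) :: complex) = 1"
        unfolding of_real_mult[symmetric] exp_add[symmetric] by simp
      moreover have "g' (a c) = g (a c)" using ac by (simp add: g'_def)
      ultimately show ?thesis by (simp add: mult.assoc[symmetric])
    qed
    moreover have "of_real (X x - a c) * integral {0..1} (\<lambda>\<tau>. p (y x c \<tau>) * M (y x c \<tau>) (2 * y x c \<tau> - c))
        = integral {0..x} (\<lambda>y. p y * M y (2 * y - c)) - integral {0..a c} (\<lambda>y. p y * M y (2 * y - c))"
      using segment_integral[OF cG ac x] x by (simp add: X_def y_def)
    moreover have "M x c = of_real (exp (l * w x c)) * (of_real (exp (- (l * w x c))) * g' (a c))
        + of_real (X x - a c) * (of_real (exp (l * w x c)) * I F x c)"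
      unfolding M_def fixp by (simp add: algebra_simps)
    ultimately show ?thesis by (simp only:)
  qed
  \<comment> \<open>For \<open>c = 2 * x\<close> the path starts at \<open>a c = x\<close> and is
    empty.\<close>
  have "M x (2 * x) = g x" if "x \<in> {0..b}" for x
    using M[of x "2 * x"] that by (simp add: a_def)
  moreover have "M x c = M 0 c + integral {0..x} (\<lambda>y. p y * M y (2 * y - c))"
    if "x \<in> {0..b}" "c \<le> 2 * b" for x c
    using M[OF that] M[of 0 c] that b by simp
  ultimately show ?thesis using contM by blast
qed

section \<open>Estimates for the two boundary value problems\<close>

lemma integral_affine:
  fixes f :: "real \<Rightarrow> 'a :: banach"
  assumes m: "m > 0" and f: "f integrable_on {m * u + k..m * v + k}"
  shows "integral {u..v} (\<lambda>y. f (m * y + k)) = integral {m * u + k..m * v + k} f /\<^sub>R m"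
proof -
  have "((\<lambda>y. f (m *\<^sub>R y + k)) has_integral (integral {m * u + k..m * v + k} f /\<^sub>R m ^ DIM(real)))
      (cbox ((m * u + k - k) /\<^sub>R m) ((m * v + k - k) /\<^sub>R m))"
    using m f by (intro has_integral_affinity') (auto simp: integrable_integral)
  moreover have "cbox ((m * u + k - k) /\<^sub>R m) ((m * v + k - k) /\<^sub>R m) = {u..v}" using m by simp
  ultimately have "((\<lambda>y. f (m * y + k)) has_integral (integral {m * u + k..m * v + k} f /\<^sub>R m)) {u..v}"
    by (simp only: DIM_real power_one_right real_scaleR_def)
  then show ?thesis by (rule integral_unique)
qed

lemma mult_exp_minus_le_iff: "a * exp (- t) \<le> B \<longleftrightarrow> a \<le> B * exp t" for a t B :: real
  by (simp add: exp_minus field_simps)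

lemma norm_add_diff_le: "norm (a + x) - norm a \<le> norm x" for a x :: "'a :: real_normed_vector"
  using norm_triangle_ineq[of a x] by linarith

text \<open>The step fed to \<open>sup_halving\<close>. The integrand is controlled by a known
  source \<open>n\<close> and a hypothetical bound \<open>B\<close> on the weighted unknown;
  integrating \<open>exp (l * v)\<close> produces \<open>1 / l\<close>, and \<open>Mp / l\<close> is
  at most 1/2. The coordinate \<open>\<xi>\<close> stays fixed along the path of
  integration.\<close>

lemma weighted_Volterra_step:
  fixes \<phi> :: "real \<Rightarrow> complex" and n :: "real \<Rightarrow> real"
  assumes l: "l = 2 * Mp + 1" and pos: "Mp \<ge> 0" "B \<ge> 0" "0 \<le> \<xi>" "0 \<le> \<eta>"
    and int: "\<phi> integrable_on {0..\<eta>}" and n: "n integrable_on {0..\<eta>}" "\<And>v. v \<in> {0..\<eta>} \<Longrightarrow> n v \<ge> 0"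
    and bound: "\<And>v. v \<in> {0..\<eta>} \<Longrightarrow> cmod (\<phi> v) \<le> Mp * (n v + B * exp (l * (\<xi> + v)))"
  shows "cmod (integral {0..\<eta>} \<phi>) * exp (- (l * (\<xi> + \<eta>))) \<le> Mp * integral {0..\<eta>} n + B / 2"
proof -
  have l0: "l > 0" using l pos by simp
  have "((\<lambda>v. Mp * (n v + B * exp (l * \<xi>) * exp (l * v))) has_integral
      Mp * (integral {0..\<eta>} n + B * exp (l * \<xi>) * ((exp (l * \<eta>) - 1) / l))) {0..\<eta>}"
    by (intro has_integral_mult_right has_integral_add integrable_integral n exp_has_integral l0 pos)
  then have "cmod (integral {0..\<eta>} \<phi>) \<le> Mp * (integral {0..\<eta>} n + B * exp (l * \<xi>) * ((exp (l * \<eta>) - 1) / l))"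
    using bound
    by (intro order_trans[OF integral_norm_bound_integral[OF int has_integral_integrable] eq_refl[OF integral_unique]])
       (auto simp: distrib_left exp_add mult.assoc)
  then have "cmod (integral {0..\<eta>} \<phi>) * exp (- (l * (\<xi> + \<eta>)))
     \<le> Mp * (integral {0..\<eta>} n + B * exp (l * \<xi>) * ((exp (l * \<eta>) - 1) / l)) * exp (- (l * (\<xi> + \<eta>)))"
    by (rule mult_right_mono) simp
  also have "\<dots> = Mp * integral {0..\<eta>} n * exp (- (l * (\<xi> + \<eta>))) + B * (Mp / l) * (exp (l * \<xi>) * (exp (l * \<eta>) - 1) * exp (- (l * (\<xi> + \<eta>))))"
    by (simp only: distrib_left distrib_right times_divide_eq_right times_divide_eq_left mult_ac)
  also have "\<dots> \<le> Mp * integral {0..\<eta>} n * 1 + B * (1 / 2) * 1"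
  proof (intro add_mono mult_mono)
    show "exp (- (l * (\<xi> + \<eta>))) \<le> 1" using l0 pos by simp
    show "Mp / l \<le> 1 / 2" using l pos by (simp add: field_simps)
    have "exp (l * \<xi>) * (exp (l * \<eta>) - 1) * exp (- (l * (\<xi> + \<eta>))) \<le> exp (l * \<xi>) * exp (l * \<eta>) * exp (- (l * (\<xi> + \<eta>)))"
      by (intro mult_right_mono mult_left_mono) auto
    also have "\<dots> = 1" by (simp add: exp_add[symmetric] distrib_left)
    finally show "exp (l * \<xi>) * (exp (l * \<eta>) - 1) * exp (- (l * (\<xi> + \<eta>))) \<le> 1" .
    show "0 \<le> exp (l * \<xi>) * (exp (l * \<eta>) - 1) * exp (- (l * (\<xi> + \<eta>)))" using l0 pos by simp
    show n0: "0 \<le> integral {0..\<eta>} n" using n by (intro integral_nonneg) auto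
    then show "0 \<le> Mp * integral {0..\<eta>} n" using pos by simp
  qed (use pos l0 in auto)
  finally show ?thesis by simp
qed

text \<open>The initial value enters pointwise only at \<open>2 * x\<close> and otherwise through
  its \<open>L1\<close> norm. In this form the bound serves both for uniform and for
  \<open>L2\<close> estimates, with a constant chosen before \<open>M\<close> and
  \<open>e\<close>.\<close>

lemma trace_problem_estimate:
  fixes p :: "real \<Rightarrow> complex"
  assumes b: "b > 0" and p: "continuous_on {0..b} p"
  obtains C where "C \<ge> 0" and
    "\<And>M e x. continuous_on ({0..b} \<times> UNIV) (\<lambda>(x, c). M x c) \<Longrightarrow> continuous_on {-2*b..2*b} e \<Longrightarrow>
      (\<And>x c. x \<in> {0..b} \<Longrightarrow> c \<le> 2 * b \<Longrightarrow> M x c = e c + integral {0..x} (\<lambda>y. p y * M y (2 * y - c))) \<Longrightarrow>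
      x \<in> {0..b} \<Longrightarrow> cmod (M x (2 * x)) \<le> cmod (e (2 * x)) + C * integral {-2*b..2*b} (\<lambda>z. cmod (e z))"
proof -
  obtain Mp where Mp: "Mp \<ge> 0" "\<And>x. x \<in> {0..b} \<Longrightarrow> cmod (p x) \<le> Mp"
    using continuous_on_compact_bound[OF compact_Icc p] by blast
  define l where "l = 2 * Mp + 1"
  have "cmod (M x (2 * x)) \<le> cmod (e (2 * x)) + Mp * exp (l * b) * integral {-2*b..2*b} (\<lambda>z. cmod (e z))"
    if M: "continuous_on ({0..b} \<times> UNIV) (\<lambda>(x, c). M x c)" and e: "continuous_on {-2*b..2*b} e"
      and eq: "\<And>x c. x \<in> {0..b} \<Longrightarrow> c \<le> 2 * b \<Longrightarrow> M x c = e c + integral {0..x} (\<lambda>y. p y * M y (2 * y - c))"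
      and x: "x \<in> {0..b}" for M e x
  proof -
    define J where "J = integral {-2*b..2*b} (\<lambda>z. cmod (e z))"
    \<comment> \<open>Closed under passage from \<open>(x, c)\<close> to
      \<open>(y, 2 * y - c)\<close> with \<open>0 \<le> y \<le> x\<close>, contained in the strip
      where \<open>e\<close> is continuous, and containing all points
      \<open>(x, 2 * x)\<close>.\<close>
    define D where "D = {(x, c). 0 \<le> x \<and> x \<le> b \<and> 2 * x - 2 * b \<le> c \<and> c \<le> 2 * b}"
    \<comment> \<open>Subtracting \<open>cmod (e c)\<close> leaves the part of \<open>M\<close>
      produced by the integral, for which only the integral of \<open>cmod (e z)\<close>
      matters.\<close>
    define W where "W = (\<lambda>(x, c). (cmod (M x c) - cmod (e c)) * exp (- (l * (0 + x))))"
    have ce: "continuous_on {-2*b..2*b} (\<lambda>z. cmod (e z))" using e by (intro continuous_intros)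
    have J: "J \<ge> 0" unfolding J_def by (intro integral_nonneg integrable_continuous_real ce) auto
    obtain B0 where B0: "\<And>z. z \<in> {0..b} \<times> {-2*b..2*b} \<Longrightarrow> cmod ((\<lambda>(x, c). M x c) z) \<le> B0"
      using continuous_on_compact_bound[OF compact_Times[OF compact_Icc compact_Icc]
          continuous_on_subset[OF M Sigma_mono[OF subset_refl subset_UNIV]]] by blast
    have l0: "l > 0" using Mp by (simp add: l_def)
    have "W z \<le> 2 * (Mp * (J / 2))" if "z \<in> D" for z
    proof (rule sup_halving[OF _ _ _ that])
      show "W z \<le> B0" if "z \<in> D" for z
      proof -
        obtain x c where z: "z = (x, c)" by force
        have xc: "0 \<le> x" "x \<le> b" "-2*b \<le> c" "c \<le> 2*b" using that by (auto simp: z D_def)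
        have "W z \<le> cmod (M x c) * exp (- (l * (0 + x)))" by (simp add: W_def z)
        also have "\<dots> \<le> cmod (M x c) * 1" using l0 xc by (intro mult_left_mono) auto
        also have "\<dots> \<le> B0" using B0[of "(x, c)"] xc by simp
        finally show ?thesis .
      qed
      show "0 \<le> Mp * (J / 2)" using Mp J by simp
    next
      fix B z assume B: "0 \<le> (B::real)" and WB: "\<And>z. z \<in> D \<Longrightarrow> W z \<le> B" and zD: "z \<in> D"
      obtain x c where z: "z = (x, c)" by force
      have xc: "0 \<le> x" "x \<le> b" "2 * x - 2*b \<le> c" "c \<le> 2*b" using zD by (auto simp: z D_def)
      have ca: "continuous_on {0..x} (\<lambda>y. cmod (e (2 * y - c)))"
        using xc by (intro continuous_intros continuous_on_compose2[OF e]) auto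
      have "continuous_on {0..x} (\<lambda>y. (\<lambda>(x, c). M x c) (y, 2 * y - c))"
        using xc by (intro continuous_on_compose2[OF M]) (auto intro!: continuous_intros)
      then have cphi: "continuous_on {0..x} (\<lambda>y. p y * M y (2 * y - c))"
        using xc by (auto intro!: continuous_intros continuous_on_subset[OF p])
      have "cmod (integral {0..x} (\<lambda>y. p y * M y (2 * y - c))) * exp (- (l * (0 + x)))
          \<le> Mp * integral {0..x} (\<lambda>y. cmod (e (2 * y - c))) + B / 2"
      proof (rule weighted_Volterra_step[OF l_def Mp(1) B _ xc(1) integrable_continuous_real[OF cphi] integrable_continuous_real[OF ca]])
        fix y assume y: "y \<in> {0..x}"
        have "(y, 2 * y - c) \<in> D" using y xc by (auto simp: D_def)
        from WB[OF this] have "cmod (M y (2 * y - c)) - cmod (e (2 * y - c)) \<le> B * exp (l * (0 + y))"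
          by (simp add: W_def mult_exp_minus_le_iff)
        then show "cmod (p y * M y (2 * y - c)) \<le> Mp * (cmod (e (2 * y - c)) + B * exp (l * (0 + y)))"
          unfolding norm_mult using y xc Mp by (intro mult_mono) auto
      qed auto
      also have "integral {0..x} (\<lambda>y. cmod (e (2 * y - c))) \<le> J / 2"
      proof -
        have sub: "{2 * 0 + - c..2 * x + - c} \<subseteq> {-2*b..2*b}" using xc by auto
        have "integral {0..x} (\<lambda>y. cmod (e (2 * y + - c))) = integral {2 * 0 + - c..2 * x + - c} (\<lambda>z. cmod (e z)) /\<^sub>R 2"
          using xc by (intro integral_affine) (auto intro!: integrable_continuous_real continuous_on_subset[OF ce])
        also have "integral {2 * 0 + - c..2 * x + - c} (\<lambda>z. cmod (e z)) \<le> J"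
          unfolding J_def using sub by (intro integral_subset_le integrable_continuous_real ce continuous_on_subset[OF ce]) auto
        finally show ?thesis by simp
      qed
      finally have *: "cmod (integral {0..x} (\<lambda>y. p y * M y (2 * y - c))) * exp (- (l * (0 + x))) \<le> Mp * (J / 2) + B / 2"
        using Mp by (simp add: mult_left_mono)
      have "cmod (M x c) - cmod (e c) \<le> cmod (integral {0..x} (\<lambda>y. p y * M y (2 * y - c)))"
        using eq[of x c] xc norm_add_diff_le[of "e c"] by simp
      then have "W z \<le> cmod (integral {0..x} (\<lambda>y. p y * M y (2 * y - c))) * exp (- (l * (0 + x)))"
        unfolding W_def z by (simp add: mult_right_mono)
      with * show "W z \<le> Mp * (J / 2) + B / 2" by linarith
    qed
    from this[of "(x, 2 * x)"] have "(cmod (M x (2 * x)) - cmod (e (2 * x))) \<le> Mp * J * exp (l * x)"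
      using x b by (auto simp: W_def D_def mult_exp_minus_le_iff)
    also have "\<dots> \<le> Mp * J * exp (l * b)" using Mp J l0 x by (intro mult_left_mono) auto
    finally show ?thesis unfolding J_def by (simp add: mult_ac)
  qed
  moreover have "Mp * exp (l * b) \<ge> 0" using Mp by simp
  ultimately show ?thesis using that by blast
qed

lemma compact_triangle: "compact {(\<xi>, \<eta>). 0 \<le> \<xi> \<and> 0 \<le> \<eta> \<and> \<xi> + \<eta> \<le> (b :: real)}" (is "compact ?T")
proof -
  have "?T = {z. 0 \<le> fst z \<and> 0 \<le> snd z \<and> fst z + snd z \<le> b}" by auto
  moreover have "closed {z :: real \<times> real. 0 \<le> fst z \<and> 0 \<le> snd z \<and> fst z + snd z \<le> b}"
    by (intro closed_Collect_conj closed_Collect_le continuous_intros)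
  moreover have "?T \<subseteq> {0..b} \<times> {0..b}" by auto
  ultimately show ?thesis
    using compact_Int_closed[OF compact_Times[OF compact_Icc compact_Icc], of ?T 0 b 0 b] by (simp add: Int_absorb1)
qed

text \<open>Each unknown is compared with the datum carried along its own characteristic, and the
  coupling contributes \<open>L1\<close> norms only. For this reason the estimate can be integrated
  over every line \<open>\<xi> + \<eta> = x\<close>, uniformly in \<open>x\<close>, with the data
  measured in \<open>L2\<close>.\<close>

lemma Goursat_estimate:
  fixes p :: "real \<Rightarrow> complex"
  assumes b: "b > 0" and p: "continuous_on {0..b} p"
  defines "T \<equiv> {(\<xi>, \<eta>). 0 \<le> \<xi> \<and> 0 \<le> \<eta> \<and> \<xi> + \<eta> \<le> b}"
  obtains C where "C \<ge> 0" and
    "\<And>m s \<mu> \<nu> \<xi> \<eta>. continuous_on T (\<lambda>(\<xi>, \<eta>). m \<xi> \<eta>) \<Longrightarrow> continuous_on T (\<lambda>(\<xi>, \<eta>). s \<xi> \<eta>) \<Longrightarrow>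
      continuous_on {0..b} \<mu> \<Longrightarrow> continuous_on {0..b} \<nu> \<Longrightarrow>
      (\<And>\<xi> \<eta>. (\<xi>, \<eta>) \<in> T \<Longrightarrow> m \<xi> \<eta> = \<mu> \<xi> + integral {0..\<eta>} (\<lambda>v. p (\<xi> + v) * s \<xi> v)) \<Longrightarrow>
      (\<And>\<xi> \<eta>. (\<xi>, \<eta>) \<in> T \<Longrightarrow> s \<xi> \<eta> = \<nu> \<eta> + integral {0..\<xi>} (\<lambda>u. p (u + \<eta>) * m u \<eta>)) \<Longrightarrow>
      (\<xi>, \<eta>) \<in> T \<Longrightarrow>
      cmod (m \<xi> \<eta>) \<le> cmod (\<mu> \<xi>) + C * (integral {0..b} (\<lambda>z. cmod (\<mu> z)) + integral {0..b} (\<lambda>z. cmod (\<nu> z))) \<and>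
      cmod (s \<xi> \<eta>) \<le> cmod (\<nu> \<eta>) + C * (integral {0..b} (\<lambda>z. cmod (\<mu> z)) + integral {0..b} (\<lambda>z. cmod (\<nu> z)))"
proof -
  obtain Mp where Mp: "Mp \<ge> 0" "\<And>x. x \<in> {0..b} \<Longrightarrow> cmod (p x) \<le> Mp"
    using continuous_on_compact_bound[OF compact_Icc p] by blast
  define l where "l = 2 * Mp + 1"
  have l0: "l > 0" using Mp by (simp add: l_def)
  have cT: "compact T" unfolding T_def by (rule compact_triangle)
  have "cmod (m \<xi> \<eta>) \<le> cmod (\<mu> \<xi>) + 2 * Mp * exp (l * b) * (integral {0..b} (\<lambda>z. cmod (\<mu> z)) + integral {0..b} (\<lambda>z. cmod (\<nu> z))) \<and>
      cmod (s \<xi> \<eta>) \<le> cmod (\<nu> \<eta>) + 2 * Mp * exp (l * b) * (integral {0..b} (\<lambda>z. cmod (\<mu> z)) + integral {0..b} (\<lambda>z. cmod (\<nu> z)))"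
    if m: "continuous_on T (\<lambda>(\<xi>, \<eta>). m \<xi> \<eta>)" and s: "continuous_on T (\<lambda>(\<xi>, \<eta>). s \<xi> \<eta>)"
      and mu: "continuous_on {0..b} \<mu>" and nu: "continuous_on {0..b} \<nu>"
      and eqm: "\<And>\<xi> \<eta>. (\<xi>, \<eta>) \<in> T \<Longrightarrow> m \<xi> \<eta> = \<mu> \<xi> + integral {0..\<eta>} (\<lambda>v. p (\<xi> + v) * s \<xi> v)"
      and eqs: "\<And>\<xi> \<eta>. (\<xi>, \<eta>) \<in> T \<Longrightarrow> s \<xi> \<eta> = \<nu> \<eta> + integral {0..\<xi>} (\<lambda>u. p (u + \<eta>) * m u \<eta>)"
      and mem: "(\<xi>, \<eta>) \<in> T" for m s \<mu> \<nu> \<xi> \<eta>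
  proof -
    define J where "J = integral {0..b} (\<lambda>z. cmod (\<mu> z)) + integral {0..b} (\<lambda>z. cmod (\<nu> z))"
    have cm: "continuous_on {0..b} (\<lambda>z. cmod (\<mu> z))" and cn: "continuous_on {0..b} (\<lambda>z. cmod (\<nu> z))"
      using mu nu by (auto intro!: continuous_intros)
    have part: "integral {0..y} (\<lambda>z. cmod (\<mu> z)) \<le> J" "integral {0..y} (\<lambda>z. cmod (\<nu> z)) \<le> J" if "0 \<le> y" "y \<le> b" for y
    proof -
      have "integral {0..y} (\<lambda>z. cmod (\<mu> z)) \<le> integral {0..b} (\<lambda>z. cmod (\<mu> z))"
         "integral {0..y} (\<lambda>z. cmod (\<nu> z)) \<le> integral {0..b} (\<lambda>z. cmod (\<nu> z))"
        using that by (auto intro!: integral_subset_le integrable_continuous_real cm cn continuous_on_subset[OF cm] continuous_on_subset[OF cn])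
      moreover have "0 \<le> integral {0..b} (\<lambda>z. cmod (\<mu> z))" "0 \<le> integral {0..b} (\<lambda>z. cmod (\<nu> z))"
        by (auto intro!: integral_nonneg integrable_continuous_real cm cn)
      ultimately show "integral {0..y} (\<lambda>z. cmod (\<mu> z)) \<le> J" "integral {0..y} (\<lambda>z. cmod (\<nu> z)) \<le> J"
        by (auto simp: J_def)
    qed
    have J: "J \<ge> 0" using part(1)[of 0] b by simp
    \<comment> \<open>The weight depends on \<open>\<xi> + \<eta>\<close>, so it grows along both
      directions of integration and one supremum handles the coupled pair.\<close>
    define W where "W = (\<lambda>(\<xi>, \<eta>). max (cmod (m \<xi> \<eta>) - cmod (\<mu> \<xi>)) (cmod (s \<xi> \<eta>) - cmod (\<nu> \<eta>)) * exp (- (l * (\<xi> + \<eta>))))"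
    obtain B1 where B1: "\<And>z. z \<in> T \<Longrightarrow> cmod ((\<lambda>(\<xi>, \<eta>). m \<xi> \<eta>) z) \<le> B1"
      using continuous_on_compact_bound[OF cT m] by blast
    obtain B2 where B2: "\<And>z. z \<in> T \<Longrightarrow> cmod ((\<lambda>(\<xi>, \<eta>). s \<xi> \<eta>) z) \<le> B2"
      using continuous_on_compact_bound[OF cT s] by blast
    have "W z \<le> 2 * (Mp * J)" if "z \<in> T" for z
    proof (rule sup_halving[OF _ _ _ that])
      show "W z \<le> max B1 B2" if "z \<in> T" for z
      proof -
        obtain x c where z: "z = (x, c)" by force
        have b12: "cmod (m x c) \<le> B1" "cmod (s x c) \<le> B2" using B1[OF that] B2[OF that] by (auto simp: z)
        have "max (cmod (m x c) - cmod (\<mu> x)) (cmod (s x c) - cmod (\<nu> c)) \<le> max (cmod (m x c)) (cmod (s x c))"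
          using norm_ge_zero[of "\<mu> x"] norm_ge_zero[of "\<nu> c"] by linarith
        then have "W z \<le> max (cmod (m x c)) (cmod (s x c)) * exp (- (l * (x + c)))"
          unfolding W_def z by (simp add: mult_right_mono)
        also have "\<dots> \<le> max (cmod (m x c)) (cmod (s x c)) * 1"
          using l0 that by (intro mult_left_mono) (auto simp: T_def z le_max_iff_disj)
        also have "\<dots> \<le> max B1 B2" using b12 by auto
        finally show ?thesis .
      qed
      show "0 \<le> Mp * J" using Mp J by simp
    next
      fix B z assume B: "0 \<le> (B::real)" and WB: "\<And>z. z \<in> T \<Longrightarrow> W z \<le> B" and zT: "z \<in> T"
      obtain x y where z: "z = (x, y)" by force
      have xy: "0 \<le> x" "0 \<le> y" "x + y \<le> b" using zT by (auto simp: z T_def)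
      have Wb: "cmod (m u v) - cmod (\<mu> u) \<le> B * exp (l * (u + v))" "cmod (s u v) - cmod (\<nu> v) \<le> B * exp (l * (u + v))"
        if "(u, v) \<in> T" for u v
        using WB[OF that] by (auto simp: W_def mult_exp_minus_le_iff)
      have "continuous_on {0..y} (\<lambda>v. (\<lambda>(\<xi>, \<eta>). s \<xi> \<eta>) (x, v))"
        using xy by (intro continuous_on_compose2[OF s]) (auto intro!: continuous_intros simp: T_def)
      then have c1: "continuous_on {0..y} (\<lambda>v. p (x + v) * s x v)"
        using xy by (auto intro!: continuous_intros continuous_on_compose2[OF p])
      have "continuous_on {0..x} (\<lambda>u. (\<lambda>(\<xi>, \<eta>). m \<xi> \<eta>) (u, y))"
        using xy by (intro continuous_on_compose2[OF m]) (auto intro!: continuous_intros simp: T_def)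
      then have c2: "continuous_on {0..x} (\<lambda>u. p (u + y) * m u y)"
        using xy by (auto intro!: continuous_intros continuous_on_compose2[OF p])
      have c3: "continuous_on {0..y} (\<lambda>v. cmod (\<nu> v))" and c4: "continuous_on {0..x} (\<lambda>v. cmod (\<mu> v))"
        using xy by (auto intro!: continuous_on_subset[OF cn] continuous_on_subset[OF cm])
      have "cmod (integral {0..y} (\<lambda>v. p (x + v) * s x v)) * exp (- (l * (x + y))) \<le> Mp * integral {0..y} (\<lambda>v. cmod (\<nu> v)) + B / 2"
      proof (rule weighted_Volterra_step[OF l_def Mp(1) B xy(1,2) integrable_continuous_real[OF c1] integrable_continuous_real[OF c3]])
        fix v assume v: "v \<in> {0..y}"
        have "(x, v) \<in> T" using v xy by (auto simp: T_def)
        from Wb(2)[OF this]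
        show "cmod (p (x + v) * s x v) \<le> Mp * (cmod (\<nu> v) + B * exp (l * (x + v)))"
          unfolding norm_mult using v xy Mp by (intro mult_mono) auto
      qed auto
      also have "\<dots> \<le> Mp * J + B / 2" using part(2)[of y] xy Mp by (auto intro!: mult_left_mono)
      finally have 1: "cmod (integral {0..y} (\<lambda>v. p (x + v) * s x v)) * exp (- (l * (x + y))) \<le> Mp * J + B / 2" .
      have "cmod (integral {0..x} (\<lambda>u. p (u + y) * m u y)) * exp (- (l * (y + x))) \<le> Mp * integral {0..x} (\<lambda>v. cmod (\<mu> v)) + B / 2"
      proof (rule weighted_Volterra_step[OF l_def Mp(1) B xy(2,1) integrable_continuous_real[OF c2] integrable_continuous_real[OF c4]])
        fix u assume u: "u \<in> {0..x}"
        have "(u, y) \<in> T" using u xy by (auto simp: T_def)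
        from Wb(1)[OF this]
        show "cmod (p (u + y) * m u y) \<le> Mp * (cmod (\<mu> u) + B * exp (l * (y + u)))"
          unfolding norm_mult using u xy Mp by (intro mult_mono) (auto simp: add.commute)
      qed auto
      also have "\<dots> \<le> Mp * J + B / 2" using part(1)[of x] xy Mp by (auto intro!: mult_left_mono)
      finally have 2: "cmod (integral {0..x} (\<lambda>u. p (u + y) * m u y)) * exp (- (l * (x + y))) \<le> Mp * J + B / 2"
        by (simp add: add.commute)
      have "cmod (m x y) - cmod (\<mu> x) \<le> cmod (integral {0..y} (\<lambda>v. p (x + v) * s x v))"
        using eqm[of x y] zT norm_add_diff_le[of "\<mu> x"] by (simp add: z)
      then have "(cmod (m x y) - cmod (\<mu> x)) * exp (- (l * (x + y))) \<le> Mp * J + B / 2"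
        using 1 mult_right_mono[of _ _ "exp (- (l * (x + y)))"] by (meson exp_ge_zero order_trans)
      moreover
      have "cmod (s x y) - cmod (\<nu> y) \<le> cmod (integral {0..x} (\<lambda>u. p (u + y) * m u y))"
        using eqs[of x y] zT norm_add_diff_le[of "\<nu> y"] by (simp add: z)
      then have "(cmod (s x y) - cmod (\<nu> y)) * exp (- (l * (x + y))) \<le> Mp * J + B / 2"
        using 2 mult_right_mono[of _ _ "exp (- (l * (x + y)))"] by (meson exp_ge_zero order_trans)
      ultimately show "W z \<le> Mp * J + B / 2" unfolding W_def z by (simp add: max_def)
    qed
    from this[OF mem] have "max (cmod (m \<xi> \<eta>) - cmod (\<mu> \<xi>)) (cmod (s \<xi> \<eta>) - cmod (\<nu> \<eta>)) \<le> 2 * (Mp * J) * exp (l * (\<xi> + \<eta>))"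
      by (simp add: W_def mult_exp_minus_le_iff)
    also have "\<dots> \<le> 2 * (Mp * J) * exp (l * b)" using Mp J l0 mem by (intro mult_left_mono) (auto simp: T_def)
    also have "\<dots> = 2 * Mp * exp (l * b) * J" by simp
    finally show ?thesis unfolding J_def[symmetric] max.bounded_iff diff_le_eq add.commute[of "2 * _ * _ * _"] .
  qed
  moreover have "2 * Mp * exp (l * b) \<ge> 0" using Mp by simp
  ultimately show ?thesis using that by blast
qed

section \<open>The first order system satisfied by the two kernels\<close>

text \<open>For the sum \<open>s\<close> and the difference \<open>m\<close> of the two kernels, the integral equations are the twice integrated
  form of \<open>s\<^sub>\<xi> = p m\<close>, \<open>m\<^sub>\<eta> = p s\<close>. The defects \<open>\<sigma> = s\<^sub>\<xi> - p m\<close> and \<open>\<rho> = m\<^sub>\<eta> - p s\<close> solve a homogeneous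
  Volterra system and hence vanish.\<close>

lemma transmutation_kernels_first_order:
  fixes p q1 q2 :: "real \<Rightarrow> complex"
  assumes b: "b > 0" and q1: "continuous_on {0..b} q1"
    and p': "\<And>x. x \<in> {0..b} \<Longrightarrow> (p has_vector_derivative (q1 x - (p x)\<^sup>2)) (at x within {0..b})"
    and q2: "\<And>x. x \<in> {0..b} \<Longrightarrow> q2 x = 2 * (p x)\<^sup>2 - q1 x"
    and K1: "transmutation_kernel b q1 (p 0) K1" and K2: "transmutation_kernel b q2 (- p 0) K2"
  defines "T \<equiv> {(\<xi>, \<eta>). 0 \<le> \<xi> \<and> 0 \<le> \<eta> \<and> \<xi> + \<eta> \<le> b}"
  defines "m \<equiv> \<lambda>\<xi> \<eta>. K1 (\<xi> + \<eta>) (\<xi> - \<eta>) - K2 (\<xi> + \<eta>) (\<xi> - \<eta>)"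
    and "s \<equiv> \<lambda>\<xi> \<eta>. K1 (\<xi> + \<eta>) (\<xi> - \<eta>) + K2 (\<xi> + \<eta>) (\<xi> - \<eta>)"
  shows "continuous_on T (\<lambda>(\<xi>, \<eta>). m \<xi> \<eta>)" "continuous_on T (\<lambda>(\<xi>, \<eta>). s \<xi> \<eta>)"
    and "(\<xi>, \<eta>) \<in> T \<Longrightarrow> m \<xi> \<eta> = p \<xi> + integral {0..\<eta>} (\<lambda>v. p (\<xi> + v) * s \<xi> v)"
    and "(\<xi>, \<eta>) \<in> T \<Longrightarrow> s \<xi> \<eta> = integral {0..\<xi>} (\<lambda>u. p (u + \<eta>) * m u \<eta>)"
proof -
  have p: "continuous_on {0..b} p"
    using p' by (intro continuous_on_vector_derivative)
  \<comment> \<open>The derivative of \<open>p\<close>; in terms of it \<open>q1 = d + p^2\<close>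
    and \<open>q2 = p^2 - d\<close>.\<close>
  define d where "d = (\<lambda>x. q1 x - (p x)\<^sup>2)"
  have d: "continuous_on {0..b} d" unfolding d_def by (intro continuous_intros q1 p)
  have cq2: "continuous_on {0..b} q2"
  proof -
    have "continuous_on {0..b} (\<lambda>x. 2 * (p x)\<^sup>2 - q1 x)" by (intro continuous_intros q1 p)
    then show ?thesis by (rule continuous_on_eq) (simp add: q2)
  qed
  define H1 where "H1 = (\<lambda>\<xi> \<eta>. K1 (\<xi> + \<eta>) (\<xi> - \<eta>))"
  define H2 where "H2 = (\<lambda>\<xi> \<eta>. K2 (\<xi> + \<eta>) (\<xi> - \<eta>))"
  have cH1: "continuous_on T (\<lambda>z. H1 (fst z) (snd z))" and cH2: "continuous_on T (\<lambda>z. H2 (fst z) (snd z))"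
    using K1 K2 unfolding transmutation_kernel_def Let_def T_def H1_def H2_def by (auto simp: split_def)
  have mH: "m \<xi> \<eta> = H1 \<xi> \<eta> - H2 \<xi> \<eta>" and sH: "s \<xi> \<eta> = H1 \<xi> \<eta> + H2 \<xi> \<eta>" for \<xi> \<eta>
    by (auto simp: m_def s_def H1_def H2_def)
  have cm: "continuous_on T (\<lambda>z. m (fst z) (snd z))" and cs: "continuous_on T (\<lambda>z. s (fst z) (snd z))"
    unfolding mH sH by (auto intro!: continuous_intros cH1 cH2)
  then show "continuous_on T (\<lambda>(\<xi>, \<eta>). m \<xi> \<eta>)" "continuous_on T (\<lambda>(\<xi>, \<eta>). s \<xi> \<eta>)"
    by (simp_all add: split_def)
  have cT: "continuous_on T (\<lambda>z. f (fst z + snd z))" if "continuous_on {0..b} f" for f :: "real \<Rightarrow> complex"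
    by (rule continuous_on_compose2[OF that]) (auto intro!: continuous_intros simp: T_def)
  \<comment> \<open>\<open>G1\<close> is \<open>q1 * H1 - q2 * H2\<close> and \<open>G2\<close> is
    \<open>q1 * H1 + q2 * H2\<close>, rewritten in \<open>m\<close> and \<open>s\<close>.\<close>
  define G1 where "G1 = (\<lambda>u v. d (u + v) * s u v + (p (u + v))\<^sup>2 * m u v)"
  define G2 where "G2 = (\<lambda>u v. d (u + v) * m u v + (p (u + v))\<^sup>2 * s u v)"
  have cG1: "continuous_on T (\<lambda>z. G1 (fst z) (snd z))" and cG2: "continuous_on T (\<lambda>z. G2 (fst z) (snd z))"
    unfolding G1_def G2_def by (auto intro!: continuous_intros cm cs cT d p)
  define I where "I = (\<lambda>\<xi> v. integral {0..\<xi>} (\<lambda>u. G1 u v))"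
  define J where "J = (\<lambda>u \<eta>. integral {0..\<eta>} (\<lambda>v. G2 u v))"
  have rect: "{0..\<xi>} \<times> {0..\<eta>} \<subseteq> T" if "(\<xi>, \<eta>) \<in> T" for \<xi> \<eta>
    using that by (auto simp: T_def)
  have row: "continuous_on {0..\<eta>} (\<lambda>v. F \<xi> v)" and col: "continuous_on {0..\<xi>} (\<lambda>u. F u \<eta>)"
    and param_row: "continuous_on {0..\<eta>} (\<lambda>v. integral {0..\<xi>} (\<lambda>u. F u v))"
    and param_col: "continuous_on {0..\<xi>} (\<lambda>u. integral {0..\<eta>} (\<lambda>v. F u v))"
    if F: "continuous_on T (\<lambda>z. F (fst z) (snd z))" and mem: "(\<xi>, \<eta>) \<in> T" for F :: "real \<Rightarrow> real \<Rightarrow> complex" and \<xi> \<eta>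
  proof -
    have c: "continuous_on ({0..\<xi>} \<times> {0..\<eta>}) (\<lambda>z. F (fst z) (snd z))"
      by (rule continuous_on_subset[OF F rect[OF mem]])
    have pos: "0 \<le> \<xi>" "0 \<le> \<eta>" using mem by (auto simp: T_def)
    have "continuous_on {0..\<eta>} (\<lambda>v. (\<lambda>z. F (fst z) (snd z)) (\<xi>, v))"
      using pos by (intro continuous_on_compose2[OF c] continuous_on_Pair continuous_on_const continuous_on_id) auto
    then show "continuous_on {0..\<eta>} (\<lambda>v. F \<xi> v)" by simp
    have "continuous_on {0..\<xi>} (\<lambda>u. (\<lambda>z. F (fst z) (snd z)) (u, \<eta>))"
      using pos by (intro continuous_on_compose2[OF c] continuous_on_Pair continuous_on_const continuous_on_id) auto
    then show "continuous_on {0..\<xi>} (\<lambda>u. F u \<eta>)" by simp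
    show "continuous_on {0..\<xi>} (\<lambda>u. integral {0..\<eta>} (\<lambda>v. F u v))"
      using integral_continuous_on_param[of "{0..\<xi>}" 0 \<eta> F] c by (simp add: split_def)
    have "continuous_on ({0..\<eta>} \<times> {0..\<xi>}) (\<lambda>z. (\<lambda>z. F (fst z) (snd z)) (snd z, fst z))"
      by (intro continuous_on_compose2[OF c] continuous_on_Pair continuous_on_fst continuous_on_snd continuous_on_id) auto
    then show "continuous_on {0..\<eta>} (\<lambda>v. integral {0..\<xi>} (\<lambda>u. F u v))"
      using integral_continuous_on_param[of "{0..\<eta>}" 0 \<xi> "\<lambda>v u. F u v"] by (simp add: split_def)
  qed
  have sub: "(u, v) \<in> T" if "(\<xi>, \<eta>) \<in> T" "u \<in> {0..\<xi>}" "v \<in> {0..\<eta>}" for u v \<xi> \<eta>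
    using that by (auto simp: T_def)
  have T1: "\<xi> \<in> {0..b}" "\<eta> \<in> {0..b}" "\<xi> + \<eta> \<in> {0..b}" "0 \<le> \<xi>" "0 \<le> \<eta>" if "(\<xi>, \<eta>) \<in> T" for \<xi> \<eta>
    using that by (auto simp: T_def)
  have sumint: "integral {0..x} q1 + integral {0..x} q2 = integral {0..x} (\<lambda>u. 2 * (p u)\<^sup>2)"
     "integral {0..x} q1 - integral {0..x} q2 = 2 * (p x - p 0)" if x: "x \<in> {0..b}" for x
  proof -
    have iq: "q1 integrable_on {0..x}" "q2 integrable_on {0..x}"
      using x by (auto intro!: integrable_continuous_real continuous_on_subset[OF q1] continuous_on_subset[OF cq2])
    have "integral {0..x} q1 + integral {0..x} q2 = integral {0..x} (\<lambda>u. q1 u + q2 u)"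
      by (rule Henstock_Kurzweil_Integration.integral_add[OF iq, symmetric])
    also have "\<dots> = integral {0..x} (\<lambda>u. 2 * (p u)\<^sup>2)"
      using x q2 by (intro integral_cong) auto
    finally show "integral {0..x} q1 + integral {0..x} q2 = integral {0..x} (\<lambda>u. 2 * (p u)\<^sup>2)" .
    have "((\<lambda>u. q1 u - (p u)\<^sup>2) has_integral (p x - p 0)) {0..x}"
      using x by (intro fundamental_theorem_of_calculus) (auto intro!: has_vector_derivative_within_subset[OF p'])
    then have "((\<lambda>u. 2 * (q1 u - (p u)\<^sup>2)) has_integral 2 * (p x - p 0)) {0..x}"
      by (rule has_integral_mult_right)
    then have "integral {0..x} (\<lambda>u. 2 * (q1 u - (p u)\<^sup>2)) = 2 * (p x - p 0)" by (rule integral_unique)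
    moreover have "integral {0..x} q1 - integral {0..x} q2 = integral {0..x} (\<lambda>u. q1 u - q2 u)"
      by (rule Henstock_Kurzweil_Integration.integral_diff[OF iq, symmetric])
    moreover have "\<dots> = integral {0..x} (\<lambda>u. 2 * (q1 u - (p u)\<^sup>2))"
      using x q2 by (intro integral_cong) auto
    ultimately show "integral {0..x} q1 - integral {0..x} q2 = 2 * (p x - p 0)" by simp
  qed
  have cq1H: "continuous_on T (\<lambda>z. q1 (fst z + snd z) * H1 (fst z) (snd z))"
    and cq2H: "continuous_on T (\<lambda>z. q2 (fst z + snd z) * H2 (fst z) (snd z))"
    by (auto intro!: continuous_intros cT q1 cq2 cH1 cH2)
  have dbl: "integral {0..\<xi>} (\<lambda>u. integral {0..\<eta>} (\<lambda>v. q1 (u + v) * H1 u v)) + integral {0..\<xi>} (\<lambda>u. integral {0..\<eta>} (\<lambda>v. q2 (u + v) * H2 u v))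
        = integral {0..\<xi>} (\<lambda>u. integral {0..\<eta>} (\<lambda>v. G2 u v))" (is "?A1 + ?A2 = _")
    "integral {0..\<xi>} (\<lambda>u. integral {0..\<eta>} (\<lambda>v. q1 (u + v) * H1 u v)) - integral {0..\<xi>} (\<lambda>u. integral {0..\<eta>} (\<lambda>v. q2 (u + v) * H2 u v))
        = integral {0..\<xi>} (\<lambda>u. integral {0..\<eta>} (\<lambda>v. G1 u v))"
    if mem: "(\<xi>, \<eta>) \<in> T" for \<xi> \<eta>
  proof -
    note o1 = integrable_continuous_real[OF param_col[OF cq1H mem]] and o2 = integrable_continuous_real[OF param_col[OF cq2H mem]]
    have i1: "(\<lambda>v. q1 (u + v) * H1 u v) integrable_on {0..\<eta>}" and i2: "(\<lambda>v. q2 (u + v) * H2 u v) integrable_on {0..\<eta>}"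
      if "u \<in> {0..\<xi>}" for u
      using row[OF cq1H, of u \<eta>] row[OF cq2H, of u \<eta>] sub[OF mem that] T1[OF mem] by (auto intro!: integrable_continuous_real)
    have e: "q1 (u + v) * H1 u v + q2 (u + v) * H2 u v = G2 u v" "q1 (u + v) * H1 u v - q2 (u + v) * H2 u v = G1 u v"
      if "u \<in> {0..\<xi>}" "v \<in> {0..\<eta>}" for u v
    proof -
      have q2uv: "q2 (u + v) = 2 * (p (u + v))\<^sup>2 - q1 (u + v)" using T1(3)[OF sub[OF mem that]] by (rule q2)
      show "q1 (u + v) * H1 u v + q2 (u + v) * H2 u v = G2 u v" "q1 (u + v) * H1 u v - q2 (u + v) * H2 u v = G1 u v"
        unfolding q2uv G1_def G2_def mH sH d_def by (simp_all add: algebra_simps)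
    qed
    show "?A1 + ?A2 = integral {0..\<xi>} (\<lambda>u. integral {0..\<eta>} (\<lambda>v. G2 u v))"
      unfolding Henstock_Kurzweil_Integration.integral_add[OF o1 o2, symmetric]
      by (intro integral_cong) (auto simp: Henstock_Kurzweil_Integration.integral_add[OF i1 i2, symmetric] e intro!: integral_cong)
    show "?A1 - ?A2 = integral {0..\<xi>} (\<lambda>u. integral {0..\<eta>} (\<lambda>v. G1 u v))"
      unfolding Henstock_Kurzweil_Integration.integral_diff[OF o1 o2, symmetric]
      by (intro integral_cong) (auto simp: Henstock_Kurzweil_Integration.integral_diff[OF i1 i2, symmetric] e intro!: integral_cong)
  qed
  have eqH1: "H1 \<xi> \<eta> = p 0 / 2 + integral {0..\<xi>} q1 / 2 + integral {0..\<xi>} (\<lambda>u. integral {0..\<eta>} (\<lambda>v. q1 (u + v) * H1 u v))"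
    and eqH2: "H2 \<xi> \<eta> = - p 0 / 2 + integral {0..\<xi>} q2 / 2 + integral {0..\<xi>} (\<lambda>u. integral {0..\<eta>} (\<lambda>v. q2 (u + v) * H2 u v))"
    if "(\<xi>, \<eta>) \<in> T" for \<xi> \<eta>
    using K1 K2 that unfolding transmutation_kernel_def Let_def T_def H1_def H2_def by auto
  have cp2: "continuous_on {0..x} (\<lambda>u. (p u)\<^sup>2)" if "x \<in> {0..b}" for x
    using that by (auto intro!: continuous_intros continuous_on_subset[OF p])
  have s_eq: "s \<xi> \<eta> = integral {0..\<xi>} (\<lambda>u. (p u)\<^sup>2 + J u \<eta>)" if mem: "(\<xi>, \<eta>) \<in> T" for \<xi> \<eta>
  proof -
    have "s \<xi> \<eta> = (integral {0..\<xi>} q1 + integral {0..\<xi>} q2) / 2 + integral {0..\<xi>} (\<lambda>u. J u \<eta>)"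
      unfolding sH eqH1[OF mem] eqH2[OF mem] J_def dbl(1)[OF mem, symmetric] by (simp add: field_simps)
    also have "\<dots> = integral {0..\<xi>} (\<lambda>u. (p u)\<^sup>2) + integral {0..\<xi>} (\<lambda>u. J u \<eta>)"
      using sumint(1)[OF T1(1)[OF mem]] by simp
    also have "\<dots> = integral {0..\<xi>} (\<lambda>u. (p u)\<^sup>2 + J u \<eta>)"
      unfolding J_def
      by (rule Henstock_Kurzweil_Integration.integral_add[symmetric])
         (intro integrable_continuous_real cp2 T1[OF mem] param_col[OF cG2 mem])+
    finally show ?thesis .
  qed
  have m_eq: "m \<xi> \<eta> = p \<xi> + integral {0..\<eta>} (\<lambda>v. I \<xi> v)" if mem: "(\<xi>, \<eta>) \<in> T" for \<xi> \<eta>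
  proof -
    have "m \<xi> \<eta> = p 0 + (integral {0..\<xi>} q1 - integral {0..\<xi>} q2) / 2 + integral {0..\<xi>} (\<lambda>u. integral {0..\<eta>} (\<lambda>v. G1 u v))"
      unfolding mH eqH1[OF mem] eqH2[OF mem] dbl(2)[OF mem, symmetric] by (simp add: field_simps)
    also have "\<dots> = p \<xi> + integral {0..\<xi>} (\<lambda>u. integral {0..\<eta>} (\<lambda>v. G1 u v))"
      unfolding sumint(2)[OF T1(1)[OF mem]] by (simp add: field_simps)
    \<comment> \<open>Exchanging the integrals exhibits \<open>I\<close> as the derivative of
      \<open>m\<close> in \<open>\<eta>\<close>.\<close>
    also have "integral {0..\<xi>} (\<lambda>u. integral {0..\<eta>} (\<lambda>v. G1 u v)) = integral {0..\<eta>} (\<lambda>v. I \<xi> v)"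
      using integral_swap_continuous[of 0 0 \<xi> \<eta> G1] continuous_on_subset[OF cG1 rect[OF mem]]
      by (simp add: I_def split_def cbox_Pair_eq)
    finally show ?thesis .
  qed
  define \<rho> where "\<rho> = (\<lambda>\<xi> v. I \<xi> v - p (\<xi> + v) * s \<xi> v)"
  define \<sigma> where "\<sigma> = (\<lambda>u \<eta>. (p u)\<^sup>2 + J u \<eta> - p (u + \<eta>) * m u \<eta>)"
  have dp: "((\<lambda>v. p (k + v)) has_vector_derivative d (k + v)) (at v within {0..y})" if "0 \<le> k" "k + y \<le> b" "v \<in> {0..y}" for k v y
    unfolding d_def by (rule has_vector_derivative_translate[OF p']) (use that in auto)
  \<comment> \<open>The terms with \<open>d\<close> cancel, so the derivative of
    \<open>\<sigma>\<close> in \<open>\<eta>\<close> is \<open>- p * \<rho>\<close>; at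
    \<open>\<eta> = 0\<close> the defect vanishes because \<open>m u 0 = p u\<close>.\<close>
  have sig: "((\<lambda>v. p (u + v) * \<rho> u v) has_integral - \<sigma> u \<eta>) {0..\<eta>}" if mem: "(u, \<eta>) \<in> T" for u \<eta>
  proof -
    have "((\<lambda>v. p (u + v) * I u v + d (u + v) * m u v) has_integral (p (u + \<eta>) * m u \<eta> - p (u + 0) * m u 0)) {0..\<eta>}"
    proof (rule fundamental_theorem_of_calculus)
      show "0 \<le> \<eta>" using T1[OF mem] by simp
      fix v assume v: "v \<in> {0..\<eta>}"
      have cI: "continuous_on {0..\<eta>} (\<lambda>v. I u v)" unfolding I_def by (rule param_row[OF cG1 mem])
      have "((\<lambda>v. p u + integral {0..v} (\<lambda>v. I u v)) has_vector_derivative 0 + I u v) (at v within {0..\<eta>})"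
        by (intro has_vector_derivative_add has_vector_derivative_const integral_has_vector_derivative[OF cI v])
      then have "((\<lambda>v. m u v) has_vector_derivative I u v) (at v within {0..\<eta>})"
        by (rule has_vector_derivative_transform[OF v, rotated, THEN has_vector_derivative_eq_rhs])
           (use sub[OF mem] T1[OF mem] m_eq in auto)
      from has_vector_derivative_mult[OF dp[of u \<eta> v] this] show "((\<lambda>v. p (u + v) * m u v) has_vector_derivative p (u + v) * I u v + d (u + v) * m u v) (at v within {0..\<eta>})"
        using v mem by (simp add: T_def)
    qed
    moreover have "(G2 u has_integral J u \<eta>) {0..\<eta>}"
      unfolding J_def by (intro integrable_integral integrable_continuous_real row[OF cG2 mem])
    ultimately have "((\<lambda>v. (p (u + v) * I u v + d (u + v) * m u v) - G2 u v) has_integral ((p (u + \<eta>) * m u \<eta> - p (u + 0) * m u 0) - J u \<eta>)) {0..\<eta>}"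
      by (rule has_integral_diff)
    moreover have "(p (u + v) * I u v + d (u + v) * m u v) - G2 u v = p (u + v) * \<rho> u v" for v
      by (simp add: G2_def \<rho>_def algebra_simps power2_eq_square)
    moreover have "m u 0 = p u" using m_eq[of u 0] mem by (simp add: T_def)
    ultimately show ?thesis by (simp add: \<sigma>_def power2_eq_square algebra_simps)
  qed
  \<comment> \<open>Symmetrically, the derivative of \<open>\<rho>\<close> in \<open>\<xi>\<close>
    is \<open>- p * \<sigma>\<close>, starting from zero at \<open>\<xi> = 0\<close>, where
    \<open>s\<close> and \<open>I\<close> vanish.\<close>
  have rho: "((\<lambda>u. p (u + v) * \<sigma> u v) has_integral - \<rho> \<xi> v) {0..\<xi>}" if mem: "(\<xi>, v) \<in> T" for \<xi> v
  proof -
    have "((\<lambda>u. p (v + u) * ((p u)\<^sup>2 + J u v) + d (v + u) * s u v) has_integral (p (v + \<xi>) * s \<xi> v - p (v + 0) * s 0 v)) {0..\<xi>}"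
    proof (rule fundamental_theorem_of_calculus)
      show "0 \<le> \<xi>" using T1[OF mem] by simp
      fix u assume u: "u \<in> {0..\<xi>}"
      have cJ: "continuous_on {0..\<xi>} (\<lambda>u. (p u)\<^sup>2 + J u v)" unfolding J_def
        by (intro continuous_on_add cp2 T1[OF mem] param_col[OF cG2 mem])
      have "((\<lambda>u. integral {0..u} (\<lambda>u. (p u)\<^sup>2 + J u v)) has_vector_derivative (p u)\<^sup>2 + J u v) (at u within {0..\<xi>})"
        by (intro integral_has_vector_derivative[OF cJ u])
      then have "((\<lambda>u. s u v) has_vector_derivative (p u)\<^sup>2 + J u v) (at u within {0..\<xi>})"
        by (rule has_vector_derivative_transform[OF u, rotated])
           (use sub[OF mem] T1[OF mem] s_eq in auto)
      from has_vector_derivative_mult[OF dp[of v \<xi> u] this] show "((\<lambda>u. p (v + u) * s u v) has_vector_derivative p (v + u) * ((p u)\<^sup>2 + J u v) + d (v + u) * s u v) (at u within {0..\<xi>})"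
        using u mem by (simp add: T_def)
    qed
    moreover have "((\<lambda>u. G1 u v) has_integral I \<xi> v) {0..\<xi>}"
      unfolding I_def by (intro integrable_integral integrable_continuous_real col[OF cG1 mem])
    ultimately have "((\<lambda>u. (p (v + u) * ((p u)\<^sup>2 + J u v) + d (v + u) * s u v) - G1 u v) has_integral ((p (v + \<xi>) * s \<xi> v - p (v + 0) * s 0 v) - I \<xi> v)) {0..\<xi>}"
      by (rule has_integral_diff)
    moreover have "(p (v + u) * ((p u)\<^sup>2 + J u v) + d (v + u) * s u v) - G1 u v = p (u + v) * \<sigma> u v" for u
      by (simp add: G1_def \<sigma>_def algebra_simps power2_eq_square)
    moreover have "s 0 v = 0" using s_eq[of 0 v] mem by (simp add: T_def)
    ultimately show ?thesis by (simp add: \<rho>_def algebra_simps)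
  qed
  obtain Mp where Mp: "Mp \<ge> 0" "\<And>x. x \<in> {0..b} \<Longrightarrow> cmod (p x) \<le> Mp"
    using continuous_on_compact_bound[OF compact_Icc p] by blast
  define l where "l = 2 * Mp + 1"
  have l0: "l > 0" using Mp by (simp add: l_def)
  have cpt: "compact T" unfolding T_def by (rule compact_triangle)
  define W where "W = (\<lambda>(\<xi>, \<eta>). max (cmod (\<rho> \<xi> \<eta>)) (cmod (\<sigma> \<xi> \<eta>)) * exp (- (l * (\<xi> + \<eta>))))"
  \<comment> \<open>A bound for \<open>W\<close> follows from bounds for the integrands on the
    compact triangle, which avoids proving joint continuity of the parameter integrals
    \<open>I\<close> and \<open>J\<close>.\<close>
  have "\<exists>B0. \<forall>z\<in>T. W z \<le> B0"
  proof -
    obtain B1 where B1: "B1 \<ge> 0" "\<And>z. z \<in> T \<Longrightarrow> cmod (G1 (fst z) (snd z)) \<le> B1"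
      using continuous_on_compact_bound[OF cpt cG1] by blast
    obtain B2 where B2: "B2 \<ge> 0" "\<And>z. z \<in> T \<Longrightarrow> cmod (G2 (fst z) (snd z)) \<le> B2"
      using continuous_on_compact_bound[OF cpt cG2] by blast
    obtain B3 where B3: "B3 \<ge> 0" "\<And>z. z \<in> T \<Longrightarrow> cmod (m (fst z) (snd z)) \<le> B3"
      using continuous_on_compact_bound[OF cpt cm] by blast
    obtain B4 where B4: "B4 \<ge> 0" "\<And>z. z \<in> T \<Longrightarrow> cmod (s (fst z) (snd z)) \<le> B4"
      using continuous_on_compact_bound[OF cpt cs] by blast
    have "W z \<le> max (B1 * b + Mp * B4) (Mp\<^sup>2 + B2 * b + Mp * B3)" if "z \<in> T" for z
    proof -
      obtain \<xi> \<eta> where z: "z = (\<xi>, \<eta>)" by force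
      have mem: "(\<xi>, \<eta>) \<in> T" using that z by simp
      have "cmod (I \<xi> \<eta>) \<le> B1 * (\<xi> - 0)" unfolding I_def
        using T1[OF mem] sub[OF mem] by (intro integral_bound col[OF cG1 mem]) (auto intro!: B1(2)[of "(_, \<eta>)", simplified])
      also have "\<dots> \<le> B1 * b" using T1[OF mem] B1 by (intro mult_left_mono) auto
      finally have i: "cmod (I \<xi> \<eta>) \<le> B1 * b" .
      have "cmod (J \<xi> \<eta>) \<le> B2 * (\<eta> - 0)" unfolding J_def
        using T1[OF mem] sub[OF mem] by (intro integral_bound row[OF cG2 mem]) (auto intro!: B2(2)[of "(\<xi>, _)", simplified])
      also have "\<dots> \<le> B2 * b" using T1[OF mem] B2 by (intro mult_left_mono) auto
      finally have j: "cmod (J \<xi> \<eta>) \<le> B2 * b" .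
      have ps: "cmod (p (\<xi> + \<eta>) * s \<xi> \<eta>) \<le> Mp * B4" "cmod (p (\<xi> + \<eta>) * m \<xi> \<eta>) \<le> Mp * B3"
        unfolding norm_mult using B3(2)[OF mem] B4(2)[OF mem] Mp T1[OF mem] by (auto intro!: mult_mono)
      have pp: "cmod ((p \<xi>)\<^sup>2) \<le> Mp\<^sup>2" unfolding norm_power using Mp T1[OF mem] by (intro power_mono) auto
      have "cmod (\<rho> \<xi> \<eta>) \<le> B1 * b + Mp * B4" unfolding \<rho>_def
        using norm_triangle_ineq4[of "I \<xi> \<eta>" "p (\<xi> + \<eta>) * s \<xi> \<eta>"] i ps(1) by linarith
      moreover have "cmod (\<sigma> \<xi> \<eta>) \<le> Mp\<^sup>2 + B2 * b + Mp * B3" unfolding \<sigma>_def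
        using norm_triangle_ineq4[of "(p \<xi>)\<^sup>2 + J \<xi> \<eta>" "p (\<xi> + \<eta>) * m \<xi> \<eta>"] norm_triangle_ineq[of "(p \<xi>)\<^sup>2" "J \<xi> \<eta>"] j ps(2) pp by linarith
      ultimately have "max (cmod (\<rho> \<xi> \<eta>)) (cmod (\<sigma> \<xi> \<eta>)) \<le> max (B1 * b + Mp * B4) (Mp\<^sup>2 + B2 * b + Mp * B3)" by linarith
      moreover have "W z \<le> max (cmod (\<rho> \<xi> \<eta>)) (cmod (\<sigma> \<xi> \<eta>)) * 1"
        unfolding W_def z split using l0 T1[OF mem] by (intro mult_left_mono) (auto simp: le_max_iff_disj)
      ultimately show ?thesis by linarith
    qed
    then show ?thesis by blast
  qed
  then obtain B0 where B0: "\<And>z. z \<in> T \<Longrightarrow> W z \<le> B0" by blast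
  have W0: "W z \<le> 2 * 0" if "z \<in> T" for z
  proof (rule sup_halving[OF B0 _ _ that])
    fix B z assume B: "0 \<le> (B::real)" and WB: "\<And>z. z \<in> T \<Longrightarrow> W z \<le> B" and zT: "z \<in> T"
    obtain x y where z: "z = (x, y)" by force
    have mem: "(x, y) \<in> T" using zT z by simp
    have Wb: "cmod (\<rho> u v) \<le> B * exp (l * (u + v))" "cmod (\<sigma> u v) \<le> B * exp (l * (u + v))"
      if "(u, v) \<in> T" for u v
      using WB[OF that] by (auto simp: W_def mult_exp_minus_le_iff)
    have "cmod (integral {0..y} (\<lambda>v. p (x + v) * \<rho> x v)) * exp (- (l * (x + y))) \<le> Mp * integral {0..y} (\<lambda>v. 0) + B / 2"
    proof (rule weighted_Volterra_step[OF l_def Mp(1) B T1(4,5)[OF mem] has_integral_integrable[OF sig[OF mem]]])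
      fix v assume v: "v \<in> {0..y}"
      have "(x, v) \<in> T" using v mem by (auto simp: T_def)
      from Wb(1)[OF this] T1(3)[OF this]
      show "cmod (p (x + v) * \<rho> x v) \<le> Mp * (0 + B * exp (l * (x + v)))"
        unfolding norm_mult using Mp by (intro mult_mono) auto
    qed auto
    then have 1: "cmod (\<sigma> x y) * exp (- (l * (x + y))) \<le> 0 + B / 2"
      by (simp add: integral_unique[OF sig[OF mem]])
    have "cmod (integral {0..x} (\<lambda>u. p (u + y) * \<sigma> u y)) * exp (- (l * (y + x))) \<le> Mp * integral {0..x} (\<lambda>v. 0) + B / 2"
    proof (rule weighted_Volterra_step[OF l_def Mp(1) B T1(5,4)[OF mem] has_integral_integrable[OF rho[OF mem]]])
      fix u assume u: "u \<in> {0..x}"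
      have "(u, y) \<in> T" using u mem by (auto simp: T_def)
      from Wb(2)[OF this] T1(3)[OF this]
      show "cmod (p (u + y) * \<sigma> u y) \<le> Mp * (0 + B * exp (l * (y + u)))"
        unfolding norm_mult using Mp by (intro mult_mono) (auto simp: add.commute)
    qed auto
    then have 2: "cmod (\<rho> x y) * exp (- (l * (x + y))) \<le> 0 + B / 2"
      by (simp add: integral_unique[OF rho[OF mem]] add.commute)
    show "W z \<le> 0 + B / 2" using 1 2 by (simp add: W_def z max_def)
  qed auto
  have zero: "\<rho> u v = 0" "\<sigma> u v = 0" if "(u, v) \<in> T" for u v
    using W0[OF that] by (auto simp: W_def mult_le_0_iff max_def split: if_splits)
  show "m \<xi> \<eta> = p \<xi> + integral {0..\<eta>} (\<lambda>v. p (\<xi> + v) * s \<xi> v)" if mem: "(\<xi>, \<eta>) \<in> T"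
    unfolding m_eq[OF mem] using zero(1) sub[OF mem] T1[OF mem]
    by (intro arg_cong2[of _ _ _ _ "(+)"] refl integral_cong) (auto simp: \<rho>_def)
  show "s \<xi> \<eta> = integral {0..\<xi>} (\<lambda>u. p (u + \<eta>) * m u \<eta>)" if mem: "(\<xi>, \<eta>) \<in> T"
    unfolding s_eq[OF mem] using zero(2) sub[OF mem] T1[OF mem]
    by (intro integral_cong) (auto simp: \<sigma>_def)
qed

section \<open>Generalized wave polynomials\<close>

text \<open>The part of the \<open>n\<close>-th wave polynomial of \<open>F\<close> even in \<open>t\<close> plus the part of that of \<open>G\<close> odd in \<open>t\<close>.\<close>

definition mixed_wave :: "(nat \<Rightarrow> real \<Rightarrow> complex) \<Rightarrow> (nat \<Rightarrow> real \<Rightarrow> complex) \<Rightarrow> nat \<Rightarrow> real \<Rightarrow> real \<Rightarrow> complex" where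
  "mixed_wave F G n x t = (\<Sum>k\<le>n. of_nat (n choose k) * (if even k then F else G) (n - k) x * of_real t ^ k)"

text \<open>The linear extension from monomials to polynomials: the solution of the system whose
  initial value on \<open>x = 0\<close> is \<open>Q\<close>, see
  \<open>mixed_poly_0\<close>.\<close>

definition mixed_poly :: "(nat \<Rightarrow> real \<Rightarrow> complex) \<Rightarrow> (nat \<Rightarrow> real \<Rightarrow> complex) \<Rightarrow> complex poly \<Rightarrow> real \<Rightarrow> real \<Rightarrow> complex" where
  "mixed_poly F G Q x t = (\<Sum>n\<le>degree Q. coeff Q n * mixed_wave F G n x t)"

lemma mixed_poly_altdef:
  assumes "degree Q \<le> N"
  shows "mixed_poly F G Q x t = (\<Sum>n\<le>N. coeff Q n * mixed_wave F G n x t)"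
  unfolding mixed_poly_def using assms
  by (intro sum.mono_neutral_left) (auto simp: coeff_eq_0)

lemma mixed_poly_diff: "mixed_poly F G (P - Q) x t = mixed_poly F G P x t - mixed_poly F G Q x t"
proof -
  define N where "N = max (degree P) (degree Q)"
  have "degree P \<le> N" "degree Q \<le> N" "degree (P - Q) \<le> N" by (auto simp: N_def degree_diff_le_max)
  then show ?thesis by (simp add: mixed_poly_altdef[of _ N] left_diff_distrib sum_subtractf)
qed

text \<open>An abstraction of \<open>phi\<close> and \<open>psi\<close> with
  \<open>p = f' / f\<close>. Exchanging \<open>F\<close> and \<open>G\<close> while negating
  \<open>p\<close> preserves it (\<open>swap\<close>), so every result is available for both least
  squares problems. At \<open>n = 0\<close> the truncated index \<open>n - 1\<close> is harmless, as
  its factor vanishes.\<close>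

locale formal_powers =
  fixes b :: real and p :: "real \<Rightarrow> complex" and F G :: "nat \<Rightarrow> real \<Rightarrow> complex"
  assumes b: "b > 0" and p: "continuous_on {0..b} p"
    and F': "x \<in> {0..b} \<Longrightarrow> (F n has_vector_derivative (p x * F n x + of_nat n * G (n - 1) x)) (at x within {0..b})"
    and G': "x \<in> {0..b} \<Longrightarrow> (G n has_vector_derivative (- p x * G n x + of_nat n * F (n - 1) x)) (at x within {0..b})"
    and F0: "F n 0 = (if n = 0 then 1 else 0)" and G0: "G n 0 = (if n = 0 then 1 else 0)"
begin

lemma swap: "formal_powers b (\<lambda>x. - p x) G F"
  using b p F' G' F0 G0 by unfold_locales (auto intro!: continuous_intros)

lemma mixed_wave_0: "mixed_wave F G n 0 t = of_real t ^ n"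
proof -
  have "mixed_wave F G n 0 t = (\<Sum>k\<le>n. if k = n then of_real t ^ n else 0)"
    unfolding mixed_wave_def by (intro sum.cong refl) (auto simp: F0 G0)
  then show ?thesis by simp
qed

lemma mixed_poly_0: "mixed_poly F G Q 0 t = poly Q (of_real t)"
  by (simp add: mixed_poly_def mixed_wave_0 poly_altdef)

text \<open>The sign of \<open>p\<close> alternates with the parity of \<open>k\<close>, and
  \<open>(-1)^k * t^k = (-t)^k\<close> turns this into a reflection of \<open>t\<close>.
  Differentiating the powers of \<open>t\<close> and lowering the index of the formal powers both
  give \<open>n * mixed_wave G F (n - 1)\<close> by binomial absorption, whence the factor
  \<open>1 + \<beta>\<close>: it vanishes on \<open>t = c - x\<close> and equals 2 on
  \<open>t = c + x\<close>.\<close>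

lemma mixed_wave_derivative:
  assumes x: "x \<in> {0..b}"
  shows "((\<lambda>x. mixed_wave F G n x (\<alpha> + \<beta> * x)) has_vector_derivative
    (p x * mixed_wave F G n x (- (\<alpha> + \<beta> * x)) + of_nat n * (1 + of_real \<beta>) * mixed_wave G F (n - 1) x (\<alpha> + \<beta> * x)))
    (at x within {0..b})"
proof -
  define H where "H = (\<lambda>k::nat. if even k then F else G)"
  define t where "t = \<alpha> + \<beta> * x"
  have chi': "(H k j has_vector_derivative ((-1) ^ k * p x * H k j x + of_nat j * H (Suc k) (j - 1) x)) (at x within {0..b})" for k j
    using F'[OF x, of j] G'[OF x, of j] by (auto simp: H_def)
  have dt: "((\<lambda>x. complex_of_real (\<alpha> + \<beta> * x) ^ k) has_vector_derivative of_nat k * of_real t ^ (k - 1) * of_real \<beta>) (at x within {0..b})" for k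
  proof -
    have "((\<lambda>x. (\<alpha> + \<beta> * x) ^ k) has_real_derivative real k * t ^ (k - 1) * \<beta>) (at x within {0..b})"
      unfolding t_def by (auto intro!: derivative_eq_intros)
    from has_vector_derivative_of_real[OF this]
    show ?thesis by simp
  qed
  have mwG: "mixed_wave G F j x t = (\<Sum>k\<le>j. of_nat (j choose k) * H (Suc k) (j - k) x * of_real t ^ k)" for j
    unfolding mixed_wave_def H_def by (intro sum.cong refl) auto
  have 1: "((\<lambda>x. mixed_wave F G n x (\<alpha> + \<beta> * x)) has_vector_derivative
     (\<Sum>k\<le>n. of_nat (n choose k) * H k (n - k) x * (of_nat k * of_real t ^ (k - 1) * of_real \<beta>)
        + of_nat (n choose k) * ((-1) ^ k * p x * H k (n - k) x + of_nat (n - k) * H (Suc k) (n - k - 1) x) * of_real t ^ k)) (at x within {0..b})"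
  proof -
    have "mixed_wave F G n x t = (\<Sum>k\<le>n. of_nat (n choose k) * H k (n - k) x * of_real t ^ k)" for x t
      by (simp add: mixed_wave_def H_def)
    then show ?thesis
      by (simp only:) (unfold t_def, intro has_vector_derivative_sum has_vector_derivative_mult
        has_vector_derivative_mult_right chi' dt[unfolded t_def])
  qed
  have "(\<Sum>k\<le>n. of_nat (n choose k) * H k (n - k) x * (of_nat k * of_real t ^ (k - 1) * of_real \<beta>)
        + of_nat (n choose k) * ((-1) ^ k * p x * H k (n - k) x + of_nat (n - k) * H (Suc k) (n - k - 1) x) * of_real t ^ k)
      = (\<Sum>k\<le>n. p x * (of_nat (n choose k) * H k (n - k) x * of_real (- t) ^ k))
       + (of_real \<beta> * (\<Sum>k\<le>n. of_nat (k * (n choose k)) * H k (n - k) x * of_real t ^ (k - 1))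
       + (\<Sum>k\<le>n. of_nat ((n - k) * (n choose k)) * H (Suc k) (n - k - 1) x * of_real t ^ k))"
    unfolding sum_distrib_left sum.distrib[symmetric]
    by (intro sum.cong refl) (simp add: algebra_simps power_minus[of "complex_of_real t"])
  also have "(\<Sum>k\<le>n. p x * (of_nat (n choose k) * H k (n - k) x * of_real (- t) ^ k)) = p x * mixed_wave F G n x (- t)"
    by (simp add: mixed_wave_def H_def sum_distrib_left)
  also have "(\<Sum>k\<le>n. of_nat (k * (n choose k)) * H k (n - k) x * of_real t ^ (k - 1)) = of_nat n * mixed_wave G F (n - 1) x t"
  proof (cases n)
    case (Suc m)
    have "(\<Sum>k\<le>n. of_nat (k * (n choose k)) * H k (n - k) x * of_real t ^ (k - 1))
        = (\<Sum>k\<le>m. of_nat (Suc k * (Suc m choose Suc k)) * H (Suc k) (m - k) x * of_real t ^ k)"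
      unfolding Suc sum.atMost_Suc_shift by simp
    also have "\<dots> = (\<Sum>k\<le>m. of_nat n * (of_nat (m choose k) * H (Suc k) (m - k) x * of_real t ^ k))"
      unfolding Suc_times_binomial Suc of_nat_mult by (simp only: mult.assoc)
    finally show ?thesis unfolding mwG sum_distrib_left by (simp only: Suc diff_Suc_1)
  qed simp
  also have "(\<Sum>k\<le>n. of_nat ((n - k) * (n choose k)) * H (Suc k) (n - k - 1) x * of_real t ^ k) = of_nat n * mixed_wave G F (n - 1) x t"
  proof (cases n)
    case (Suc m)
    have "(\<Sum>k\<le>n. of_nat ((n - k) * (n choose k)) * H (Suc k) (n - k - 1) x * of_real t ^ k)
        = (\<Sum>k\<le>m. of_nat ((Suc m - k) * (Suc m choose k)) * H (Suc k) (m - k) x * of_real t ^ k)"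
      unfolding Suc by simp
    also have "\<dots> = (\<Sum>k\<le>m. of_nat n * (of_nat (m choose k) * H (Suc k) (m - k) x * of_real t ^ k))"
    proof (intro sum.cong refl)
      fix k assume "k \<in> {..m}"
      then have "(Suc m - k) * (Suc m choose k) = n * (m choose k)"
        using binomial_absorb_comp[of "Suc m" k] Suc by simp
      then show "of_nat ((Suc m - k) * (Suc m choose k)) * H (Suc k) (m - k) x * of_real t ^ k = of_nat n * (of_nat (m choose k) * H (Suc k) (m - k) x * of_real t ^ k)"
        by (simp only: of_nat_mult mult.assoc)
    qed
    finally show ?thesis unfolding mwG sum_distrib_left by (simp only: Suc diff_Suc_1)
  qed simp
  finally show ?thesis using 1 by (simp add: t_def algebra_simps)
qed

lemma mixed_poly_derivative:
  assumes x: "x \<in> {0..b}"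
  shows "((\<lambda>x. mixed_poly F G Q x (\<alpha> + \<beta> * x)) has_vector_derivative
    (p x * mixed_poly F G Q x (- (\<alpha> + \<beta> * x)) + (1 + of_real \<beta>) * mixed_poly G F (pderiv Q) x (\<alpha> + \<beta> * x)))
    (at x within {0..b})"
proof -
  have 1: "((\<lambda>x. mixed_poly F G Q x (\<alpha> + \<beta> * x)) has_vector_derivative
    (\<Sum>n\<le>degree Q. coeff Q n * (p x * mixed_wave F G n x (- (\<alpha> + \<beta> * x)) + of_nat n * (1 + of_real \<beta>) * mixed_wave G F (n - 1) x (\<alpha> + \<beta> * x)))) (at x within {0..b})"
    unfolding mixed_poly_def
    by (intro has_vector_derivative_sum has_vector_derivative_mult_right mixed_wave_derivative x)
  have "(\<Sum>n\<le>degree Q. coeff Q n * (of_nat n * mixed_wave G F (n - 1) x t)) = mixed_poly G F (pderiv Q) x t" for t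
  proof (cases "degree Q")
    case (Suc m)
    have "(\<Sum>n\<le>degree Q. coeff Q n * (of_nat n * mixed_wave G F (n - 1) x t)) = (\<Sum>n\<le>m. coeff (pderiv Q) n * mixed_wave G F n x t)"
      unfolding Suc sum.atMost_Suc_shift by (simp add: coeff_pderiv mult_ac)
    also have "\<dots> = mixed_poly G F (pderiv Q) x t"
      using mixed_poly_altdef[of "pderiv Q" m] by (simp add: degree_pderiv Suc)
    finally show ?thesis .
  next
    case 0
    then have "pderiv Q = 0" by (simp add: pderiv_eq_0_iff)
    with 0 show ?thesis by (simp add: mixed_poly_def)
  qed
  then have *: "\<gamma> * mixed_poly G F (pderiv Q) x (\<alpha> + \<beta> * x)
     = (\<Sum>n\<le>degree Q. \<gamma> * (coeff Q n * (of_nat n * mixed_wave G F (n - 1) x (\<alpha> + \<beta> * x))))"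
    for \<gamma> by (simp only: sum_distrib_left[symmetric])
  have "(\<Sum>n\<le>degree Q. coeff Q n * (p x * mixed_wave F G n x (- (\<alpha> + \<beta> * x)) + of_nat n * \<gamma> * mixed_wave G F (n - 1) x (\<alpha> + \<beta> * x)))
     = p x * mixed_poly F G Q x (- (\<alpha> + \<beta> * x)) + \<gamma> * mixed_poly G F (pderiv Q) x (\<alpha> + \<beta> * x)" for \<gamma>
    unfolding mixed_poly_def[of F G] * by (simp only: sum_distrib_left sum.distrib distrib_left mult_ac)
  with 1 show ?thesis by simp
qed

lemma F_continuous: "continuous_on {0..b} (F n)" and G_continuous: "continuous_on {0..b} (G n)"
  by (rule continuous_on_vector_derivative, erule F')
     (rule continuous_on_vector_derivative, erule G')

lemma mixed_poly_continuous: "continuous_on ({0..b} \<times> UNIV) (\<lambda>z. mixed_poly F G Q (fst z) (snd z))"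
proof -
  have "continuous_on ({0..b} \<times> UNIV) (\<lambda>z::real \<times> real. (if even k then F else G) j (fst z))" for k j
    by (cases "even k") (auto intro!: continuous_on_compose2[OF F_continuous] continuous_on_compose2[OF G_continuous] continuous_intros)
  then show ?thesis unfolding mixed_poly_def mixed_wave_def
    by (intro continuous_intros)
qed

text \<open>For slope -1 the term with \<open>pderiv Q\<close> disappears. With
  \<open>M x c = mixed_poly F G Q x (c - x)\<close> what remains is the equation of the trace
  problem with initial value \<open>Q\<close>.\<close>

lemma mixed_poly_integral_eq:
  assumes x: "x \<in> {0..b}"
  shows "mixed_poly F G Q x (c - x) = poly Q (of_real c) + integral {0..x} (\<lambda>y. p y * mixed_poly F G Q y (y - c))"
proof -
  have "((\<lambda>y. p y * mixed_poly F G Q y (y - c)) has_integral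
    (mixed_poly F G Q x (c + (-1) * x) - mixed_poly F G Q 0 (c + (-1) * 0))) {0..x}"
  proof (rule fundamental_theorem_of_calculus)
    fix y assume "y \<in> {0..x}"
    then have "((\<lambda>x. mixed_poly F G Q x (c + (-1) * x)) has_vector_derivative
        (p y * mixed_poly F G Q y (- (c + (-1) * y)) + (1 + of_real (-1)) * mixed_poly G F (pderiv Q) y (c + (-1) * y))) (at y within {0..x})"
      using x by (intro has_vector_derivative_within_subset[OF mixed_poly_derivative]) auto
    then show "((\<lambda>x. mixed_poly F G Q x (c + (-1) * x)) has_vector_derivative p y * mixed_poly F G Q y (y - c)) (at y within {0..x})"
      by simp
  qed (use x in auto)
  then show ?thesis by (simp add: integral_unique mixed_poly_0)
qed

end

section \<open>Traces of generalized wave polynomials approximate smooth functions\<close>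

lemma Cr_on_imp_continuous_on: "Cr_on k S g \<Longrightarrow> continuous_on S g"
  by (cases k) (auto intro: continuous_on_vector_derivative)

lemma Cr_on_SucD: "Cr_on (Suc k) S g \<Longrightarrow> Cr_on k S g"
proof (induction k arbitrary: g)
  case 0
  then show ?case by (auto intro: continuous_on_vector_derivative)
next
  case (Suc k)
  then obtain g' where "\<forall>x\<in>S. (g has_vector_derivative g' x) (at x within S)" "Cr_on (Suc k) S g'"
    by (auto simp del: Cr_on.simps(2) simp: Cr_on.simps(2)[of "Suc k"])
  with Suc.IH[of g'] show ?case by auto
qed

lemma Cr_on_le: "Cr_on k S g \<Longrightarrow> j \<le> k \<Longrightarrow> Cr_on j S g"
  by (induction k) (metis le_zero_eq, metis Cr_on_SucD le_Suc_eq)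

lemma Cr_on_const: "Cr_on k S (\<lambda>x. c)"
  by (induction k arbitrary: c) (auto intro!: exI[of _ "\<lambda>x. 0"])

lemma Cr_on_add: "Cr_on k S g \<Longrightarrow> Cr_on k S h \<Longrightarrow> Cr_on k S (\<lambda>x. g x + h x)"
proof (induction k arbitrary: g h)
  case 0
  then show ?case by (auto intro: continuous_intros)
next
  case (Suc k)
  then obtain g' h' where *: "\<forall>x\<in>S. (g has_vector_derivative g' x) (at x within S)" "Cr_on k S g'"
    "\<forall>x\<in>S. (h has_vector_derivative h' x) (at x within S)" "Cr_on k S h'" by auto
  then show ?case using Suc.IH[of g' h'] by (auto intro!: exI[of _ "\<lambda>x. g' x + h' x"] has_vector_derivative_add)
qed

lemma Cr_on_mult: "Cr_on k S g \<Longrightarrow> Cr_on k S h \<Longrightarrow> Cr_on k S (\<lambda>x. g x * h x)"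
proof (induction k arbitrary: g h)
  case 0
  then show ?case by (auto intro: continuous_intros)
next
  case (Suc k)
  then obtain g' h' where *: "\<forall>x\<in>S. (g has_vector_derivative g' x) (at x within S)" "Cr_on k S g'"
    "\<forall>x\<in>S. (h has_vector_derivative h' x) (at x within S)" "Cr_on k S h'" by auto
  have "Cr_on k S (\<lambda>x. g x * h' x + g' x * h x)"
    using Suc.prems[THEN Cr_on_SucD] * by (intro Cr_on_add Suc.IH)
  then show ?case using *
    by (auto intro!: exI[of _ "\<lambda>x. g x * h' x + g' x * h x"] has_vector_derivative_mult)
qed

lemma Cr_on_diff: "Cr_on k S g \<Longrightarrow> Cr_on k S h \<Longrightarrow> Cr_on k S (\<lambda>x. g x - h x)"
  using Cr_on_add[of k S g "\<lambda>x. (-1) * h x"] Cr_on_mult[OF Cr_on_const[of k S "-1"], of h] by simp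

lemma Cr_on_integral:
  assumes "Cr_on k {0..b} g"
  shows "Cr_on k {0..b} (\<lambda>x. integral {0..x} g)"
  by (rule Cr_on_SucD)
     (use assms in \<open>auto intro!: exI[of _ g] integral_has_vector_derivative Cr_on_imp_continuous_on\<close>)

lemma Weierstrass_complex_poly:
  fixes f :: "real \<Rightarrow> complex"
  assumes f: "continuous_on {a..c} f" and e: "e > 0"
  obtains Q :: "complex poly" where "\<And>x. x \<in> {a..c} \<Longrightarrow> cmod (f x - poly Q (of_real x)) < e"
proof -
  have *: "\<exists>Q :: complex poly. \<forall>x\<in>{a..c}. cmod (of_real (h x) - poly Q (of_real x)) < e / 2"
    if h: "continuous_on {a..c} h" for h :: "real \<Rightarrow> real"
  proof -
    obtain g where g: "real_polynomial_function g" "\<And>x. x \<in> {a..c} \<Longrightarrow> \<bar>h x - g x\<bar> < e / 2"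
      using Stone_Weierstrass_real_polynomial_function[OF compact_Icc h, of "e / 2"] e by auto
    then obtain A n where A: "g = (\<lambda>x. \<Sum>i\<le>n. A i * x ^ i)"
      unfolding real_polynomial_function_iff_sum by blast
    have "poly (\<Sum>i\<le>n. monom (complex_of_real (A i)) i) (of_real x) = of_real (g x)" for x
      by (simp add: A poly_sum poly_monom)
    moreover have "cmod (of_real (h x) - of_real (g x)) < e / 2" if "x \<in> {a..c}" for x
      using g(2)[OF that] by (metis norm_of_real of_real_diff)
    ultimately show ?thesis by metis
  qed
  obtain Q1 where Q1: "\<And>x. x \<in> {a..c} \<Longrightarrow> cmod (of_real (Re (f x)) - poly Q1 (of_real x)) < e / 2"
    using *[OF continuous_on_Re[OF f]] by blast
  obtain Q2 where Q2: "\<And>x. x \<in> {a..c} \<Longrightarrow> cmod (of_real (Im (f x)) - poly Q2 (of_real x)) < e / 2"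
    using *[OF continuous_on_Im[OF f]] by blast
  have "cmod (f x - poly (Q1 + smult \<i> Q2) (of_real x)) < e" if x: "x \<in> {a..c}" for x
  proof -
    have "f x - poly (Q1 + smult \<i> Q2) (of_real x)
        = (of_real (Re (f x)) - poly Q1 (of_real x)) + \<i> * (of_real (Im (f x)) - poly Q2 (of_real x))"
      by (subst complex_eq[of "f x"]) (simp add: algebra_simps)
    also have "cmod \<dots> \<le> cmod (of_real (Re (f x)) - poly Q1 (of_real x)) + cmod (\<i> * (of_real (Im (f x)) - poly Q2 (of_real x)))"
      by (rule norm_triangle_ineq)
    also have "\<dots> < e / 2 + e / 2" using Q1[OF x] Q2[OF x] by (simp add: norm_mult)
    finally show ?thesis by simp
  qed
  then show ?thesis using that by blast
qed

section \<open>Density of the range and continuity of the trace operator\<close>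

context formal_powers
begin

lemma mixed_poly_continuous_shift: "continuous_on ({0..b} \<times> UNIV) (\<lambda>(x, c). mixed_poly F G Q x (c - x))"
proof -
  have "continuous_on ({0..b} \<times> UNIV) (\<lambda>z. (\<lambda>z. mixed_poly F G Q (fst z) (snd z)) (fst z, snd z - fst z))"
    by (rule continuous_on_compose2[OF mixed_poly_continuous]) (auto intro!: continuous_intros)
  then show ?thesis by (simp add: split_def)
qed

lemma mixed_poly_continuous_line: "continuous_on {0..b} (\<lambda>x. mixed_poly F G Q x (\<alpha> + \<beta> * x))"
  using mixed_poly_derivative by (rule continuous_on_vector_derivative)

lemma mixed_poly_shift_eq:
  assumes "x \<in> {0..b}"
  shows "mixed_poly F G Q x (c - x) = poly Q (of_real c) + integral {0..x} (\<lambda>y. p y * mixed_poly F G Q y ((2 * y - c) - y))"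
  using mixed_poly_integral_eq[OF assms, of Q c] by simp

text \<open>The trace problem with data \<open>g\<close> supplies a continuous initial value
  \<open>M 0\<close>; a polynomial close to it has a trace close to \<open>g\<close>, by
  \<open>trace_problem_estimate\<close> applied to the difference. The bound \<open>B\<close>
  precedes \<open>\<epsilon>\<close> because all approximants stay near the same
  \<open>M 0\<close>.\<close>

lemma trace_approx_continuous:
  assumes g: "continuous_on {0..b} g"
  shows "\<exists>B. \<forall>\<epsilon>>0. \<exists>Q. (\<forall>x\<in>{0..b}. cmod (mixed_poly F G Q x x - g x) \<le> \<epsilon>) \<and>
    (\<forall>z\<in>{-2*b..2*b}. cmod (poly Q (of_real z)) \<le> B)"
proof -
  obtain M where M: "continuous_on UNIV (\<lambda>(x, c). M x c)" and Mg: "\<And>x. x \<in> {0..b} \<Longrightarrow> M x (2 * x) = g x"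
    and Meq: "\<And>x c. x \<in> {0..b} \<Longrightarrow> c \<le> 2 * b \<Longrightarrow> M x c = M 0 c + integral {0..x} (\<lambda>y. p y * M y (2 * y - c))"
    using trace_problem_solvable[OF b p g] by blast
  have Mc: "continuous_on A (\<lambda>y. M (h1 y) (h2 y))" if "continuous_on A h1" "continuous_on A h2" for A :: "real set" and h1 h2
    using continuous_on_compose2[OF M, of A "\<lambda>y. (h1 y, h2 y)"] that by (auto intro!: continuous_on_Pair)
  have P: "continuous_on {-2*b..2*b} (M 0)" by (intro Mc continuous_intros)
  obtain B where B: "\<And>z. z \<in> {-2*b..2*b} \<Longrightarrow> cmod (M 0 z) \<le> B"
    using continuous_on_compact_bound[OF compact_Icc P] by blast
  obtain C where C: "C \<ge> 0"
    "\<And>M e x. continuous_on ({0..b} \<times> UNIV) (\<lambda>(x, c). M x c) \<Longrightarrow> continuous_on {-2*b..2*b} e \<Longrightarrow>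
      (\<And>x c. x \<in> {0..b} \<Longrightarrow> c \<le> 2 * b \<Longrightarrow> M x c = e c + integral {0..x} (\<lambda>y. p y * M y (2 * y - c))) \<Longrightarrow>
      x \<in> {0..b} \<Longrightarrow> cmod (M x (2 * x)) \<le> cmod (e (2 * x)) + C * integral {-2*b..2*b} (\<lambda>z. cmod (e z))"
    using trace_problem_estimate[OF b p] by blast
  have "\<exists>Q. (\<forall>x\<in>{0..b}. cmod (mixed_poly F G Q x x - g x) \<le> \<epsilon>) \<and>
    (\<forall>z\<in>{-2*b..2*b}. cmod (poly Q (of_real z)) \<le> B + 1)" if eps: "\<epsilon> > 0" for \<epsilon>
  proof -
    \<comment> \<open>The error is at most \<open>\<delta> + C * (4 * b * \<delta>)\<close>, where
      \<open>4 * b\<close> is the length of \<open>[-2b, 2b]\<close>;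
      \<open>\<delta> \<le> 1\<close> gives the bound \<open>B + 1\<close> for the
      polynomial.\<close>
    define \<delta> where "\<delta> = min 1 (\<epsilon> / (1 + 4 * b * C))"
    have pos: "1 + 4 * b * C > 0" using b C by (simp add: add_pos_nonneg)
    have d: "\<delta> > 0" "\<delta> \<le> 1" using pos eps by (auto simp: \<delta>_def)
    have "\<delta> \<le> \<epsilon> / (1 + 4 * b * C)" by (simp add: \<delta>_def)
    then have d3: "\<delta> * (1 + 4 * b * C) \<le> \<epsilon>" using pos by (simp only: pos_le_divide_eq)
    obtain Q where Q: "\<And>z. z \<in> {-2*b..2*b} \<Longrightarrow> cmod (M 0 z - poly Q (of_real z)) < \<delta>"
      using Weierstrass_complex_poly[OF P d(1)] by blast
    have "cmod (mixed_poly F G Q x x - g x) \<le> \<epsilon>" if x: "x \<in> {0..b}" for x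
    proof -
      define e where "e = (\<lambda>z. M 0 z - poly Q (of_real z))"
      define E where "E = (\<lambda>x c. M x c - mixed_poly F G Q x (c - x))"
      have ce: "continuous_on {-2*b..2*b} e" unfolding e_def by (intro continuous_intros P)
      have "cmod (E x (2 * x)) \<le> cmod (e (2 * x)) + C * integral {-2*b..2*b} (\<lambda>z. cmod (e z))"
      proof (rule C(2)[OF _ ce _ x])
        show "continuous_on ({0..b} \<times> UNIV) (\<lambda>(x, c). E x c)"
          using continuous_on_diff[OF continuous_on_subset[OF M subset_UNIV] mixed_poly_continuous_shift]
          by (simp add: E_def split_def)
        fix x c assume x: "x \<in> {0..b}" and c: "c \<le> 2 * b"
        have i1: "(\<lambda>y. p y * M y (2 * y - c)) integrable_on {0..x}"
          using x by (intro integrable_continuous_real continuous_intros Mc continuous_on_subset[OF p]) auto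
        have "continuous_on {0..x} (\<lambda>y. mixed_poly F G Q y (- c + 1 * y))"
          using x by (intro continuous_on_subset[OF mixed_poly_continuous_line]) auto
        then have i2: "(\<lambda>y. p y * mixed_poly F G Q y ((2 * y - c) - y)) integrable_on {0..x}"
          using x by (intro integrable_continuous_real continuous_intros continuous_on_subset[OF p]) auto
        show "E x c = e c + integral {0..x} (\<lambda>y. p y * E y (2 * y - c))"
          unfolding E_def e_def right_diff_distrib Henstock_Kurzweil_Integration.integral_diff[OF i1 i2]
          by (subst Meq[OF x c], subst mixed_poly_shift_eq[OF x]) simp
      qed
      also have "cmod (e (2 * x)) \<le> \<delta>" using Q[of "2 * x"] x b by (auto simp: e_def)
      also have "integral {-2*b..2*b} (\<lambda>z. cmod (e z)) \<le> integral {-2*b..2*b} (\<lambda>z. \<delta>)"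
        using Q by (intro integral_le integrable_continuous_real continuous_intros ce) (auto simp: e_def less_imp_le)
      also have "\<delta> + C * integral {-2*b..2*b} (\<lambda>z. \<delta>) = \<delta> * (1 + 4 * b * C)"
        using b by (simp add: algebra_simps)
      finally show ?thesis
        using d3 C(1) x by (simp add: E_def Mg norm_minus_commute mult_left_mono)
    qed
    moreover have "cmod (poly Q (of_real z)) \<le> B + 1" if "z \<in> {-2*b..2*b}" for z
      using norm_triangle_sub[of "poly Q (of_real z)" "M 0 z"] Q[OF that] B[OF that] d(2)
      by (simp add: norm_minus_commute)
    ultimately show ?thesis by blast
  qed
  then show ?thesis by blast
qed

text \<open>The trace at \<open>x\<close> is bounded by the initial value at \<open>2 * x\<close>
  plus an \<open>L1\<close> norm, which Cauchy-Schwarz turns into an \<open>L2\<close> norm over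
  \<open>[-2b, 2b]\<close>. This transfers the truncation error of a polynomial to its
  trace.\<close>

lemma trace_L2_bound:
  obtains C where "C \<ge> 0" "\<And>Q. integral {0..b} (\<lambda>x. (cmod (mixed_poly F G Q x x))\<^sup>2) \<le> C * cheb_sq (2 * b) Q"
proof -
  obtain C where C: "C \<ge> 0"
    "\<And>M e x. continuous_on ({0..b} \<times> UNIV) (\<lambda>(x, c). M x c) \<Longrightarrow> continuous_on {-2*b..2*b} e \<Longrightarrow>
      (\<And>x c. x \<in> {0..b} \<Longrightarrow> c \<le> 2 * b \<Longrightarrow> M x c = e c + integral {0..x} (\<lambda>y. p y * M y (2 * y - c))) \<Longrightarrow>
      x \<in> {0..b} \<Longrightarrow> cmod (M x (2 * x)) \<le> cmod (e (2 * x)) + C * integral {-2*b..2*b} (\<lambda>z. cmod (e z))"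
    using trace_problem_estimate[OF b p] by blast
  have "integral {0..b} (\<lambda>x. (cmod (mixed_poly F G Q x x))\<^sup>2) \<le> (1 + 8 * b\<^sup>2 * C\<^sup>2) * (2 * b) * cheb_sq (2 * b) Q" for Q
  proof -
    define e where "e = (\<lambda>z. poly Q (complex_of_real z))"
    define J where "J = integral {-2*b..2*b} (\<lambda>z. cmod (e z))"
    define K where "K = integral {-2*b..2*b} (\<lambda>z. (cmod (e z))\<^sup>2)"
    have ce: "continuous_on A e" for A unfolding e_def by (intro continuous_intros)
    have ce2: "continuous_on {0..b} (\<lambda>x. e (2 * x))" unfolding e_def by (intro continuous_intros)
    have ci: "continuous_on A (\<lambda>z. (cmod (e z))\<^sup>2)" for A by (intro continuous_intros ce)
    have pt: "cmod (mixed_poly F G Q x x) \<le> cmod (e (2 * x)) + C * J" if x: "x \<in> {0..b}" for x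
      using C(2)[OF mixed_poly_continuous_shift ce _ x, of Q] mixed_poly_shift_eq[of _ Q]
      by (simp add: e_def J_def)
    have "J\<^sup>2 \<le> (2 * b - (- 2 * b)) * K" unfolding J_def K_def
      using b by (intro Cauchy_Schwarz_integral continuous_intros ce) auto
    then have J2: "J\<^sup>2 \<le> 4 * b * K" by simp
    have mc: "continuous_on {0..b} (\<lambda>x. mixed_poly F G Q x x)"
      using mixed_poly_continuous_line[of Q 0 1] by simp
    have "integral {0..b} (\<lambda>x. (cmod (mixed_poly F G Q x x))\<^sup>2) \<le> integral {0..b} (\<lambda>x. 2 * (cmod (e (2 * x)))\<^sup>2 + 2 * (C * J)\<^sup>2)"
    proof (rule integral_le)
      fix x assume "x \<in> {0..b}"
      then have "(cmod (mixed_poly F G Q x x))\<^sup>2 \<le> (cmod (e (2 * x)) + C * J)\<^sup>2"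
        using pt by (intro power_mono) auto
      also have "\<dots> \<le> 2 * (cmod (e (2 * x)))\<^sup>2 + 2 * (C * J)\<^sup>2"
        using zero_le_power2[of "cmod (e (2 * x)) - C * J"] by (simp add: power2_diff power2_sum)
      finally show "(cmod (mixed_poly F G Q x x))\<^sup>2 \<le> 2 * (cmod (e (2 * x)))\<^sup>2 + 2 * (C * J)\<^sup>2" .
    qed (auto intro!: integrable_continuous_real continuous_intros mc ce2)
    also have "\<dots> = 2 * integral {0..b} (\<lambda>x. (cmod (e (2 * x)))\<^sup>2) + b * (2 * (C * J)\<^sup>2)"
      using b by (subst Henstock_Kurzweil_Integration.integral_add)
        (auto intro!: integrable_continuous_real continuous_intros ce2)
    also have "integral {0..b} (\<lambda>x. (cmod (e (2 * x)))\<^sup>2) = integral {0..2*b} (\<lambda>z. (cmod (e z))\<^sup>2) / 2"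
      using integral_affine[of 2 "\<lambda>z. (cmod (e z))\<^sup>2" 0 0 b] b by (simp add: integrable_continuous_real ci)
    also have "integral {0..2*b} (\<lambda>z. (cmod (e z))\<^sup>2) \<le> K"
      unfolding K_def using b by (intro integral_subset_le integrable_continuous_real ci) auto
    also have "b * (2 * (C * J)\<^sup>2) = 2 * b * C\<^sup>2 * J\<^sup>2" by (simp add: power_mult_distrib)
    also have "2 * b * C\<^sup>2 * J\<^sup>2 \<le> 2 * b * C\<^sup>2 * (4 * b * K)" using b J2 by (intro mult_left_mono) auto
    also have "2 * (K / 2) + 2 * b * C\<^sup>2 * (4 * b * K) = (1 + 8 * b\<^sup>2 * C\<^sup>2) * K"
      by (simp add: algebra_simps power2_eq_square)
    finally have "integral {0..b} (\<lambda>x. (cmod (mixed_poly F G Q x x))\<^sup>2) \<le> (1 + 8 * b\<^sup>2 * C\<^sup>2) * K"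
      by simp
    also have "K \<le> 2 * b * cheb_sq (2 * b) Q"
      using integral_poly_le_cheb_sq[of "2 * b" Q] b by (simp add: K_def e_def)
    finally show ?thesis by (simp add: mult.assoc add_nonneg_nonneg mult_left_mono)
  qed
  moreover have "(1 + 8 * b\<^sup>2 * C\<^sup>2) * (2 * b) \<ge> 0" using b by simp
  ultimately show ?thesis using that by blast
qed


text \<open>With \<open>L Q x = mixed_poly F G Q x x\<close> and \<open>L'\<close> the analogous operator of the swapped system, the traces satisfy
  \<open>(L Q)' = 2 L' (Q') + p (Q(0) + \<integral>\<^sub>0\<^sup>x p L Q)\<close>. The operator \<open>g \<mapsto> g\<^sub>1\<close> below inverts this, so that approximating
  \<open>g\<close> by \<open>L Q\<close> reduces to approximating the less regular \<open>g\<^sub>1\<close> by \<open>L' (Q')\<close>.\<close>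

lemma trace_approx_step:
  assumes g: "\<And>x. x \<in> {0..b} \<Longrightarrow> (g has_vector_derivative g' x) (at x within {0..b})" and cg': "continuous_on {0..b} g'"
  defines "g1 \<equiv> \<lambda>x. (1 / 2) * (g' x - p x * (g 0 + integral {0..x} (\<lambda>y. p y * g y)))"
  obtains C where "C > 0"
    "\<And>Q \<delta> x. poly Q 0 = g 0 \<Longrightarrow> \<delta> \<ge> 0 \<Longrightarrow> (\<And>x. x \<in> {0..b} \<Longrightarrow> cmod (mixed_poly G F (pderiv Q) x x - g1 x) \<le> \<delta>) \<Longrightarrow>
      x \<in> {0..b} \<Longrightarrow> cmod (mixed_poly F G Q x x - g x) \<le> C * \<delta>"
proof -
  obtain M0 where M0: "M0 \<ge> 0" "\<And>x. x \<in> {0..b} \<Longrightarrow> cmod (p x) \<le> M0"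
    using continuous_on_compact_bound[OF compact_Icc p] by blast
  \<comment> \<open>At least 1, because \<open>R\<close> below carries no factor \<open>p\<close>
    while \<open>weighted_Volterra_step\<close> expects the source behind the factor
    \<open>Mp\<close>.\<close>
  define Mp where "Mp = M0 + 1"
  have Mp: "Mp \<ge> 1" "Mp \<ge> 0" "\<And>x. x \<in> {0..b} \<Longrightarrow> cmod (p x) \<le> Mp"
    using M0 by (force simp: Mp_def)+
  define l where "l = 2 * Mp + 1"
  have l0: "l > 0" using Mp by (simp add: l_def)
  have cg: "continuous_on {0..b} g" using g by (rule continuous_on_vector_derivative)
  have "cmod (mixed_poly F G Q x x - g x) \<le> 4 * Mp * b * exp (l * b) * \<delta>"
    if Q0: "poly Q 0 = g 0" and \<delta>: "\<delta> \<ge> 0"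
      and r: "\<And>x. x \<in> {0..b} \<Longrightarrow> cmod (mixed_poly G F (pderiv Q) x x - g1 x) \<le> \<delta>" and x: "x \<in> {0..b}" for Q \<delta> x
  proof -
    define D where "D = (\<lambda>x. mixed_poly F G Q x x - g x)"
    \<comment> \<open>The companion error on the other characteristic \<open>t = -x\<close>.
      Together \<open>D' = p * Y + R\<close> and \<open>Y' = p * D\<close> form a closed linear
      system with zero initial values.\<close>
    define Y where "Y = (\<lambda>x. mixed_poly F G Q x (- x) - (g 0 + integral {0..x} (\<lambda>y. p y * g y)))"
    define R where "R = (\<lambda>x. 2 * (mixed_poly G F (pderiv Q) x x - g1 x))"
    have cpg: "continuous_on {0..b} (\<lambda>y. p y * g y)" by (intro continuous_intros p cg)
    have dD: "(D has_vector_derivative p x * Y x + R x) (at x within {0..b})" if x: "x \<in> {0..b}" for x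
    proof -
      have "((\<lambda>x. mixed_poly F G Q x (0 + 1 * x) - g x) has_vector_derivative
         (p x * mixed_poly F G Q x (- (0 + 1 * x)) + (1 + of_real 1) * mixed_poly G F (pderiv Q) x (0 + 1 * x)) - g' x) (at x within {0..b})"
        by (intro has_vector_derivative_diff mixed_poly_derivative g x)
      then show ?thesis by (simp add: D_def Y_def R_def g1_def algebra_simps)
    qed
    have dY: "(Y has_vector_derivative p x * D x) (at x within {0..b})" if x: "x \<in> {0..b}" for x
    proof -
      have "((\<lambda>x. mixed_poly F G Q x (0 + (-1) * x) - (g 0 + integral {0..x} (\<lambda>y. p y * g y))) has_vector_derivative
         (p x * mixed_poly F G Q x (- (0 + (-1) * x)) + (1 + of_real (-1)) * mixed_poly G F (pderiv Q) x (0 + (-1) * x)) - (0 + p x * g x)) (at x within {0..b})"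
        by (intro has_vector_derivative_diff has_vector_derivative_add has_vector_derivative_const
           mixed_poly_derivative integral_has_vector_derivative[OF cpg] x)
      then show ?thesis by (simp add: D_def Y_def right_diff_distrib)
    qed
    have D0: "D 0 = 0" and Y0: "Y 0 = 0" using Q0 by (simp_all add: D_def Y_def mixed_poly_0)
    have iD: "((\<lambda>y. p y * Y y + R y) has_integral D x) {0..x}" and iY: "((\<lambda>y. p y * D y) has_integral Y x) {0..x}"
      if x: "x \<in> {0..b}" for x
    proof -
      have "((\<lambda>y. p y * Y y + R y) has_integral (D x - D 0)) {0..x}"
        using x by (intro fundamental_theorem_of_calculus has_vector_derivative_within_subset[OF dD]) auto
      then show "((\<lambda>y. p y * Y y + R y) has_integral D x) {0..x}" by (simp add: D0)
      have "((\<lambda>y. p y * D y) has_integral (Y x - Y 0)) {0..x}"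
        using x by (intro fundamental_theorem_of_calculus has_vector_derivative_within_subset[OF dY]) auto
      then show "((\<lambda>y. p y * D y) has_integral Y x) {0..x}" by (simp add: Y0)
    qed
    define W where "W = (\<lambda>x. max (cmod (D x)) (cmod (Y x)) * exp (- (l * (0 + x))))"
    have "continuous_on {0..b} D" "continuous_on {0..b} Y"
      by (rule continuous_on_vector_derivative, erule dD)
         (rule continuous_on_vector_derivative, erule dY)
    then have cW: "continuous_on {0..b} W" unfolding W_def by (intro continuous_intros)
    obtain B0 where B0: "\<And>x. x \<in> {0..b} \<Longrightarrow> norm (W x) \<le> B0"
      using continuous_on_compact_bound[OF compact_Icc cW] by blast
    have "W x \<le> 2 * (Mp * (b * (2 * \<delta>)))"
    proof (rule sup_halving[OF _ _ _ x])
      show "W z \<le> B0" if "z \<in> {0..b}" for z using B0[OF that] by simp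
      show "0 \<le> Mp * (b * (2 * \<delta>))" using Mp b \<delta> by simp
      fix B x assume B: "0 \<le> B" and WB: "\<And>z. z \<in> {0..b} \<Longrightarrow> W z \<le> B" and x: "x \<in> {0..b}"
      have Wb: "cmod (D y) \<le> B * exp (l * (0 + y))" "cmod (Y y) \<le> B * exp (l * (0 + y))" if "y \<in> {0..b}" for y
        using WB[OF that] by (auto simp: W_def mult_exp_minus_le_iff)
      have x0: "0 \<le> x" using x by simp
      have "cmod (integral {0..x} (\<lambda>y. p y * Y y + R y)) * exp (- (l * (0 + x))) \<le> Mp * integral {0..x} (\<lambda>y. 2 * \<delta>) + B / 2"
      proof (rule weighted_Volterra_step[OF l_def Mp(2) B order_refl x0 has_integral_integrable[OF iD[OF x]]])
        fix y assume "y \<in> {0..x}"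
        then have y: "y \<in> {0..b}" using x by auto
        have "cmod (p y * Y y) \<le> Mp * (B * exp (l * (0 + y)))"
          unfolding norm_mult using Mp Wb(2)[OF y] y by (intro mult_mono) auto
        moreover have "cmod (R y) \<le> 2 * \<delta>" using r[OF y] unfolding R_def norm_mult by simp
        moreover have "2 * \<delta> \<le> Mp * (2 * \<delta>)" using mult_right_mono[OF Mp(1), of "2 * \<delta>"] \<delta> by simp
        ultimately show "cmod (p y * Y y + R y) \<le> Mp * (2 * \<delta> + B * exp (l * (0 + y)))"
          using norm_triangle_ineq[of "p y * Y y" "R y"] unfolding distrib_left by linarith
      qed (use \<delta> in auto)
      also have "\<dots> \<le> Mp * (b * (2 * \<delta>)) + B / 2"
        using x Mp \<delta> by (simp add: mult_mono)
      finally have 1: "cmod (D x) * exp (- (l * (0 + x))) \<le> Mp * (b * (2 * \<delta>)) + B / 2"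
        by (simp only: integral_unique[OF iD[OF x]])
      have "cmod (integral {0..x} (\<lambda>y. p y * D y)) * exp (- (l * (0 + x))) \<le> Mp * integral {0..x} (\<lambda>y. 0) + B / 2"
      proof (rule weighted_Volterra_step[OF l_def Mp(2) B order_refl x0 has_integral_integrable[OF iY[OF x]]])
        fix y assume "y \<in> {0..x}"
        then have y: "y \<in> {0..b}" using x by auto
        show "cmod (p y * D y) \<le> Mp * (0 + B * exp (l * (0 + y)))"
          unfolding norm_mult using Mp Wb(1)[OF y] y by (intro mult_mono) auto
      qed auto
      also have "\<dots> \<le> Mp * (b * (2 * \<delta>)) + B / 2" using Mp b \<delta> by simp
      finally have 2: "cmod (Y x) * exp (- (l * (0 + x))) \<le> Mp * (b * (2 * \<delta>)) + B / 2"
        by (simp only: integral_unique[OF iY[OF x]])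
      show "W x \<le> Mp * (b * (2 * \<delta>)) + B / 2" using 1 2 unfolding W_def by (simp add: max_def)
    qed
    then have "max (cmod (D x)) (cmod (Y x)) \<le> 2 * (Mp * (b * (2 * \<delta>))) * exp (l * (0 + x))"
      unfolding W_def mult_exp_minus_le_iff .
    also have "\<dots> \<le> 2 * (Mp * (b * (2 * \<delta>))) * exp (l * b)"
      using Mp b \<delta> l0 x by (intro mult_left_mono) auto
    finally show ?thesis by (simp add: D_def mult_ac)
  qed
  moreover have "4 * Mp * b * exp (l * b) > 0" using Mp b by simp
  ultimately show ?thesis using that by blast
qed

end

text \<open>Each induction step trades one derivative of \<open>g\<close> for one of
  \<open>Q\<close> and exchanges the two families of formal powers, which is why \<open>p\<close>,
  \<open>F\<close> and \<open>G\<close> are generalised. That \<open>B\<close> is chosen before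
  \<open>\<epsilon>\<close> is the point of the statement.\<close>

lemma trace_approx_Cr:
  assumes "formal_powers b p F G" "Cr_on k {0..b} p" "Cr_on k {0..b} g"
  shows "\<exists>B. \<forall>\<epsilon>>0. \<exists>Q. (\<forall>x\<in>{0..b}. cmod (mixed_poly F G Q x x - g x) \<le> \<epsilon>) \<and>
    (\<forall>z\<in>{-2*b..2*b}. cmod (poly ((pderiv ^^ k) Q) (of_real z)) \<le> B)"
  using assms
proof (induction k arbitrary: p F G g)
  case 0
  then show ?case using formal_powers.trace_approx_continuous[of b p F G g] by simp
next
  case (Suc k)
  interpret formal_powers b p F G by fact
  obtain g' where g': "\<And>x. x \<in> {0..b} \<Longrightarrow> (g has_vector_derivative g' x) (at x within {0..b})" "Cr_on k {0..b} g'"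
    using Suc.prems(3) unfolding Cr_on.simps by blast
  define g1 where "g1 = (\<lambda>x. (1 / 2) * (g' x - p x * (g 0 + integral {0..x} (\<lambda>y. p y * g y))))"
  note pk = Cr_on_SucD[OF Suc.prems(2)] and gk = Cr_on_SucD[OF Suc.prems(3)]
  have "Cr_on k {0..b} g1"
    unfolding g1_def by (intro Cr_on_mult Cr_on_diff Cr_on_add Cr_on_const Cr_on_integral pk gk g')
  moreover have "Cr_on k {0..b} (\<lambda>x. - p x)"
    using Cr_on_diff[OF Cr_on_const[of k "{0..b}" 0] pk] by simp
  ultimately obtain B where B: "\<And>\<epsilon>. \<epsilon> > 0 \<Longrightarrow> \<exists>Q. (\<forall>x\<in>{0..b}. cmod (mixed_poly G F Q x x - g1 x) \<le> \<epsilon>) \<and>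
    (\<forall>z\<in>{-2*b..2*b}. cmod (poly ((pderiv ^^ k) Q) (of_real z)) \<le> B)"
    using Suc.IH[OF swap, of g1] by blast
  obtain C where C: "C > 0"
    "\<And>Q \<delta> x. poly Q 0 = g 0 \<Longrightarrow> \<delta> \<ge> 0 \<Longrightarrow> (\<And>x. x \<in> {0..b} \<Longrightarrow> cmod (mixed_poly G F (pderiv Q) x x - g1 x) \<le> \<delta>) \<Longrightarrow>
      x \<in> {0..b} \<Longrightarrow> cmod (mixed_poly F G Q x x - g x) \<le> C * \<delta>"
    using trace_approx_step[OF g'(1) Cr_on_imp_continuous_on[OF g'(2)]] unfolding g1_def by blast
  have "\<exists>Q. (\<forall>x\<in>{0..b}. cmod (mixed_poly F G Q x x - g x) \<le> \<epsilon>) \<and>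
    (\<forall>z\<in>{-2*b..2*b}. cmod (poly ((pderiv ^^ Suc k) Q) (of_real z)) \<le> B)" if "\<epsilon> > 0" for \<epsilon>
  proof -
    have e: "\<epsilon> / C > 0" using that C by simp
    from B[OF this] obtain Q1 where Q1: "\<And>x. x \<in> {0..b} \<Longrightarrow> cmod (mixed_poly G F Q1 x x - g1 x) \<le> \<epsilon> / C"
      "\<And>z. z \<in> {-2*b..2*b} \<Longrightarrow> cmod (poly ((pderiv ^^ k) Q1) (of_real z)) \<le> B" by blast
    \<comment> \<open>Integrating \<open>Q1\<close> and adding the constant \<open>g 0\<close> keeps
      the derivative of order \<open>Suc k\<close> equal to that of order \<open>k\<close> of
      \<open>Q1\<close>, so \<open>B\<close> is inherited unchanged.\<close>
    obtain P where P: "pderiv P = Q1" "poly P 0 = 0" using pderiv_surj by metis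
    define Q where "Q = P + [:g 0:]"
    have Q: "pderiv Q = Q1" "poly Q 0 = g 0" using P by (auto simp: Q_def pderiv_add pderiv_pCons)
    have "cmod (mixed_poly F G Q x x - g x) \<le> \<epsilon>" if "x \<in> {0..b}" for x
      using C(2)[OF Q(2) _ _ that, of "\<epsilon> / C"] Q1(1) e C(1) unfolding Q(1) by simp
    moreover have "(pderiv ^^ Suc k) Q = (pderiv ^^ k) Q1" by (simp add: funpow_Suc_right Q del: funpow.simps)
    ultimately show ?thesis using Q1(2) by (intro exI[of _ Q]) simp
  qed
  then show ?case by blast
qed

text \<open>There are two errors: that of the trace of some \<open>Q\<close> of uncontrolled degree,
  made at most \<open>1 / N^k\<close> by the choice of \<open>Q\<close>, and the trace of
  \<open>Q - q\<close>, where \<open>q\<close> comes from \<open>cheb_sq_approx\<close> and only the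
  uniform bound on the derivative of order \<open>k\<close> enters.\<close>

lemma trace_approx_rate:
  assumes fp: "formal_powers b p F G" and pk: "Cr_on k {0..b} p" and g: "Cr_on k {0..b} g" and k: "k \<ge> 1"
  obtains C where "C \<ge> 0"
    "\<And>N. N \<ge> k \<Longrightarrow> \<exists>q. degree q \<le> N \<and>
      integral {0..b} (\<lambda>x. (cmod (g x - mixed_poly F G q x x))\<^sup>2) \<le> (C / real N ^ k)\<^sup>2"
proof -
  interpret formal_powers b p F G by fact
  obtain B where B: "\<And>\<epsilon>. \<epsilon> > 0 \<Longrightarrow> \<exists>Q. (\<forall>x\<in>{0..b}. cmod (mixed_poly F G Q x x - g x) \<le> \<epsilon>) \<and>
    (\<forall>z\<in>{-2*b..2*b}. cmod (poly ((pderiv ^^ k) Q) (of_real z)) \<le> B)"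
    using trace_approx_Cr[OF fp pk g] by blast
  obtain C1 where C1: "C1 \<ge> 0" "\<And>Q. integral {0..b} (\<lambda>x. (cmod (mixed_poly F G Q x x))\<^sup>2) \<le> C1 * cheb_sq (2 * b) Q"
    using trace_L2_bound by blast
  \<comment> \<open>The summand \<open>2 * b\<close> belongs to the uniform error
    \<open>1 / N^k\<close>, the other one to the truncation; \<open>pi * B^2\<close> bounds
    \<open>cheb_sq\<close> of the derivative of order \<open>k\<close>, and the factor
    \<open>real k\<close> pays for replacing \<open>N + 1 - k\<close> by \<open>N\<close>.\<close>
  define K where "K = 2 * b + 2 * C1 * ((2 * b * real k) ^ k)\<^sup>2 * (pi * B\<^sup>2)"
  have K: "K \<ge> 0" using b C1 by (simp add: K_def)
  have cont: "continuous_on {0..b} (\<lambda>x. mixed_poly F G Q x x)" for Q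
    using mixed_poly_continuous_line[of Q 0 1] by simp
  have cg: "continuous_on {0..b} g" by (rule Cr_on_imp_continuous_on[OF g])
  have "\<exists>q. degree q \<le> N \<and>
      integral {0..b} (\<lambda>x. (cmod (g x - mixed_poly F G q x x))\<^sup>2) \<le> (sqrt K / real N ^ k)\<^sup>2" if N: "N \<ge> k" for N
  proof -
    have N0: "real N > 0" using N k by simp
    obtain Q where Q: "\<And>x. x \<in> {0..b} \<Longrightarrow> cmod (mixed_poly F G Q x x - g x) \<le> 1 / real N ^ k"
      "\<And>z. z \<in> {-2*b..2*b} \<Longrightarrow> cmod (poly ((pderiv ^^ k) Q) (of_real z)) \<le> B"
      using B[of "1 / real N ^ k"] N0 by (metis zero_less_divide_1_iff zero_less_power)
    obtain q where q: "degree q \<le> N"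
      "cheb_sq (2 * b) (Q - q) \<le> ((2 * b / real (Suc N - k)) ^ k)\<^sup>2 * cheb_sq (2 * b) ((pderiv ^^ k) Q)"
      using cheb_sq_approx[of "2 * b" k N Q] N b by auto
    have "cheb_sq (2 * b) ((pderiv ^^ k) Q) \<le> integral {0..pi} (\<lambda>\<theta>. B\<^sup>2)"
      unfolding cheb_sq_def
    proof (rule integral_le)
      fix \<theta> :: real
      have "2 * b * cos \<theta> \<in> {-2*b..2*b}"
        using b mult_left_mono[of "-1" "cos \<theta>" "2*b"] mult_left_mono[of "cos \<theta>" 1 "2*b"] by simp
      then show "(cmod (poly ((pderiv ^^ k) Q) (of_real (2 * b * cos \<theta>))))\<^sup>2 \<le> B\<^sup>2"
        by (intro power_mono Q) auto
    qed (auto intro!: integrable_continuous_real continuous_intros)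
    then have cB: "cheb_sq (2 * b) ((pderiv ^^ k) Q) \<le> pi * B\<^sup>2" by simp
    \<comment> \<open>With \<open>N = k + j\<close> this is \<open>k + j \<le> k * (j + 1)\<close>,
      which uses \<open>k \<ge> 1\<close>.\<close>
    have "real N \<le> real k * real (Suc N - k)"
    proof -
      have "N \<le> k * (Suc N - k)"
      proof -
        obtain j where "N = k + j" using N le_Suc_ex by blast
        then show ?thesis using k by simp
      qed
      then show ?thesis by (metis of_nat_le_iff of_nat_mult)
    qed
    then have "2 * b / real (Suc N - k) \<le> 2 * b * real k / real N"
      using b N N0 by (simp add: field_simps del: of_nat_diff)
    then have "((2 * b / real (Suc N - k)) ^ k)\<^sup>2 \<le> ((2 * b * real k / real N) ^ k)\<^sup>2"
      using b by (intro power_mono) auto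
    then have "cheb_sq (2 * b) (Q - q) \<le> ((2 * b * real k / real N) ^ k)\<^sup>2 * (pi * B\<^sup>2)"
      using q(2) cB by (intro order_trans[OF q(2)] mult_mono) (auto simp: cheb_sq_def intro!: integral_nonneg integrable_continuous_real continuous_intros)
    also have "\<dots> = ((2 * b * real k) ^ k)\<^sup>2 * (pi * B\<^sup>2) / (real N ^ k)\<^sup>2"
      by (simp add: power_divide)
    finally have cq: "cheb_sq (2 * b) (Q - q) \<le> ((2 * b * real k) ^ k)\<^sup>2 * (pi * B\<^sup>2) / (real N ^ k)\<^sup>2" .
    have "integral {0..b} (\<lambda>x. (cmod (g x - mixed_poly F G q x x))\<^sup>2)
       \<le> integral {0..b} (\<lambda>x. 2 * (1 / real N ^ k)\<^sup>2 + 2 * (cmod (mixed_poly F G (Q - q) x x))\<^sup>2)"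
    proof (rule integral_le)
      fix x assume x: "x \<in> {0..b}"
      have e: "g x - mixed_poly F G q x x = mixed_poly F G (Q - q) x x - (mixed_poly F G Q x x - g x)"
        by (simp add: mixed_poly_diff)
      have "cmod (g x - mixed_poly F G q x x) \<le> cmod (mixed_poly F G (Q - q) x x) + 1 / real N ^ k"
        unfolding e using norm_triangle_ineq4[of "mixed_poly F G (Q - q) x x" "mixed_poly F G Q x x - g x"] Q(1)[OF x] by simp
      then have "(cmod (g x - mixed_poly F G q x x))\<^sup>2 \<le> (cmod (mixed_poly F G (Q - q) x x) + 1 / real N ^ k)\<^sup>2"
        by (rule power_mono) simp
      also have "\<dots> \<le> 2 * (1 / real N ^ k)\<^sup>2 + 2 * (cmod (mixed_poly F G (Q - q) x x))\<^sup>2"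
        using zero_le_power2[of "cmod (mixed_poly F G (Q - q) x x) - 1 / real N ^ k"] by (simp only: power2_diff power2_sum)
      finally show "(cmod (g x - mixed_poly F G q x x))\<^sup>2 \<le> 2 * (1 / real N ^ k)\<^sup>2 + 2 * (cmod (mixed_poly F G (Q - q) x x))\<^sup>2" .
    qed (auto intro!: integrable_continuous_real continuous_intros cont cg)
    also have "\<dots> = b * (2 * (1 / real N ^ k)\<^sup>2) + 2 * integral {0..b} (\<lambda>x. (cmod (mixed_poly F G (Q - q) x x))\<^sup>2)"
      using b by (subst Henstock_Kurzweil_Integration.integral_add)
        (auto intro!: integrable_continuous_real continuous_intros cont)
    also have "\<dots> \<le> b * (2 * (1 / real N ^ k)\<^sup>2) + 2 * (C1 * (((2 * b * real k) ^ k)\<^sup>2 * (pi * B\<^sup>2) / (real N ^ k)\<^sup>2))"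
      using C1(1) cq by (intro add_left_mono mult_left_mono order_trans[OF C1(2)]) auto
    also have "\<dots> = K / (real N ^ k)\<^sup>2"
      by (simp add: K_def power_divide add_divide_distrib mult_ac)
    also have "\<dots> = (sqrt K / real N ^ k)\<^sup>2" using K by (simp add: power_divide)
    finally show ?thesis using q(1) by blast
  qed
  then show ?thesis using that[of "sqrt K"] K by simp
qed

section \<open>From the least squares residuals to the kernels\<close>

text \<open>On a line of constant \<open>x\<close> the characteristic coordinates are
  \<open>(x + t) / 2\<close> and \<open>(x - t) / 2\<close>; the boundary errors are functions of
  one of them.\<close>

lemma integral_half_affine:
  fixes f :: "real \<Rightarrow> real"
  assumes "continuous_on {0..x} f"
  shows "integral {-x..x} (\<lambda>t. f ((x + t) / 2)) = 2 * integral {0..x} f"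
    and "integral {-x..x} (\<lambda>t. f ((x - t) / 2)) = 2 * integral {0..x} f"
proof -
  show 1: "integral {-x..x} (\<lambda>t. f ((x + t) / 2)) = 2 * integral {0..x} f"
    using integral_affine[of "1/2" f "-x" "x/2" x] assms
    by (simp add: integrable_continuous_real add_divide_distrib add.commute)
  show "integral {-x..x} (\<lambda>t. f ((x - t) / 2)) = 2 * integral {0..x} f"
    using Henstock_Kurzweil_Integration.integral_reflect_real[of x "-x" "\<lambda>t. f ((x + t) / 2)"] 1 by simp
qed

context formal_powers
begin

text \<open>The approximate sum and difference solve the same linear system, so
  \<open>Goursat_estimate\<close> applies to the errors, with boundary data formed from the two
  residuals. The bound assumed on \<open>2 * cmod (E t)\<close> fits half the sum and half the
  difference alike and thus covers both kernels.\<close>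

lemma kernel_error_bound:
  defines "T \<equiv> {(\<xi>, \<eta>). 0 \<le> \<xi> \<and> 0 \<le> \<eta> \<and> \<xi> + \<eta> \<le> b}"
  assumes m: "continuous_on T (\<lambda>(\<xi>, \<eta>). m \<xi> \<eta>)" and s: "continuous_on T (\<lambda>(\<xi>, \<eta>). s \<xi> \<eta>)"
    and eqm: "\<And>\<xi> \<eta>. (\<xi>, \<eta>) \<in> T \<Longrightarrow> m \<xi> \<eta> = p \<xi> + integral {0..\<eta>} (\<lambda>v. p (\<xi> + v) * s \<xi> v)"
    and eqs: "\<And>\<xi> \<eta>. (\<xi>, \<eta>) \<in> T \<Longrightarrow> s \<xi> \<eta> = integral {0..\<xi>} (\<lambda>u. p (u + \<eta>) * m u \<eta>)"
  obtains C where "C \<ge> 0"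
    "\<And>P Q E x. \<lbrakk>0 \<le> x; x \<le> b; continuous_on {-x..x} E;
      \<And>t. t \<in> {-x..x} \<Longrightarrow> 2 * cmod (E t) \<le>
        cmod (m ((x + t) / 2) ((x - t) / 2) - (mixed_poly F G P x t + mixed_poly G F Q x t)) +
        cmod (s ((x + t) / 2) ((x - t) / 2) - (mixed_poly F G P x (- t) - mixed_poly G F Q x (- t)))\<rbrakk> \<Longrightarrow>
      integral {-x..x} (\<lambda>t. (cmod (E t))\<^sup>2) \<le>
        C * (integral {0..b} (\<lambda>z. (cmod (p z / 2 - mixed_poly F G P z z))\<^sup>2) +
             integral {0..b} (\<lambda>z. (cmod (p z / 2 - mixed_poly G F Q z z))\<^sup>2))"
proof -
  interpret sw: formal_powers b "\<lambda>x. - p x" G F by (rule swap)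
  obtain C where C: "C \<ge> 0" and
    est: "\<And>m s \<mu> \<nu> \<xi> \<eta>. continuous_on T (\<lambda>(\<xi>, \<eta>). m \<xi> \<eta>) \<Longrightarrow> continuous_on T (\<lambda>(\<xi>, \<eta>). s \<xi> \<eta>) \<Longrightarrow>
      continuous_on {0..b} \<mu> \<Longrightarrow> continuous_on {0..b} \<nu> \<Longrightarrow>
      (\<And>\<xi> \<eta>. (\<xi>, \<eta>) \<in> T \<Longrightarrow> m \<xi> \<eta> = \<mu> \<xi> + integral {0..\<eta>} (\<lambda>v. p (\<xi> + v) * s \<xi> v)) \<Longrightarrow>
      (\<And>\<xi> \<eta>. (\<xi>, \<eta>) \<in> T \<Longrightarrow> s \<xi> \<eta> = \<nu> \<eta> + integral {0..\<xi>} (\<lambda>u. p (u + \<eta>) * m u \<eta>)) \<Longrightarrow>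
      (\<xi>, \<eta>) \<in> T \<Longrightarrow>
      cmod (m \<xi> \<eta>) \<le> cmod (\<mu> \<xi>) + C * (integral {0..b} (\<lambda>z. cmod (\<mu> z)) + integral {0..b} (\<lambda>z. cmod (\<nu> z))) \<and>
      cmod (s \<xi> \<eta>) \<le> cmod (\<nu> \<eta>) + C * (integral {0..b} (\<lambda>z. cmod (\<mu> z)) + integral {0..b} (\<lambda>z. cmod (\<nu> z)))"
    using Goursat_estimate[OF b p] unfolding T_def by blast
  have "integral {-x..x} (\<lambda>t. (cmod (E t))\<^sup>2) \<le>
        (3 + 24 * b\<^sup>2 * C\<^sup>2) * (integral {0..b} (\<lambda>z. (cmod (p z / 2 - mixed_poly F G P z z))\<^sup>2) +
             integral {0..b} (\<lambda>z. (cmod (p z / 2 - mixed_poly G F Q z z))\<^sup>2))"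
    if x: "0 \<le> x" "x \<le> b" and cE: "continuous_on {-x..x} E"
      and E: "\<And>t. t \<in> {-x..x} \<Longrightarrow> 2 * cmod (E t) \<le>
        cmod (m ((x + t) / 2) ((x - t) / 2) - (mixed_poly F G P x t + mixed_poly G F Q x t)) +
        cmod (s ((x + t) / 2) ((x - t) / 2) - (mixed_poly F G P x (- t) - mixed_poly G F Q x (- t)))"
    for P Q E x
  proof -
    define e1 where "e1 = (\<lambda>z. p z / 2 - mixed_poly F G P z z)"
    define e2 where "e2 = (\<lambda>z. p z / 2 - mixed_poly G F Q z z)"
    \<comment> \<open>The boundary errors at \<open>\<eta> = 0\<close> and \<open>\<xi> = 0\<close>.
      The exact difference of the kernels is \<open>p\<close> on the first, and their sum is zero on
      the second, in accordance with the cancellation of \<open>p / 2\<close> in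
      \<open>e1 - e2\<close>.\<close>
    define \<mu> where "\<mu> = (\<lambda>z. e1 z + e2 z)"
    define \<nu> where "\<nu> = (\<lambda>z. e1 z - e2 z)"
    define m' where "m' = (\<lambda>\<xi> \<eta>. mixed_poly F G P (\<xi> + \<eta>) (\<xi> - \<eta>) + mixed_poly G F Q (\<xi> + \<eta>) (\<xi> - \<eta>))"
    define s' where "s' = (\<lambda>\<xi> \<eta>. mixed_poly F G P (\<xi> + \<eta>) (\<eta> - \<xi>) - mixed_poly G F Q (\<xi> + \<eta>) (\<eta> - \<xi>))"
    have ce1: "continuous_on {0..b} e1" and ce2: "continuous_on {0..b} e2"
      using mixed_poly_continuous_line[of P 0 1] sw.mixed_poly_continuous_line[of Q 0 1] p
      by (auto simp: e1_def e2_def intro!: continuous_intros)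
    have cmu: "continuous_on {0..b} \<mu>" and cnu: "continuous_on {0..b} \<nu>"
      unfolding \<mu>_def \<nu>_def by (intro continuous_intros ce1 ce2)+
    have cP: "continuous_on T (\<lambda>z. mixed_poly F G P (fst z + snd z) (h z))" "continuous_on T (\<lambda>z. mixed_poly G F Q (fst z + snd z) (h z))"
      if h: "continuous_on T h" for h
    proof -
      have img: "(\<lambda>z. (fst z + snd z, h z)) ` T \<subseteq> {0..b} \<times> UNIV" by (auto simp: T_def)
      have c: "continuous_on T (\<lambda>z. (fst z + snd z, h z))" by (intro continuous_intros h)
      from continuous_on_compose2[OF mixed_poly_continuous c img]
      show "continuous_on T (\<lambda>z. mixed_poly F G P (fst z + snd z) (h z))" by simp
      from continuous_on_compose2[OF sw.mixed_poly_continuous c img]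
      show "continuous_on T (\<lambda>z. mixed_poly G F Q (fst z + snd z) (h z))" by simp
    qed
    have cm': "continuous_on T (\<lambda>(\<xi>, \<eta>). m \<xi> \<eta> - m' \<xi> \<eta>)" and cs': "continuous_on T (\<lambda>(\<xi>, \<eta>). s \<xi> \<eta> - s' \<xi> \<eta>)"
      using m s unfolding m'_def s'_def split_def by (auto intro!: continuous_intros cP)
    have line_s: "continuous_on {0..\<eta>} (\<lambda>v. s \<xi> v)" and line_m: "continuous_on {0..\<xi>} (\<lambda>u. m u \<eta>)" if "(\<xi>, \<eta>) \<in> T" for \<xi> \<eta>
    proof -
      have "continuous_on {0..\<eta>} (\<lambda>v. (\<lambda>(\<xi>, \<eta>). s \<xi> \<eta>) (\<xi>, v))"
        using that by (intro continuous_on_compose2[OF s] continuous_on_Pair continuous_on_const continuous_on_id) (auto simp: T_def)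
      then show "continuous_on {0..\<eta>} (\<lambda>v. s \<xi> v)" by simp
      have "continuous_on {0..\<xi>} (\<lambda>u. (\<lambda>(\<xi>, \<eta>). m \<xi> \<eta>) (u, \<eta>))"
        using that by (intro continuous_on_compose2[OF m] continuous_on_Pair continuous_on_const continuous_on_id) (auto simp: T_def)
      then show "continuous_on {0..\<xi>} (\<lambda>u. m u \<eta>)" by simp
    qed
    \<comment> \<open>For fixed \<open>\<xi>\<close> the point moves on the line
      \<open>t = 2 * \<xi> - z\<close> of slope -1, so only the reflected terms survive; the
      opposite signs of \<open>p\<close> in the two families assemble them into
      \<open>s'\<close>.\<close>
    have hm: "((\<lambda>v. p (\<xi> + v) * s' \<xi> v) has_integral (m' \<xi> \<eta> - m' \<xi> 0)) {0..\<eta>}" if mem: "(\<xi>, \<eta>) \<in> T" for \<xi> \<eta>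
    proof (rule fundamental_theorem_of_calculus)
      fix v assume v: "v \<in> {0..\<eta>}"
      have z: "\<xi> + v \<in> {0..b}" using mem v by (auto simp: T_def)
      have "((\<lambda>z. mixed_poly F G P z (2 * \<xi> + (-1) * z) + mixed_poly G F Q z (2 * \<xi> + (-1) * z)) has_vector_derivative
        ((p (\<xi> + v) * mixed_poly F G P (\<xi> + v) (- (2 * \<xi> + (-1) * (\<xi> + v))) + (1 + of_real (-1)) * mixed_poly G F (pderiv P) (\<xi> + v) (2 * \<xi> + (-1) * (\<xi> + v)))
        + (- p (\<xi> + v) * mixed_poly G F Q (\<xi> + v) (- (2 * \<xi> + (-1) * (\<xi> + v))) + (1 + of_real (-1)) * mixed_poly F G (pderiv Q) (\<xi> + v) (2 * \<xi> + (-1) * (\<xi> + v)))))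
        (at (\<xi> + v) within {0..b})"
        by (intro has_vector_derivative_add mixed_poly_derivative sw.mixed_poly_derivative z)
      from has_vector_derivative_translate[OF this, of \<eta>] mem
      show "((\<lambda>v. m' \<xi> v) has_vector_derivative p (\<xi> + v) * s' \<xi> v) (at v within {0..\<eta>})"
        by (simp add: T_def m'_def s'_def right_diff_distrib)
    qed (use mem in \<open>auto simp: T_def\<close>)
    have hs: "((\<lambda>u. p (u + \<eta>) * m' u \<eta>) has_integral (s' \<xi> \<eta> - s' 0 \<eta>)) {0..\<xi>}" if mem: "(\<xi>, \<eta>) \<in> T" for \<xi> \<eta>
    proof (rule fundamental_theorem_of_calculus)
      fix u assume u: "u \<in> {0..\<xi>}"
      have z: "\<eta> + u \<in> {0..b}" using mem u by (auto simp: T_def)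
      have "((\<lambda>z. mixed_poly F G P z (2 * \<eta> + (-1) * z) - mixed_poly G F Q z (2 * \<eta> + (-1) * z)) has_vector_derivative
        ((p (\<eta> + u) * mixed_poly F G P (\<eta> + u) (- (2 * \<eta> + (-1) * (\<eta> + u))) + (1 + of_real (-1)) * mixed_poly G F (pderiv P) (\<eta> + u) (2 * \<eta> + (-1) * (\<eta> + u)))
        - (- p (\<eta> + u) * mixed_poly G F Q (\<eta> + u) (- (2 * \<eta> + (-1) * (\<eta> + u))) + (1 + of_real (-1)) * mixed_poly F G (pderiv Q) (\<eta> + u) (2 * \<eta> + (-1) * (\<eta> + u)))))
        (at (\<eta> + u) within {0..b})"
        by (intro has_vector_derivative_diff mixed_poly_derivative sw.mixed_poly_derivative z)
      from has_vector_derivative_translate[OF this, of \<xi>] mem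
      show "((\<lambda>u. s' u \<eta>) has_vector_derivative p (u + \<eta>) * m' u \<eta>) (at u within {0..\<xi>})"
        by (simp add: T_def m'_def s'_def distrib_left add.commute)
    qed (use mem in \<open>auto simp: T_def\<close>)
    define J where "J = integral {0..b} (\<lambda>z. cmod (\<mu> z)) + integral {0..b} (\<lambda>z. cmod (\<nu> z))"
    have bound: "cmod (m \<xi> \<eta> - m' \<xi> \<eta>) \<le> cmod (\<mu> \<xi>) + C * J \<and> cmod (s \<xi> \<eta> - s' \<xi> \<eta>) \<le> cmod (\<nu> \<eta>) + C * J"
      if "(\<xi>, \<eta>) \<in> T" for \<xi> \<eta>
      unfolding J_def
    proof (rule est[OF cm' cs' cmu cnu _ _ that])
      fix \<xi> \<eta> assume mem: "(\<xi>, \<eta>) \<in> T"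
      have i1: "(\<lambda>v. p (\<xi> + v) * s \<xi> v) integrable_on {0..\<eta>}"
        using mem by (intro integrable_continuous_real continuous_intros line_s continuous_on_compose2[OF p]) (auto simp: T_def)
      have i2: "(\<lambda>u. p (u + \<eta>) * m u \<eta>) integrable_on {0..\<xi>}"
        using mem by (intro integrable_continuous_real continuous_intros line_m continuous_on_compose2[OF p]) (auto simp: T_def)
      show "m \<xi> \<eta> - m' \<xi> \<eta> = \<mu> \<xi> + integral {0..\<eta>} (\<lambda>v. p (\<xi> + v) * (s \<xi> v - s' \<xi> v))"
        unfolding right_diff_distrib Henstock_Kurzweil_Integration.integral_diff[OF i1 has_integral_integrable[OF hm[OF mem]]]
          integral_unique[OF hm[OF mem]] eqm[OF mem]
        by (simp add: \<mu>_def e1_def e2_def m'_def)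
      show "s \<xi> \<eta> - s' \<xi> \<eta> = \<nu> \<eta> + integral {0..\<xi>} (\<lambda>u. p (u + \<eta>) * (m u \<eta> - m' u \<eta>))"
        unfolding right_diff_distrib Henstock_Kurzweil_Integration.integral_diff[OF i2 has_integral_integrable[OF hs[OF mem]]]
          integral_unique[OF hs[OF mem]] eqs[OF mem]
        by (simp add: \<nu>_def e1_def e2_def s'_def)
    qed
    define N1 where "N1 = integral {0..b} (\<lambda>z. (cmod (\<mu> z))\<^sup>2)"
    define N2 where "N2 = integral {0..b} (\<lambda>z. (cmod (\<nu> z))\<^sup>2)"
    have cm2: "continuous_on {0..b} (\<lambda>z. (cmod (\<mu> z))\<^sup>2)" and cn2: "continuous_on {0..b} (\<lambda>z. (cmod (\<nu> z))\<^sup>2)"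
      by (intro continuous_intros cmu cnu)+
    have J2: "J\<^sup>2 \<le> 2 * b * (N1 + N2)"
    proof -
      have "J\<^sup>2 \<le> 2 * (integral {0..b} (\<lambda>z. cmod (\<mu> z)))\<^sup>2 + 2 * (integral {0..b} (\<lambda>z. cmod (\<nu> z)))\<^sup>2"
        unfolding J_def using zero_le_power2[of "integral {0..b} (\<lambda>z. cmod (\<mu> z)) - integral {0..b} (\<lambda>z. cmod (\<nu> z))"]
        by (simp only: power2_diff power2_sum)
      moreover have "(integral {0..b} (\<lambda>z. cmod (\<mu> z)))\<^sup>2 \<le> (b - 0) * N1" "(integral {0..b} (\<lambda>z. cmod (\<nu> z)))\<^sup>2 \<le> (b - 0) * N2"
        unfolding N1_def N2_def using b by (intro Cauchy_Schwarz_integral continuous_intros cmu cnu; simp)+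
      ultimately show ?thesis by (simp add: algebra_simps)
    qed
    have sub: "integral {0..x} (\<lambda>z. (cmod (\<mu> z))\<^sup>2) \<le> N1" "integral {0..x} (\<lambda>z. (cmod (\<nu> z))\<^sup>2) \<le> N2"
      unfolding N1_def N2_def using x
      by (auto intro!: integral_subset_le integrable_continuous_real cm2 cn2 continuous_on_subset[OF cm2] continuous_on_subset[OF cn2])
    have c1: "continuous_on {-x..x} (\<lambda>t. (cmod (\<mu> ((x + t) / 2)))\<^sup>2)" "continuous_on {-x..x} (\<lambda>t. (cmod (\<nu> ((x - t) / 2)))\<^sup>2)"
      using x by (auto intro!: continuous_intros continuous_on_compose2[OF cmu] continuous_on_compose2[OF cnu])
    have "integral {-x..x} (\<lambda>t. (cmod (E t))\<^sup>2) \<le>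
       integral {-x..x} (\<lambda>t. (3 / 4) * (cmod (\<mu> ((x + t) / 2)))\<^sup>2 + (3 / 4) * (cmod (\<nu> ((x - t) / 2)))\<^sup>2 + 3 * (C * J)\<^sup>2)"
    proof (rule integral_le)
      fix t assume t: "t \<in> {-x..x}"
      define A where "A = cmod (\<mu> ((x + t) / 2)) / 2"
      define B where "B = cmod (\<nu> ((x - t) / 2)) / 2"
      have mem: "((x + t) / 2, (x - t) / 2) \<in> T" using t x by (auto simp: T_def field_simps)
      have h: "(x + t) / 2 + (x - t) / 2 = x" "(x + t) / 2 - (x - t) / 2 = t" "(x - t) / 2 - (x + t) / 2 = - t"
        by (auto simp: field_simps)
      have "cmod (E t) \<le> A + B + C * J"
        using E[OF t] bound[OF mem] unfolding m'_def s'_def h by (simp add: A_def B_def)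
      then have "(cmod (E t))\<^sup>2 \<le> (A + B + C * J)\<^sup>2" by (rule power_mono) simp
      also have "\<dots> \<le> 3 * A\<^sup>2 + 3 * B\<^sup>2 + 3 * (C * J)\<^sup>2"
        using zero_le_power2[of "A - B"] zero_le_power2[of "A - C * J"] zero_le_power2[of "B - C * J"]
        by (simp add: power2_eq_square algebra_simps)
      finally show "(cmod (E t))\<^sup>2 \<le> (3 / 4) * (cmod (\<mu> ((x + t) / 2)))\<^sup>2 + (3 / 4) * (cmod (\<nu> ((x - t) / 2)))\<^sup>2 + 3 * (C * J)\<^sup>2"
        by (simp add: A_def B_def power_divide)
    qed (auto intro!: integrable_continuous_real continuous_intros cE c1)
    also have "\<dots> = (3 / 4) * integral {-x..x} (\<lambda>t. (cmod (\<mu> ((x + t) / 2)))\<^sup>2) + (3 / 4) * integral {-x..x} (\<lambda>t. (cmod (\<nu> ((x - t) / 2)))\<^sup>2)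
        + 2 * x * (3 * (C * J)\<^sup>2)"
    proof -
      have "((\<lambda>t. (3 / 4) * (cmod (\<mu> ((x + t) / 2)))\<^sup>2 + (3 / 4) * (cmod (\<nu> ((x - t) / 2)))\<^sup>2 + 3 * (C * J)\<^sup>2) has_integral
        ((3 / 4) * integral {-x..x} (\<lambda>t. (cmod (\<mu> ((x + t) / 2)))\<^sup>2) + (3 / 4) * integral {-x..x} (\<lambda>t. (cmod (\<nu> ((x - t) / 2)))\<^sup>2)
        + (x - (- x)) *\<^sub>R (3 * (C * J)\<^sup>2))) {-x..x}"
        using x by (intro has_integral_add has_integral_mult_right integrable_integral integrable_continuous_real c1 has_integral_const_real[THEN has_integral_eq_rhs]) auto
      then show ?thesis by (simp add: integral_unique)
    qed
    also have "\<dots> = (3 / 2) * integral {0..x} (\<lambda>z. (cmod (\<mu> z))\<^sup>2) + (3 / 2) * integral {0..x} (\<lambda>z. (cmod (\<nu> z))\<^sup>2) + 6 * x * C\<^sup>2 * J\<^sup>2"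
      using integral_half_affine[of x "\<lambda>z. (cmod (\<mu> z))\<^sup>2"] integral_half_affine[of x "\<lambda>z. (cmod (\<nu> z))\<^sup>2"] x
        continuous_on_subset[OF cm2, of "{0..x}"] continuous_on_subset[OF cn2, of "{0..x}"]
      by (simp add: power_mult_distrib)
    also have "\<dots> \<le> (3 / 2) * N1 + (3 / 2) * N2 + 6 * b * C\<^sup>2 * (2 * b * (N1 + N2))"
      using sub x J2 b by (intro add_mono mult_left_mono mult_mono) auto
    also have "\<dots> = (3 / 2 + 12 * b\<^sup>2 * C\<^sup>2) * (N1 + N2)"
      by (simp add: algebra_simps power2_eq_square)
    \<comment> \<open>The parallelogram law leads back from the boundary errors to the
      residuals.\<close>
    also have "N1 + N2 = 2 * (integral {0..b} (\<lambda>z. (cmod (e1 z))\<^sup>2) + integral {0..b} (\<lambda>z. (cmod (e2 z))\<^sup>2))"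
    proof -
      have "N1 + N2 = integral {0..b} (\<lambda>z. (cmod (\<mu> z))\<^sup>2 + (cmod (\<nu> z))\<^sup>2)"
        unfolding N1_def N2_def
        by (rule Henstock_Kurzweil_Integration.integral_add[symmetric]) (intro integrable_continuous_real cm2 cn2)+
      also have "\<dots> = integral {0..b} (\<lambda>z. 2 * ((cmod (e1 z))\<^sup>2 + (cmod (e2 z))\<^sup>2))"
        by (intro integral_cong) (simp add: \<mu>_def \<nu>_def cmod_power2, simp add: power2_eq_square algebra_simps)
      also have "\<dots> = 2 * (integral {0..b} (\<lambda>z. (cmod (e1 z))\<^sup>2) + integral {0..b} (\<lambda>z. (cmod (e2 z))\<^sup>2))"
        unfolding integral_mult_right
        by (subst Henstock_Kurzweil_Integration.integral_add) (auto intro!: integrable_continuous_real continuous_intros ce1 ce2)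
      finally show ?thesis .
    qed
    finally show ?thesis by (simp add: e1_def e2_def algebra_simps)
  qed
  moreover have "3 + 24 * b\<^sup>2 * C\<^sup>2 \<ge> 0" by simp
  ultimately show ?thesis using that by blast
qed

end

section \<open>Approximate kernels as even and odd parts of mixed polynomials\<close>

text \<open>Even powers of \<open>t\<close> carry \<open>F\<close> in \<open>mixed_wave F G\<close>,
  odd ones carry it in \<open>mixed_wave G F\<close>. Hence the even part here and the odd part in
  the next lemma contain \<open>F\<close> alone, whatever \<open>G\<close> is.\<close>

lemma wave_poly_odd_index_mixed:
  assumes "n \<ge> 1"
  shows "wave_poly F (2 * n - 1) x t = (mixed_wave F G n x t + mixed_wave F G n x (- t)) / 2"
proof -
  have "(mixed_wave F G n x t + mixed_wave F G n x (- t)) / 2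
      = (\<Sum>k\<le>n. if even k then of_nat (n choose k) * F (n - k) x * of_real t ^ k else 0)"
    unfolding mixed_wave_def sum.distrib[symmetric] sum_divide_distrib
    by (intro sum.cong refl) (auto simp: power_minus[of "complex_of_real t"])
  also have "\<dots> = (\<Sum>k\<in>{k\<in>{0..n}. even k}. of_nat (n choose k) * F (n - k) x * of_real t ^ k)"
    by (rule sum.mono_neutral_cong_right) auto
  finally show ?thesis using wave_poly_odd_index[OF assms] by simp
qed

lemma wave_poly_even_index_mixed:
  assumes "n \<ge> 1"
  shows "wave_poly F (2 * n) x t = (mixed_wave G F n x t - mixed_wave G F n x (- t)) / 2"
proof -
  have "(mixed_wave G F n x t - mixed_wave G F n x (- t)) / 2
      = (\<Sum>k\<le>n. if odd k then of_nat (n choose k) * F (n - k) x * of_real t ^ k else 0)"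
    unfolding mixed_wave_def sum_subtractf[symmetric] sum_divide_distrib
    by (intro sum.cong refl) (auto simp: power_minus[of "complex_of_real t"])
  also have "\<dots> = (\<Sum>k\<in>{k\<in>{1..n}. odd k}. of_nat (n choose k) * F (n - k) x * of_real t ^ k)"
    by (rule sum.mono_neutral_cong_right) (auto simp: Suc_le_eq odd_pos)
  finally show ?thesis using wave_poly_even_index[OF assms] by simp
qed

definition coeff_poly :: "nat \<Rightarrow> (nat \<Rightarrow> complex) \<Rightarrow> complex poly" where
  "coeff_poly N a = (\<Sum>n\<le>N. monom (a n) n)"

lemma coeff_coeff_poly: "coeff (coeff_poly N a) n = (if n \<le> N then a n else 0)"
  by (simp add: coeff_poly_def coeff_sum)

lemma degree_coeff_poly: "degree (coeff_poly N a) \<le> N"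
  by (rule degree_le) (simp add: coeff_coeff_poly)

lemma mixed_poly_coeff_poly: "mixed_poly F G (coeff_poly N a) x t = (\<Sum>n\<le>N. a n * mixed_wave F G n x t)"
  by (simp add: mixed_poly_altdef[OF degree_coeff_poly] coeff_coeff_poly)

text \<open>The index 0 is where care is needed: the constant term of the first polynomial yields
  \<open>a 0 * phi f 0 x\<close> in the even part, while that of the second cancels in the odd
  part.\<close>

lemma approx_K_f_mixed:
  "approx_K_f f N a d x t =
    (mixed_poly (phi f) (psi f) (coeff_poly N a) x t + mixed_poly (phi f) (psi f) (coeff_poly N a) x (- t)) / 2 +
    (mixed_poly (psi f) (phi f) (coeff_poly N d) x t - mixed_poly (psi f) (phi f) (coeff_poly N d) x (- t)) / 2"
proof -
  have split: "(\<Sum>n\<le>N. g n) = g 0 + (\<Sum>n=1..N. g n)" for g :: "nat \<Rightarrow> complex"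
    by (simp add: sum.atLeast_Suc_atMost atMost_atLeast0)
  have 1: "(\<Sum>n=1..N. a n * u_poly f (2 * n - 1) x t) = ((\<Sum>n=1..N. a n * mixed_wave (phi f) (psi f) n x t) + (\<Sum>n=1..N. a n * mixed_wave (phi f) (psi f) n x (- t))) / 2"
    unfolding u_poly_def sum.distrib[symmetric] distrib_left[symmetric] sum_divide_distrib
    by (intro sum.cong refl) (subst wave_poly_odd_index_mixed[of _ _ _ _ "psi f"], auto)
  have 2: "(\<Sum>n=1..N. d n * u_poly f (2 * n) x t) = ((\<Sum>n=1..N. d n * mixed_wave (psi f) (phi f) n x t) - (\<Sum>n=1..N. d n * mixed_wave (psi f) (phi f) n x (- t))) / 2"
    unfolding u_poly_def sum_subtractf[symmetric] right_diff_distrib[symmetric] sum_divide_distrib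
    by (intro sum.cong refl) (subst wave_poly_even_index_mixed[of _ _ _ _ "psi f"], auto)
  have 3: "u_poly f 0 x t = phi f 0 x" by (simp add: u_poly_def wave_poly_0)
  show ?thesis
    unfolding approx_K_f_def mixed_poly_coeff_poly split 1 2 3
    by (simp add: mixed_wave_def[of _ _ 0] field_simps)
qed

text \<open>Subtracting this from \<open>approx_K_f_mixed\<close> leaves the sum of the two mixed
  polynomials at \<open>t\<close>, adding leaves their difference at \<open>- t\<close>: the
  approximate counterparts of \<open>m\<close> and \<open>s\<close> in
  \<open>kernel_error_bound\<close>.\<close>

lemma approx_K_inv_f_mixed:
  "approx_K_inv_f f N a d x t =
    - (mixed_poly (phi f) (psi f) (coeff_poly N a) x t - mixed_poly (phi f) (psi f) (coeff_poly N a) x (- t)) / 2 -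
    (mixed_poly (psi f) (phi f) (coeff_poly N d) x t + mixed_poly (psi f) (phi f) (coeff_poly N d) x (- t)) / 2"
proof -
  have split: "(\<Sum>n\<le>N. g n) = g 0 + (\<Sum>n=1..N. g n)" for g :: "nat \<Rightarrow> complex"
    by (simp add: sum.atLeast_Suc_atMost atMost_atLeast0)
  have 1: "(\<Sum>n=1..N. d n * v_poly f (2 * n - 1) x t) = ((\<Sum>n=1..N. d n * mixed_wave (psi f) (phi f) n x t) + (\<Sum>n=1..N. d n * mixed_wave (psi f) (phi f) n x (- t))) / 2"
    unfolding v_poly_def sum.distrib[symmetric] distrib_left[symmetric] sum_divide_distrib
    by (intro sum.cong refl) (subst wave_poly_odd_index_mixed[of _ _ _ _ "phi f"], auto)
  have 2: "(\<Sum>n=1..N. a n * v_poly f (2 * n) x t) = ((\<Sum>n=1..N. a n * mixed_wave (phi f) (psi f) n x t) - (\<Sum>n=1..N. a n * mixed_wave (phi f) (psi f) n x (- t))) / 2"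
    unfolding v_poly_def sum_subtractf[symmetric] right_diff_distrib[symmetric] sum_divide_distrib
    by (intro sum.cong refl) (subst wave_poly_even_index_mixed[of _ _ _ _ "phi f"], auto)
  have 3: "v_poly f 0 x t = psi f 0 x" by (simp add: v_poly_def wave_poly_0)
  show ?thesis
    unfolding approx_K_inv_f_def mixed_poly_coeff_poly split 1 2 3
    by (simp add: mixed_wave_def[of _ _ 0] field_simps)
qed

section \<open>The system generated by \<open>f\<close> and its least squares functionals\<close>

context
  fixes b :: real and f f' :: "real \<Rightarrow> complex"
  assumes b: "b > 0"
    and f': "\<And>x. x \<in> {0..b} \<Longrightarrow> (f has_vector_derivative f' x) (at x within {0..b})"
    and cf': "continuous_on {0..b} f'"
    and nz: "\<And>x. x \<in> {0..b} \<Longrightarrow> f x \<noteq> 0"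
    and f0: "f 0 = 1"
begin

lemma powi_minus_one_power: "z powi ((-1) ^ n) = (if even n then z else inverse z)" for z :: complex
  by simp

lemma formal_X_derivative: "x \<in> {0..b} \<Longrightarrow> (formal_X f (Suc n) has_vector_derivative
      of_nat (Suc n) * (formal_X f n x * ((f x)\<^sup>2) powi ((-1) ^ Suc n))) (at x within {0..b})"
  and formal_Xt_derivative: "x \<in> {0..b} \<Longrightarrow> (formal_Xt f (Suc n) has_vector_derivative
      of_nat (Suc n) * (formal_Xt f n x * ((f x)\<^sup>2) powi ((-1) ^ n))) (at x within {0..b})"
proof -
  have cf: "continuous_on {0..b} f" using f' by (rule continuous_on_vector_derivative)
  have w: "continuous_on {0..b} (\<lambda>s. ((f s)\<^sup>2) powi ((-1) ^ k))" for k :: nat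
    unfolding powi_minus_one_power using nz by (cases "even k") (auto intro!: continuous_intros cf)
  have d: "((\<lambda>x. of_nat (Suc k) * integral {0..x} (\<lambda>s. g s * ((f s)\<^sup>2) powi ((-1) ^ j))) has_vector_derivative
      of_nat (Suc k) * (g x * ((f x)\<^sup>2) powi ((-1) ^ j))) (at x within {0..b})"
    if "continuous_on {0..b} g" "x \<in> {0..b}" for k j :: nat and g :: "real \<Rightarrow> complex" and x
    using that by (intro has_vector_derivative_mult_right integral_has_vector_derivative continuous_on_mult w) auto
  have X: "continuous_on {0..b} (formal_X f n)" for n
  proof (induction n)
    case (Suc n)
    show ?case using d[OF Suc, of _ n "Suc n"]
      by (intro continuous_on_vector_derivative[of _ _ "\<lambda>x. of_nat (Suc n) * (formal_X f n x * ((f x)\<^sup>2) powi ((-1) ^ Suc n))"])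
         (simp only: formal_X.simps)
  qed simp
  have Xt: "continuous_on {0..b} (formal_Xt f n)" for n
  proof (induction n)
    case (Suc n)
    show ?case using d[OF Suc, of _ n n]
      by (intro continuous_on_vector_derivative[of _ _ "\<lambda>x. of_nat (Suc n) * (formal_Xt f n x * ((f x)\<^sup>2) powi ((-1) ^ n))"])
         (simp only: formal_Xt.simps)
  qed simp
  show "(formal_X f (Suc n) has_vector_derivative
      of_nat (Suc n) * (formal_X f n x * ((f x)\<^sup>2) powi ((-1) ^ Suc n))) (at x within {0..b})"
    and "(formal_Xt f (Suc n) has_vector_derivative
      of_nat (Suc n) * (formal_Xt f n x * ((f x)\<^sup>2) powi ((-1) ^ n))) (at x within {0..b})" if "x \<in> {0..b}"
    unfolding formal_X.simps formal_Xt.simps by (rule d X Xt that)+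
qed

text \<open>The parities in \<open>phi\<close> and \<open>psi\<close> interlock: for odd
  \<open>n\<close>, differentiating \<open>formal_X f n\<close> produces the factor
  \<open>1 / f^2\<close>, and since \<open>n - 1\<close> is even,
  \<open>formal_X f (n - 1) x / f x\<close> is just \<open>psi f (n - 1) x\<close>. The other cases
  are analogous.\<close>

lemma phi_psi_formal_powers: "formal_powers b (\<lambda>x. f' x / f x) (phi f) (psi f)"
proof
  show "b > 0" by (rule b)
  have cf: "continuous_on {0..b} f" using f' by (rule continuous_on_vector_derivative)
  show "continuous_on {0..b} (\<lambda>x. f' x / f x)" using nz by (intro continuous_intros cf cf') auto
  show "phi f n 0 = (if n = 0 then 1 else 0)" "psi f n 0 = (if n = 0 then 1 else 0)" for n
    by (cases n; simp add: phi_def psi_def f0)+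
  fix x n assume x: "x \<in> {0..b}"
  have inv: "((\<lambda>x. inverse (f x)) has_vector_derivative - (f' x / (f x)\<^sup>2)) (at x within {0..b})"
    by (rule has_vector_derivative_inverse[OF f'[OF x] nz[OF x]])
  have X: "(formal_X f n has_vector_derivative of_nat n * (formal_X f (n - 1) x * (if even n then (f x)\<^sup>2 else inverse ((f x)\<^sup>2)))) (at x within {0..b})"
   and Xt: "(formal_Xt f n has_vector_derivative of_nat n * (formal_Xt f (n - 1) x * (if odd n then (f x)\<^sup>2 else inverse ((f x)\<^sup>2)))) (at x within {0..b})" for n
  proof -
    show "(formal_X f n has_vector_derivative of_nat n * (formal_X f (n - 1) x * (if even n then (f x)\<^sup>2 else inverse ((f x)\<^sup>2)))) (at x within {0..b})"
    proof (cases n)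
      case (Suc m)
      show ?thesis using formal_X_derivative[OF x, of m] unfolding Suc diff_Suc_1 powi_minus_one_power .
    qed simp
    show "(formal_Xt f n has_vector_derivative of_nat n * (formal_Xt f (n - 1) x * (if odd n then (f x)\<^sup>2 else inverse ((f x)\<^sup>2)))) (at x within {0..b})"
    proof (cases n)
      case (Suc m)
      show ?thesis using formal_Xt_derivative[OF x, of m] unfolding Suc diff_Suc_1 powi_minus_one_power even_Suc not_not .
    qed simp
  qed
  note fx = nz[OF x]
  show "(phi f n has_vector_derivative f' x / f x * phi f n x + of_nat n * psi f (n - 1) x) (at x within {0..b})"
  proof (cases "odd n")
    case True
    then have 1: "phi f n = (\<lambda>x. f x * formal_X f n x)" and 2: "psi f (n - 1) x = formal_X f (n - 1) x / f x"
      by (auto simp: phi_def psi_def fun_eq_iff)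
    show ?thesis unfolding 1 2
      by (rule has_vector_derivative_eq_rhs[OF has_vector_derivative_mult[OF f'[OF x] X]])
         (use fx True in \<open>simp add: field_simps power2_eq_square\<close>)
  next
    case False
    \<comment> \<open>For \<open>n = 0\<close> the truncated index \<open>n - 1\<close> has the
      wrong parity, hence the guard; the factor \<open>of_nat n\<close> removes that term.\<close>
    then have 1: "phi f n = (\<lambda>x. f x * formal_Xt f n x)" and 2: "n > 0 \<Longrightarrow> psi f (n - 1) x = formal_Xt f (n - 1) x / f x"
      by (auto simp: phi_def psi_def fun_eq_iff)
    show ?thesis unfolding 1
      by (rule has_vector_derivative_eq_rhs[OF has_vector_derivative_mult[OF f'[OF x] Xt]])
         (use fx False 2 in \<open>cases "n = 0"; simp add: field_simps power2_eq_square\<close>)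
  qed
  show "(psi f n has_vector_derivative - (f' x / f x) * psi f n x + of_nat n * phi f (n - 1) x) (at x within {0..b})"
  proof (cases "odd n")
    case True
    then have 1: "psi f n = (\<lambda>x. inverse (f x) * formal_Xt f n x)" and 2: "phi f (n - 1) x = formal_Xt f (n - 1) x * f x"
      by (auto simp: phi_def psi_def fun_eq_iff divide_inverse)
    show ?thesis unfolding 1 2
      by (rule has_vector_derivative_eq_rhs[OF has_vector_derivative_mult[OF inv Xt]])
         (use fx True in \<open>simp add: field_simps power2_eq_square\<close>)
  next
    case False
    then have 1: "psi f n = (\<lambda>x. inverse (f x) * formal_X f n x)" and 2: "n > 0 \<Longrightarrow> phi f (n - 1) x = formal_X f (n - 1) x * f x"
      by (auto simp: phi_def psi_def fun_eq_iff divide_inverse)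
    show ?thesis unfolding 1
      by (rule has_vector_derivative_eq_rhs[OF has_vector_derivative_mult[OF inv X]])
         (use fx False 2 in \<open>cases "n = 0"; simp add: field_simps power2_eq_square\<close>)
  qed
qed

text \<open>Since \<open>f * (g / f)' = g' - (f' / f) * g\<close>, passing to the quotient removes
  exactly the lower order term of the derivative of a trace.\<close>

lemma vector_derivative_quotient:
  assumes x: "x \<in> {0..b}" and g: "(g has_vector_derivative (f' x / f x * g x + D)) (at x within {0..b})"
  shows "f x * vector_derivative (\<lambda>y. g y / f y) (at x within {0..b}) = D"
proof -
  from has_vector_derivative_mult[OF g has_vector_derivative_inverse[OF f'[OF x] nz[OF x]]]
  have "((\<lambda>y. g y / f y) has_vector_derivative D / f x) (at x within {0..b})"
    using nz[OF x] by (simp add: divide_inverse power2_eq_square algebra_simps)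
  then have "vector_derivative (\<lambda>y. g y / f y) (at x within {0..b}) = D / f x"
    using b x by (intro vector_derivative_within_closed_interval)
  then show ?thesis using nz[OF x] by simp
qed

text \<open>\<open>s_trace\<close> is half the difference of a mixed wave of the swapped system on
  \<open>t = x\<close> and on \<open>t = -x\<close>. Only the first line contributes a wave of lower
  index, with factor 2, and the reflected terms recombine into \<open>p * s_trace\<close>. So the
  first problem fits \<open>p / 2\<close> by traces of mixed polynomials with coefficients
  \<open>a\<close>.\<close>

lemma s_trace_quotient_derivative:
  assumes x: "x \<in> {0..b}"
  shows "f x * vector_derivative (\<lambda>y. s_trace f (n + 1) y / f y) (at x within {0..b})
     = of_nat (n + 1) * mixed_wave (phi f) (psi f) n x x"
proof (rule vector_derivative_quotient[OF x])
  interpret formal_powers b "\<lambda>x. - (f' x / f x)" "psi f" "phi f"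
    by (rule formal_powers.swap[OF phi_psi_formal_powers])
  have s: "s_trace f (n + 1) = (\<lambda>y. (1 / 2) * (mixed_wave (psi f) (phi f) (n + 1) y (0 + 1 * y) - mixed_wave (psi f) (phi f) (n + 1) y (0 + (-1) * y)))"
    using wave_poly_even_index_mixed[of "n + 1" "phi f" _ _ "psi f"] by (simp add: s_trace_def u_poly_def fun_eq_iff)
  show "(s_trace f (n + 1) has_vector_derivative f' x / f x * s_trace f (n + 1) x + of_nat (n + 1) * mixed_wave (phi f) (psi f) n x x) (at x within {0..b})"
    unfolding s
    using has_vector_derivative_mult_right[OF has_vector_derivative_diff[OF
        mixed_wave_derivative[OF x, of "n + 1" 0 1] mixed_wave_derivative[OF x, of "n + 1" 0 "-1"]], of "1 / 2"]
    by (rule has_vector_derivative_eq_rhs) (simp add: algebra_simps)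
qed

lemma c_trace_quotient_derivative:
  assumes x: "x \<in> {0..b}"
  shows "f x * vector_derivative (\<lambda>y. c_trace f (n + 1) y / f y) (at x within {0..b})
     = of_nat (n + 1) * mixed_wave (psi f) (phi f) n x x"
proof (rule vector_derivative_quotient[OF x])
  interpret formal_powers b "\<lambda>x. f' x / f x" "phi f" "psi f"
    by (rule phi_psi_formal_powers)
  have c: "c_trace f (n + 1) = (\<lambda>y. (1 / 2) * (mixed_wave (phi f) (psi f) (n + 1) y (0 + 1 * y) + mixed_wave (phi f) (psi f) (n + 1) y (0 + (-1) * y)))"
    using wave_poly_odd_index_mixed[of "n + 1" "phi f" _ _ "psi f"] by (simp add: c_trace_def u_poly_def fun_eq_iff)
  show "(c_trace f (n + 1) has_vector_derivative f' x / f x * c_trace f (n + 1) x + of_nat (n + 1) * mixed_wave (psi f) (phi f) n x x) (at x within {0..b})"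
    unfolding c
    using has_vector_derivative_mult_right[OF has_vector_derivative_add[OF
        mixed_wave_derivative[OF x, of "n + 1" 0 1] mixed_wave_derivative[OF x, of "n + 1" 0 "-1"]], of "1 / 2"]
    by (rule has_vector_derivative_eq_rhs) (simp add: algebra_simps)
qed

lemma ls_residual_mixed:
  assumes F: "formal_powers b p F G"
    and w: "\<And>n x. x \<in> {0..b} \<Longrightarrow> f x * vector_derivative (\<lambda>y. w (n + 1) y / f y) (at x within {0..b}) = of_nat (n + 1) * mixed_wave F G n x x"
  shows "ls_residual b f f' w N a =
    sqrt (integral {0..b} (\<lambda>z. (cmod (f' z / f z / 2 - mixed_poly F G (coeff_poly N a) z z))\<^sup>2))"
proof -
  interpret formal_powers b p F G by fact
  have cf: "continuous_on {0..b} f" using f' by (rule continuous_on_vector_derivative)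
  have "ls_residual b f f' w N a = L2_norm 0 b (\<lambda>z. f' z / f z / 2 - mixed_poly F G (coeff_poly N a) z z)"
    unfolding ls_residual_def
  proof (rule L2_norm_cong)
    fix x assume "0 < x" "x < b"
    then have "a n / of_nat (n + 1) * (f x * vector_derivative (\<lambda>y. w (n + 1) y / f y) (at x within {0..b})) = a n * mixed_wave F G n x x" for n
      by (subst w) (auto simp del: of_nat_Suc)
    then show "f' x / (2 * f x) - (\<Sum>n=0..N. a n / of_nat (n + 1) * (f x * vector_derivative (\<lambda>y. w (n + 1) y / f y) (at x within {0..b})))
        = f' x / f x / 2 - mixed_poly F G (coeff_poly N a) x x"
      by (simp add: mixed_poly_coeff_poly atMost_atLeast0 mult.commute)
  qed
  also have "\<dots> = sqrt (integral {0..b} (\<lambda>z. (cmod (f' z / f z / 2 - mixed_poly F G (coeff_poly N a) z z))\<^sup>2))"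
    using b nz mixed_poly_continuous_line[of "coeff_poly N a" 0 1]
    by (intro L2_norm_continuous) (auto intro!: continuous_intros cf cf')
  finally show ?thesis .
qed

text \<open>Every polynomial of degree at most \<open>N\<close> competes in the minimisation through
  its coefficients.\<close>

lemma least_squares_residual_le:
  assumes F: "formal_powers b p F G"
    and w: "\<And>n x. x \<in> {0..b} \<Longrightarrow> f x * vector_derivative (\<lambda>y. w (n + 1) y / f y) (at x within {0..b}) = of_nat (n + 1) * mixed_wave F G n x x"
    and a: "least_squares_solution b f f' w N a" and q: "degree q \<le> N"
  shows "integral {0..b} (\<lambda>z. (cmod (f' z / f z / 2 - mixed_poly F G (coeff_poly N a) z z))\<^sup>2)
    \<le> integral {0..b} (\<lambda>z. (cmod (f' z / f z / 2 - mixed_poly F G q z z))\<^sup>2)"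
proof -
  have "coeff_poly N (coeff q) = q"
    using q by (intro poly_eqI) (auto simp: coeff_coeff_poly coeff_eq_0)
  moreover have "ls_residual b f f' w N a \<le> ls_residual b f f' w N (coeff q)"
    using a unfolding least_squares_solution_def is_arg_min_def by (meson not_le)
  ultimately show ?thesis by (simp only: ls_residual_mixed[OF F w] real_sqrt_le_iff)
qed

end

section \<open>The convergence rate of the approximate kernels\<close>

theorem corollary8p2:
  fixes b :: real and r :: nat
    and q1 q2 f f' f'' :: "real \<Rightarrow> complex" and h :: complex
    and K_f K_inv_f :: "real \<Rightarrow> real \<Rightarrow> complex"
  assumes "b > 0"
    and "Cr_on r {0..b} q1"
    and "\<And>x. x \<in> {0..b} \<Longrightarrow> (f has_vector_derivative f' x) (at x within {0..b})"
    and "\<And>x. x \<in> {0..b} \<Longrightarrow> (f' has_vector_derivative f'' x) (at x within {0..b})"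
    and "\<And>x. x \<in> {0..b} \<Longrightarrow> - f'' x + q1 x * f x = 0"
    and "\<And>x. x \<in> {0..b} \<Longrightarrow> f x \<noteq> 0"
    and "f 0 = 1"
    and "h = f' 0"
    and "q2 = darboux_potential q1 f f'"
    and "transmutation_kernel b q1 h K_f"
    and "transmutation_kernel b q2 (- h) K_inv_f"
  shows "\<exists>C::real. \<forall>N>r. \<forall>a d :: nat \<Rightarrow> complex.
    least_squares_solution b f f' (s_trace f) N a \<longrightarrow>
    least_squares_solution b f f' (c_trace f) N d \<longrightarrow>
    (\<forall>x\<in>{0..b}.
       L2_norm (- x) x (\<lambda>t. K_f x t - approx_K_f f N a d x t) < C / real N ^ (r + 1) \<and>
       L2_norm (- x) x (\<lambda>t. K_inv_f x t - approx_K_inv_f f N a d x t) < C / real N ^ (r + 1))"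
proof -
  note b = assms(1) and f' = assms(3) and nz = assms(6)
  have cf': "continuous_on {0..b} f'" using assms(4) by (rule continuous_on_vector_derivative)
  define p where "p = (\<lambda>x. f' x / f x)"
  interpret formal_powers b p "phi f" "psi f"
    unfolding p_def by (rule phi_psi_formal_powers[OF b f' cf' nz assms(7)])
  have p': "(p has_vector_derivative (q1 x - (p x)\<^sup>2)) (at x within {0..b})" if x: "x \<in> {0..b}" for x
  proof -
    from has_vector_derivative_mult[OF assms(4)[OF x] has_vector_derivative_inverse[OF f'[OF x] nz[OF x]]]
    have "((\<lambda>x. f' x * inverse (f x)) has_vector_derivative f' x * - (f' x / (f x)\<^sup>2) + f'' x * inverse (f x)) (at x within {0..b})" .
    moreover have "f'' x * inverse (f x) = q1 x" using assms(5)[OF x] nz[OF x] by (simp add: field_simps)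
    ultimately show ?thesis by (simp add: p_def divide_inverse power2_eq_square mult_ac)
  qed
  \<comment> \<open>Bootstrapping in the Riccati equation: if \<open>p\<close> is \<open>C^k\<close>
    with \<open>k \<le> r\<close>, then so is \<open>q1 - p^2\<close>, and \<open>p\<close> is of
    class \<open>C^(k+1)\<close>.\<close>
  have pk: "k \<le> r + 1 \<Longrightarrow> Cr_on k {0..b} p" for k
  proof (induction k)
    case (Suc k)
    then have "Cr_on k {0..b} (\<lambda>x. q1 x - p x * p x)"
      using Cr_on_le[OF assms(2), of k] by (intro Cr_on_diff Cr_on_mult) auto
    then show ?case using p' unfolding Cr_on.simps
      by (intro exI[of _ "\<lambda>x. q1 x - p x * p x"]) (simp add: power2_eq_square)
  qed (simp add: p)
  have "Cr_on (r + 1) {0..b} (\<lambda>x. (1 / 2) * p x)" by (intro Cr_on_mult Cr_on_const pk) simp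
  then have gk: "Cr_on (r + 1) {0..b} (\<lambda>x. p x / 2)" by simp
  have mpk: "Cr_on (r + 1) {0..b} (\<lambda>x. - p x)"
    using Cr_on_diff[OF Cr_on_const[of "r + 1" "{0..b}" 0] pk[of "r + 1"]] by simp
  obtain C1 where C1: "\<And>N. N \<ge> r + 1 \<Longrightarrow> \<exists>q. degree q \<le> N \<and>
      integral {0..b} (\<lambda>x. (cmod (p x / 2 - mixed_poly (phi f) (psi f) q x x))\<^sup>2) \<le> (C1 / real N ^ (r + 1))\<^sup>2"
    using trace_approx_rate[OF formal_powers_axioms pk[OF order_refl] gk le_add2] by blast
  obtain C2 where C2: "\<And>N. N \<ge> r + 1 \<Longrightarrow> \<exists>q. degree q \<le> N \<and>
      integral {0..b} (\<lambda>x. (cmod (p x / 2 - mixed_poly (psi f) (phi f) q x x))\<^sup>2) \<le> (C2 / real N ^ (r + 1))\<^sup>2"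
    using trace_approx_rate[OF swap mpk gk le_add2] by blast
  define T where "T = {(\<xi>, \<eta>). 0 \<le> \<xi> \<and> 0 \<le> \<eta> \<and> \<xi> + \<eta> \<le> b}"
  define m where "m = (\<lambda>\<xi> \<eta>. K_f (\<xi> + \<eta>) (\<xi> - \<eta>) - K_inv_f (\<xi> + \<eta>) (\<xi> - \<eta>))"
  define s where "s = (\<lambda>\<xi> \<eta>. K_f (\<xi> + \<eta>) (\<xi> - \<eta>) + K_inv_f (\<xi> + \<eta>) (\<xi> - \<eta>))"
  have cq1: "continuous_on {0..b} q1" by (rule Cr_on_imp_continuous_on[OF assms(2)])
  have q2: "q2 x = 2 * (p x)\<^sup>2 - q1 x" for x by (simp add: assms(9) darboux_potential_def p_def)
  have K1: "transmutation_kernel b q1 (p 0) K_f" and K2: "transmutation_kernel b q2 (- p 0) K_inv_f"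
    using assms(7,8,10,11) by (simp_all add: p_def)
  have ks: "continuous_on T (\<lambda>(\<xi>, \<eta>). m \<xi> \<eta>)" "continuous_on T (\<lambda>(\<xi>, \<eta>). s \<xi> \<eta>)"
    "\<And>\<xi> \<eta>. (\<xi>, \<eta>) \<in> T \<Longrightarrow> m \<xi> \<eta> = p \<xi> + integral {0..\<eta>} (\<lambda>v. p (\<xi> + v) * s \<xi> v)"
    "\<And>\<xi> \<eta>. (\<xi>, \<eta>) \<in> T \<Longrightarrow> s \<xi> \<eta> = integral {0..\<xi>} (\<lambda>u. p (u + \<eta>) * m u \<eta>)"
    unfolding T_def m_def s_def
    by (rule transmutation_kernels_first_order[OF b cq1 p' q2 K1 K2]; assumption)+
  obtain C where C: "C \<ge> 0"
    "\<And>P Q E x. \<lbrakk>0 \<le> x; x \<le> b; continuous_on {-x..x} E;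
      \<And>t. t \<in> {-x..x} \<Longrightarrow> 2 * cmod (E t) \<le>
        cmod (m ((x + t) / 2) ((x - t) / 2) - (mixed_poly (phi f) (psi f) P x t + mixed_poly (psi f) (phi f) Q x t)) +
        cmod (s ((x + t) / 2) ((x - t) / 2) - (mixed_poly (phi f) (psi f) P x (- t) - mixed_poly (psi f) (phi f) Q x (- t)))\<rbrakk> \<Longrightarrow>
      integral {-x..x} (\<lambda>t. (cmod (E t))\<^sup>2) \<le>
        C * (integral {0..b} (\<lambda>z. (cmod (p z / 2 - mixed_poly (phi f) (psi f) P z z))\<^sup>2) +
             integral {0..b} (\<lambda>z. (cmod (p z / 2 - mixed_poly (psi f) (phi f) Q z z))\<^sup>2))"
    using kernel_error_bound[of m s, folded T_def, OF ks] by blast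
  \<comment> \<open>\<open>C1\<close> and \<open>C2\<close> measure the two minima and
    \<open>C\<close> the stability of the system. Replacing \<open>D\<close> by \<open>D + 1\<close>
    below makes the inequality strict.\<close>
  define D where "D = sqrt (C * (C1\<^sup>2 + C2\<^sup>2))"
  have "L2_norm (- x) x (\<lambda>t. K_f x t - approx_K_f f N a d x t) < (D + 1) / real N ^ (r + 1) \<and>
        L2_norm (- x) x (\<lambda>t. K_inv_f x t - approx_K_inv_f f N a d x t) < (D + 1) / real N ^ (r + 1)"
    if N: "N > r" and a: "least_squares_solution b f f' (s_trace f) N a"
      and d: "least_squares_solution b f f' (c_trace f) N d" and x: "x \<in> {0..b}" for N a d x
  proof -
    define P where "P = coeff_poly N a"
    define Q where "Q = coeff_poly N d"
    have N0: "real N > 0" using N by simp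
    obtain q where q: "degree q \<le> N"
      "integral {0..b} (\<lambda>x. (cmod (p x / 2 - mixed_poly (phi f) (psi f) q x x))\<^sup>2) \<le> (C1 / real N ^ (r + 1))\<^sup>2"
      using C1[of N] N by auto
    obtain q' where q': "degree q' \<le> N"
      "integral {0..b} (\<lambda>x. (cmod (p x / 2 - mixed_poly (psi f) (phi f) q' x x))\<^sup>2) \<le> (C2 / real N ^ (r + 1))\<^sup>2"
      using C2[of N] N by auto
    have e1: "integral {0..b} (\<lambda>z. (cmod (p z / 2 - mixed_poly (phi f) (psi f) P z z))\<^sup>2) \<le> (C1 / real N ^ (r + 1))\<^sup>2"
      using least_squares_residual_le[OF b f' cf' nz assms(7) formal_powers_axioms s_trace_quotient_derivative[OF b f' cf' nz assms(7)] a q(1)] q(2)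
      by (simp add: p_def P_def)
    have e2: "integral {0..b} (\<lambda>z. (cmod (p z / 2 - mixed_poly (psi f) (phi f) Q z z))\<^sup>2) \<le> (C2 / real N ^ (r + 1))\<^sup>2"
      using least_squares_residual_le[OF b f' cf' nz assms(7) swap c_trace_quotient_derivative[OF b f' cf' nz assms(7)] d q'(1)] q'(2)
      by (simp add: p_def Q_def)
    have final: "L2_norm (- x) x E < (D + 1) / real N ^ (r + 1)"
      if cE: "continuous_on {-x..x} E" and E: "\<And>t. t \<in> {-x..x} \<Longrightarrow> 2 * cmod (E t) \<le>
        cmod (m ((x + t) / 2) ((x - t) / 2) - (mixed_poly (phi f) (psi f) P x t + mixed_poly (psi f) (phi f) Q x t)) +
        cmod (s ((x + t) / 2) ((x - t) / 2) - (mixed_poly (phi f) (psi f) P x (- t) - mixed_poly (psi f) (phi f) Q x (- t)))" for E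
    proof -
      have "integral {-x..x} (\<lambda>t. (cmod (E t))\<^sup>2) \<le> C * ((C1 / real N ^ (r + 1))\<^sup>2 + (C2 / real N ^ (r + 1))\<^sup>2)"
        using x by (intro order_trans[OF C(2)[OF _ _ cE E]] mult_left_mono add_mono e1 e2 C(1)) auto
      also have "\<dots> = (D / real N ^ (r + 1))\<^sup>2"
        using C(1) by (simp add: D_def power_divide add_divide_distrib distrib_left)
      finally have "sqrt (integral {-x..x} (\<lambda>t. (cmod (E t))\<^sup>2)) \<le> D / real N ^ (r + 1)"
        using C(1) N0 by (intro real_le_lsqrt) (auto simp: D_def)
      also have "\<dots> < (D + 1) / real N ^ (r + 1)" using N0 by (intro divide_strict_right_mono) auto
      finally show ?thesis using L2_norm_continuous[OF _ cE] x by simp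
    qed
    have cc: "continuous_on {-x..x} (\<lambda>t. ((x + t) / 2, (x - t) / 2))" by (intro continuous_intros) auto
    have img: "(\<lambda>t. ((x + t) / 2, (x - t) / 2)) ` {-x..x} \<subseteq> T" using x by (auto simp: T_def field_simps)
    have cKs: "continuous_on {-x..x} (\<lambda>t. m ((x + t) / 2) ((x - t) / 2))" "continuous_on {-x..x} (\<lambda>t. s ((x + t) / 2) ((x - t) / 2))"
      using continuous_on_compose2[OF ks(1) cc img] continuous_on_compose2[OF ks(2) cc img] by simp_all
    have hx: "(x + t) / 2 + (x - t) / 2 = x" "(x + t) / 2 - (x - t) / 2 = t" for t
      by (auto simp: field_simps)
    have K: "K_f x t = (s ((x + t) / 2) ((x - t) / 2) + m ((x + t) / 2) ((x - t) / 2)) / 2"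
      "K_inv_f x t = (s ((x + t) / 2) ((x - t) / 2) - m ((x + t) / 2) ((x - t) / 2)) / 2" for t
      unfolding m_def s_def hx by simp_all
    interpret sw: formal_powers b "\<lambda>x. - p x" "psi f" "phi f" by (rule swap)
    have cP: "continuous_on {-x..x} (\<lambda>t. mixed_poly (phi f) (psi f) P x (g t))" "continuous_on {-x..x} (\<lambda>t. mixed_poly (psi f) (phi f) Q x (g t))"
      if g: "continuous_on {-x..x} g" for g
    proof -
      have c: "continuous_on {-x..x} (\<lambda>t. (x, g t))" by (intro continuous_intros g)
      have i: "(\<lambda>t. (x, g t)) ` {-x..x} \<subseteq> {0..b} \<times> UNIV" using x by auto
      show "continuous_on {-x..x} (\<lambda>t. mixed_poly (phi f) (psi f) P x (g t))" "continuous_on {-x..x} (\<lambda>t. mixed_poly (psi f) (phi f) Q x (g t))"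
        using continuous_on_compose2[OF mixed_poly_continuous c i] continuous_on_compose2[OF sw.mixed_poly_continuous c i] by simp_all
    qed
    \<comment> \<open>Twice the error of a kernel is the sum of the errors of \<open>m\<close> and
      \<open>s\<close> for \<open>K_f\<close>, and the error of \<open>s\<close> minus that of
      \<open>m\<close> for \<open>K_inv_f\<close>.\<close>
    have half: "2 * cmod E \<le> cmod u + cmod v" if "2 * E = u + v \<or> 2 * E = v - u" for E u v :: complex
    proof -
      have e: "2 * cmod E = cmod (2 * E)" by (simp add: norm_mult)
      have "cmod (u + v) \<le> cmod u + cmod v" "cmod (v - u) \<le> cmod u + cmod v"
        using norm_triangle_ineq[of u v] norm_triangle_ineq4[of v u] by simp_all
      then show ?thesis unfolding e using that by (elim disjE) (simp_all only:)
    qed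
    have alg: "2 * ((c + d) / 2 - ((P1 + P2) / 2 + (Q1 - Q2) / 2)) = (d - (P1 + Q1)) + (c - (P2 - Q2))"
      "2 * ((c - d) / 2 - (- (P1 - P2) / 2 - (Q1 + Q2) / 2)) = (c - (P2 - Q2)) - (d - (P1 + Q1))"
      for c d P1 P2 Q1 Q2 :: complex
      by (simp_all add: field_simps)
    show ?thesis
    proof (intro conjI final)
      show "continuous_on {-x..x} (\<lambda>t. K_f x t - approx_K_f f N a d x t)"
        "continuous_on {-x..x} (\<lambda>t. K_inv_f x t - approx_K_inv_f f N a d x t)"
        unfolding K approx_K_f_mixed approx_K_inv_f_mixed P_def[symmetric] Q_def[symmetric]
        by (intro continuous_intros cKs cP; simp)+
      show "2 * cmod (K_f x t - approx_K_f f N a d x t) \<le>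
        cmod (m ((x + t) / 2) ((x - t) / 2) - (mixed_poly (phi f) (psi f) P x t + mixed_poly (psi f) (phi f) Q x t)) +
        cmod (s ((x + t) / 2) ((x - t) / 2) - (mixed_poly (phi f) (psi f) P x (- t) - mixed_poly (psi f) (phi f) Q x (- t)))" for t
        unfolding K approx_K_f_mixed P_def[symmetric] Q_def[symmetric]
        by (rule half, rule disjI1, rule alg)
      show "2 * cmod (K_inv_f x t - approx_K_inv_f f N a d x t) \<le>
        cmod (m ((x + t) / 2) ((x - t) / 2) - (mixed_poly (phi f) (psi f) P x t + mixed_poly (psi f) (phi f) Q x t)) +
        cmod (s ((x + t) / 2) ((x - t) / 2) - (mixed_poly (phi f) (psi f) P x (- t) - mixed_poly (psi f) (phi f) Q x (- t)))" for t
        unfolding K approx_K_inv_f_mixed P_def[symmetric] Q_def[symmetric]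
        by (rule half, rule disjI2, rule alg)
    qed
  qed
  then show ?thesis by blast
qed

end
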